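(* Let $(M,\varphi)$ be an integrable $G_2$ manifold of constant type with characteristic connection $\nabla$, torsion 3-form $T$, curvature $R$ and Ricci tensor $Ric$ of $\nabla$. The following conditions are equivalent: a) The characteristic connection has curvature $R\in S^2\Lambda^2$, i.e. $R(X,Y,Z,V)=R(Z,V,X,Y)$, with vanishing characteristic Ricci tensor, $Ric=0$; b) The curvature of the characteristic connection satisfies the Riemannian first Bianchi identity $R(X,Y,Z,V)+R(Y,Z,X,V)+R(Z,X,Y,V)=0$; c) The torsion 3-form is parallel with respect to the Levi-Civita and to the characteristic connections simultaneously, $\nabla^gT=\nabla T=0$. In these cases the exterior derivative $d\varphi$ of the $G_2$-form $\varphi$ is $\nabla$-parallel, $\nabla(d\varphi)=0$.
   Context: A $G_2$ structure on a smooth 7-manifold $M$ is a 3-form $\varphi$ which near each point has, in a suitable local coframe $e_1,\dots,e_7$, the form $\varphi=e_{127}+e_{135}-e_{146}-e_{236}-e_{245}+e_{347}+e_{567}$, where $e_{ijk}=e_i\wedge e_j\wedge e_k$. It determines a Riemannian metric $g$ and an orientation for which such coframes are oriented orthonormal; $*$ is the Hodge star and $\nabla^g$ the Levi-Civita connection. The scalar product $(d\varphi,*\varphi)$ is the pointwise one on 4-forms, so $d\varphi\wedge\varphi=(d\varphi,*\varphi)\,vol$. The Lee form is $\theta=-\frac13*( *d\varphi\wedge\varphi)$. The $G_2$ structure is integrable if $d{*}\varphi=\theta\wedge{*}\varphi$. It is then of constant type if the function $(d\varphi,*\varphi)$ is constant. On an integrable $G_2$ manifold there is a unique metric connection $\nabla$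 with $\nabla\varphi=0$ whose torsion $T(X,Y,Z)=g(\nabla_XY-\nabla_YX-[X,Y],Z)$ is a 3-form (the characteristic connection); $g(\nabla_XY,Z)=g(\nabla^g_XY,Z)+\frac12T(X,Y,Z)$ and $T=-*d\varphi+*(\theta\wedge\varphi)+\frac16(d\varphi,*\varphi)\varphi$. Curvature: $R(X,Y)Z=[\nabla_X,\nabla_Y]Z-\nabla_{[X,Y]}Z$, $R(X,Y,Z,V)=g(R(X,Y)Z,V)$; the characteristic Ricci tensor is $Ric(X,Y)=\sum_iR(e_i,X,Y,e_i)$ for an orthonormal frame $e_i$. *)

theory Defs
  imports "HOL-Analysis.Analysis"
begin

section \<open>Exterior algebra of the coordinate space\<close>

text \<open>A covariant tensor on \<open>\<real>\<^sup>7\<close> is a function of the list of its arguments. Forms of degree \<open>k\<close>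
  vanish on lists of any other length, so the operations below need no degree argument.\<close>

type_synonym tensor = "(real^7) list \<Rightarrow> real"

definition is_form :: "nat \<Rightarrow> tensor \<Rightarrow> bool" where
  "is_form k \<omega> \<longleftrightarrow>
     (\<forall>vs. length vs \<noteq> k \<longrightarrow> \<omega> vs = 0) \<and>
     (\<forall>vs i. length vs = k \<and> i < k \<longrightarrow> linear (\<lambda>v. \<omega> (vs[i := v]))) \<and>
     (\<forall>vs. length vs = k \<and> \<not> distinct vs \<longrightarrow> \<omega> vs = 0)"

definition tensor1 :: "(real^7 \<Rightarrow> real) \<Rightarrow> tensor" where
  "tensor1 f = (\<lambda>vs. if length vs = 1 then f (vs ! 0) else 0)"

definition tensor2 :: "(real^7 \<Rightarrow> real^7 \<Rightarrow> real) \<Rightarrow> tensor" where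
  "tensor2 f = (\<lambda>vs. if length vs = 2 then f (vs ! 0) (vs ! 1) else 0)"

definition tensor3 :: "(real^7 \<Rightarrow> real^7 \<Rightarrow> real^7 \<Rightarrow> real) \<Rightarrow> tensor" where
  "tensor3 f = (\<lambda>vs. if length vs = 3 then f (vs ! 0) (vs ! 1) (vs ! 2) else 0)"

text \<open>\<open>S\<close> is the set of positions given to the first factor; the sign is that of the corresponding
  shuffle, so that \<open>(\<alpha> \<and> \<beta>) [u, v] = \<alpha> [u] * \<beta> [v] - \<alpha> [v] * \<beta> [u]\<close> for 1-forms.\<close>

definition wedge :: "tensor \<Rightarrow> tensor \<Rightarrow> tensor" where
  "wedge \<alpha> \<beta> = (\<lambda>vs. \<Sum>S\<in>Pow {..<length vs}.
     (- 1) ^ card {(i, j). i \<in> {..<length vs} - S \<and> j \<in> S \<and> i < j}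
       * \<alpha> (nths vs S) * \<beta> (nths vs (- S)))"

text \<open>A coframe is an invertible matrix \<open>E\<close> whose rows are the 1-forms \<open>e\<^sub>1, \<dots>, e\<^sub>7\<close>.
  In the index type \<open>7\<close> the numeral 7 denotes 0.\<close>

definition coform :: "real^7^7 \<Rightarrow> 7 \<Rightarrow> tensor" where
  "coform E i = tensor1 (\<lambda>v. (E *v v) $ i)"

definition coforms :: "real^7^7 \<Rightarrow> 7 list \<Rightarrow> tensor" where
  "coforms E I = foldr (\<lambda>i. wedge (coform E i)) I (\<lambda>vs. if vs = [] then 1 else 0)"

definition frame :: "real^7^7 \<Rightarrow> 7 \<Rightarrow> real^7" where
  "frame E i = column i (matrix_inv E)"

definition incr_indices :: "7 list list" where
  "incr_indices = subseqs [1, 2, 3, 4, 5, 6, 7]"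

text \<open>Scalar product of forms and Hodge star for which \<open>e\<^sub>1, \<dots>, e\<^sub>7\<close> is oriented orthonormal:
  the forms \<open>e\<^sub>I\<close>, \<open>I\<close> increasing, are orthonormal, and \<open>*e\<^sub>I\<close> is the contraction of
  \<open>e\<^sub>1 \<and> \<dots> \<and> e\<^sub>7\<close> with the dual frame vectors of \<open>I\<close>, whence
  \<open>e\<^sub>I \<and> *e\<^sub>I = e\<^sub>1 \<and> \<dots> \<and> e\<^sub>7\<close>.\<close>

definition coframe_inner :: "real^7^7 \<Rightarrow> tensor \<Rightarrow> tensor \<Rightarrow> real" where
  "coframe_inner E \<alpha> \<beta> =
     (\<Sum>I\<leftarrow>incr_indices. \<alpha> (map (frame E) I) * \<beta> (map (frame E) I))"

definition coframe_star :: "real^7^7 \<Rightarrow> tensor \<Rightarrow> tensor" where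
  "coframe_star E \<alpha> = (\<lambda>vs. \<Sum>I\<leftarrow>incr_indices.
     \<alpha> (map (frame E) I) * coforms E [1, 2, 3, 4, 5, 6, 7] (map (frame E) I @ vs))"


section \<open>\<open>G\<^sub>2\<close> linear algebra\<close>

definition g2_model :: "real^7^7 \<Rightarrow> tensor" where
  "g2_model E = (\<lambda>vs.
     coforms E [1, 2, 7] vs + coforms E [1, 3, 5] vs - coforms E [1, 4, 6] vs
   - coforms E [2, 3, 6] vs - coforms E [2, 4, 5] vs + coforms E [3, 4, 7] vs
   + coforms E [5, 6, 7] vs)"

definition g2_adapted :: "tensor \<Rightarrow> real^7^7 \<Rightarrow> bool" where
  "g2_adapted \<phi> E \<longleftrightarrow> invertible E \<and> \<phi> = g2_model E"

text \<open>Two coframes adapted to the same form differ by an element of the stabilizer \<open>G\<^sub>2\<close> of the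
  model form, which is contained in \<open>SO(7)\<close>; hence metric, scalar product and Hodge star below do
  not depend on the coframe selected here.\<close>

definition g2_coframe :: "tensor \<Rightarrow> real^7^7" where
  "g2_coframe \<phi> = (SOME E. g2_adapted \<phi> E)"

definition g2_metric :: "tensor \<Rightarrow> real^7 \<Rightarrow> real^7 \<Rightarrow> real" where
  "g2_metric \<phi> u v = (g2_coframe \<phi> *v u) \<bullet> (g2_coframe \<phi> *v v)"

definition g2_inner :: "tensor \<Rightarrow> tensor \<Rightarrow> tensor \<Rightarrow> real" where
  "g2_inner \<phi> = coframe_inner (g2_coframe \<phi>)"

definition g2_star :: "tensor \<Rightarrow> tensor \<Rightarrow> tensor" where
  "g2_star \<phi> = coframe_star (g2_coframe \<phi>)"


section \<open>Calculus on open subsets of \<open>\<real>\<^sup>7\<close>\<close>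

primrec Ck_on :: "nat \<Rightarrow> (real^7 \<Rightarrow> 'b::real_normed_vector) \<Rightarrow> (real^7) set \<Rightarrow> bool" where
  "Ck_on 0 f S \<longleftrightarrow> continuous_on S f"
| "Ck_on (Suc k) f S \<longleftrightarrow>
     (\<forall>x\<in>S. f differentiable (at x)) \<and> (\<forall>v. Ck_on k (\<lambda>x. frechet_derivative f (at x) v) S)"

definition smooth_fun_on :: "(real^7) set \<Rightarrow> (real^7 \<Rightarrow> 'b::real_normed_vector) \<Rightarrow> bool" where
  "smooth_fun_on S f \<longleftrightarrow> (\<forall>k. Ck_on k f S)"

type_synonym vfield = "real^7 \<Rightarrow> real^7"

definition lie_bracket :: "vfield \<Rightarrow> vfield \<Rightarrow> vfield" where
  "lie_bracket X Y = (\<lambda>x. frechet_derivative Y (at x) (X x) - frechet_derivative X (at x) (Y x))"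

text \<open>Exterior derivative of a form whose value at \<open>x\<close> is \<open>\<omega> x\<close>:
  \<open>d\<omega>(v\<^sub>0, \<dots>, v\<^sub>k) = \<Sum>\<^sub>i (-1)\<^sup>i D\<^bsub>v\<^sub>i\<^esub>(\<omega>(v\<^sub>0, \<dots>, v\<^sub>i omitted, \<dots>, v\<^sub>k))\<close>.\<close>

definition ext_deriv :: "(real^7 \<Rightarrow> tensor) \<Rightarrow> real^7 \<Rightarrow> tensor" where
  "ext_deriv \<omega> x = (\<lambda>vs. \<Sum>i<length vs.
     (- 1) ^ i * frechet_derivative (\<lambda>y. \<omega> y (take i vs @ drop (Suc i) vs)) (at x) (vs ! i))"

text \<open>A connection on an open set is given by its Christoffel symbols
  \<open>\<Gamma> x u v\<close>, the value at \<open>x\<close> of \<open>\<nabla>\<^sub>u v\<close> for the constant vector fields \<open>u\<close>, \<open>v\<close>.\<close>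

type_synonym christoffel = "real^7 \<Rightarrow> real^7 \<Rightarrow> real^7 \<Rightarrow> real^7"

definition cov :: "christoffel \<Rightarrow> vfield \<Rightarrow> vfield \<Rightarrow> vfield" where
  "cov \<Gamma> X Y = (\<lambda>x. frechet_derivative Y (at x) (X x) + \<Gamma> x (X x) (Y x))"

text \<open>\<open>(\<nabla>\<^sub>u \<omega>)(v\<^sub>1, \<dots>, v\<^sub>k) = D\<^sub>u(\<omega>(v\<^sub>1, \<dots>, v\<^sub>k)) - \<Sum>\<^sub>i \<omega>(v\<^sub>1, \<dots>, \<nabla>\<^sub>u v\<^sub>i, \<dots>, v\<^sub>k)\<close>
  with the \<open>v\<^sub>i\<close> extended as constant vector fields.\<close>

definition cov_tensor :: "christoffel \<Rightarrow> (real^7 \<Rightarrow> tensor) \<Rightarrow> real^7 \<Rightarrow> real^7 \<Rightarrow> tensor" where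
  "cov_tensor \<Gamma> \<omega> x u = (\<lambda>vs.
     frechet_derivative (\<lambda>y. \<omega> y vs) (at x) u
     - (\<Sum>i<length vs. \<omega> x (vs[i := cov \<Gamma> (\<lambda>_. u) (\<lambda>_. vs ! i) x])))"

definition torsion_vec :: "christoffel \<Rightarrow> vfield \<Rightarrow> vfield \<Rightarrow> vfield" where
  "torsion_vec \<Gamma> X Y = (\<lambda>x. cov \<Gamma> X Y x - cov \<Gamma> Y X x - lie_bracket X Y x)"

definition curvature_vec :: "christoffel \<Rightarrow> vfield \<Rightarrow> vfield \<Rightarrow> vfield \<Rightarrow> vfield" where
  "curvature_vec \<Gamma> X Y Z = (\<lambda>x. cov \<Gamma> X (cov \<Gamma> Y Z) x - cov \<Gamma> Y (cov \<Gamma> X Z) x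
     - cov \<Gamma> (lie_bracket X Y) Z x)"


section \<open>Smooth 7-manifolds\<close>

text \<open>The underlying space of the manifold is the union of the chart domains, an open subspace of
  the Hausdorff, second countable space \<^typ>\<open>'a\<close>.\<close>

type_synonym 'a chart = "'a set \<times> ('a \<Rightarrow> real^7)"

definition chart_image :: "'a chart \<Rightarrow> (real^7) set" where
  "chart_image c = snd c ` fst c"

definition transition :: "'a chart \<Rightarrow> 'a chart \<Rightarrow> real^7 \<Rightarrow> real^7" where
  "transition c c' = snd c' \<circ> inv_into (fst c) (snd c)"

definition overlap :: "'a chart \<Rightarrow> 'a chart \<Rightarrow> (real^7) set" where
  "overlap c c' = snd c ` (fst c \<inter> fst c')"

definition smooth_atlas ::
    "('a::{t2_space, second_countable_topology}) chart set \<Rightarrow> bool" where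
  "smooth_atlas A \<longleftrightarrow>
     (\<forall>c\<in>A. open (fst c) \<and> open (chart_image c) \<and>
        homeomorphism (fst c) (chart_image c) (snd c) (inv_into (fst c) (snd c))) \<and>
     (\<forall>c\<in>A. \<forall>c'\<in>A. smooth_fun_on (overlap c c') (transition c c'))"

text \<open>Tensor fields and connections on the manifold are given by their representatives in the
  charts of the atlas, related on overlaps by the respective transformation laws.\<close>

type_synonym 'a tensor_field = "'a chart \<Rightarrow> real^7 \<Rightarrow> tensor"
type_synonym 'a connection = "'a chart \<Rightarrow> christoffel"

definition differential_form ::
    "'a chart set \<Rightarrow> nat \<Rightarrow> 'a tensor_field \<Rightarrow> bool" where
  "differential_form A k \<omega> \<longleftrightarrow>
     (\<forall>c\<in>A. (\<forall>x\<in>chart_image c. is_form k (\<omega> c x)) \<and>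
        (\<forall>vs. smooth_fun_on (chart_image c) (\<lambda>x. \<omega> c x vs))) \<and>
     (\<forall>c\<in>A. \<forall>c'\<in>A. \<forall>x\<in>overlap c c'. \<forall>vs.
        \<omega> c x vs = \<omega> c' (transition c c' x)
          (map (frechet_derivative (transition c c') (at x)) vs))"

text \<open>The last condition says that \<open>\<nabla>\<^sub>u v\<close>, computed in the chart \<open>c\<close> for constant vector fields,
  is mapped by the differential of the transition map to the covariant derivative of the transformed
  fields computed in \<open>c'\<close>.\<close>

definition affine_connection :: "'a chart set \<Rightarrow> 'a connection \<Rightarrow> bool" where
  "affine_connection A \<Gamma> \<longleftrightarrow>
     (\<forall>c\<in>A. (\<forall>x\<in>chart_image c. bilinear (\<Gamma> c x)) \<and>
        (\<forall>u v. smooth_fun_on (chart_image c) (\<lambda>x. \<Gamma> c x u v))) \<and>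
     (\<forall>c\<in>A. \<forall>c'\<in>A. \<forall>x\<in>overlap c c'. \<forall>u v.
        (let D = (\<lambda>y. frechet_derivative (transition c c') (at y))
         in D x (\<Gamma> c x u v) =
            frechet_derivative (\<lambda>y. D y v) (at x) u + \<Gamma> c' (transition c c' x) (D x u) (D x v)))"

definition parallel_tensor :: "'a chart set \<Rightarrow> 'a connection \<Rightarrow> 'a tensor_field \<Rightarrow> bool" where
  "parallel_tensor A \<Gamma> \<omega> \<longleftrightarrow>
     (\<forall>c\<in>A. \<forall>x\<in>chart_image c. \<forall>u vs. cov_tensor (\<Gamma> c) (\<omega> c) x u vs = 0)"


section \<open>\<open>G\<^sub>2\<close> structures\<close>

definition g2_structure :: "'a chart set \<Rightarrow> 'a tensor_field \<Rightarrow> bool" where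
  "g2_structure A \<phi> \<longleftrightarrow> differential_form A 3 \<phi> \<and>
     (\<forall>c\<in>A. \<forall>x\<in>chart_image c. \<exists>V E. open V \<and> x \<in> V \<and> V \<subseteq> chart_image c \<and>
        smooth_fun_on V E \<and> (\<forall>y\<in>V. g2_adapted (\<phi> c y) (E y)))"

definition metric_field :: "'a tensor_field \<Rightarrow> 'a tensor_field" where
  "metric_field \<phi> c x = tensor2 (g2_metric (\<phi> c x))"

definition dphi :: "'a tensor_field \<Rightarrow> 'a tensor_field" where
  "dphi \<phi> c = ext_deriv (\<phi> c)"

definition star_phi :: "'a tensor_field \<Rightarrow> 'a tensor_field" where
  "star_phi \<phi> c x = g2_star (\<phi> c x) (\<phi> c x)"

definition lee_form :: "'a tensor_field \<Rightarrow> 'a tensor_field" where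
  "lee_form \<phi> c x = (\<lambda>vs. - (1 / 3) *
     g2_star (\<phi> c x) (wedge (g2_star (\<phi> c x) (dphi \<phi> c x)) (\<phi> c x)) vs)"

definition integrable_g2 :: "'a chart set \<Rightarrow> 'a tensor_field \<Rightarrow> bool" where
  "integrable_g2 A \<phi> \<longleftrightarrow> (\<forall>c\<in>A. \<forall>x\<in>chart_image c.
     ext_deriv (star_phi \<phi> c) x = wedge (lee_form \<phi> c x) (star_phi \<phi> c x))"

definition constant_type :: "'a chart set \<Rightarrow> 'a tensor_field \<Rightarrow> bool" where
  "constant_type A \<phi> \<longleftrightarrow> (\<exists>\<kappa>. \<forall>c\<in>A. \<forall>x\<in>chart_image c.
     g2_inner (\<phi> c x) (dphi \<phi> c x) (star_phi \<phi> c x) = \<kappa>)"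

text \<open>Torsion and curvature tensors are evaluated on tangent vectors by extending these to constant
  vector fields in the chart.\<close>

definition torsion :: "'a tensor_field \<Rightarrow> 'a connection \<Rightarrow> 'a tensor_field" where
  "torsion \<phi> \<Gamma> c x = tensor3 (\<lambda>u v w.
     g2_metric (\<phi> c x) (torsion_vec (\<Gamma> c) (\<lambda>_. u) (\<lambda>_. v) x) w)"

definition curvature ::
    "'a tensor_field \<Rightarrow> 'a connection \<Rightarrow> 'a chart \<Rightarrow> real^7 \<Rightarrow>
     real^7 \<Rightarrow> real^7 \<Rightarrow> real^7 \<Rightarrow> real^7 \<Rightarrow> real" where
  "curvature \<phi> \<Gamma> c x u v w z =
     g2_metric (\<phi> c x) (curvature_vec (\<Gamma> c) (\<lambda>_. u) (\<lambda>_. v) (\<lambda>_. w) x) z"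

definition ricci ::
    "'a tensor_field \<Rightarrow> 'a connection \<Rightarrow> 'a chart \<Rightarrow> real^7 \<Rightarrow> real^7 \<Rightarrow> real^7 \<Rightarrow> real" where
  "ricci \<phi> \<Gamma> c x u v =
     (let e = frame (g2_coframe (\<phi> c x)) in \<Sum>i\<in>UNIV. curvature \<phi> \<Gamma> c x (e i) u v (e i))"

definition levi_civita :: "'a chart set \<Rightarrow> 'a tensor_field \<Rightarrow> 'a connection \<Rightarrow> bool" where
  "levi_civita A \<phi> \<Gamma> \<longleftrightarrow> affine_connection A \<Gamma> \<and> parallel_tensor A \<Gamma> (metric_field \<phi>) \<and>
     (\<forall>c\<in>A. \<forall>x\<in>chart_image c. \<forall>u v. torsion_vec (\<Gamma> c) (\<lambda>_. u) (\<lambda>_. v) x = 0)"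

definition characteristic_connection ::
    "'a chart set \<Rightarrow> 'a tensor_field \<Rightarrow> 'a connection \<Rightarrow> bool" where
  "characteristic_connection A \<phi> \<Gamma> \<longleftrightarrow>
     affine_connection A \<Gamma> \<and> parallel_tensor A \<Gamma> (metric_field \<phi>) \<and>
     parallel_tensor A \<Gamma> \<phi> \<and> differential_form A 3 (torsion \<phi> \<Gamma>)"

end

theory Submission
  imports Defs
begin

text \<open>Everything is tested in a local adapted frame. Write \<open>\<psi> = *\<phi>\<close>, \<open>P = \<nabla>T\<close> and \<open>\<sigma>(X, Y, Z, V)\<close> for
  the cyclic sum over \<open>X, Y, Z\<close> of \<open>g(T(X, Y), T(Z, V))\<close>. The cyclic sum \<open>B\<close> of \<open>R\<close> equals that of \<open>P\<close>
  plus \<open>\<sigma>\<close>, and \<open>R(X, Y)\<close> lies in \<open>g\<^sub>2\<close> because \<open>\<nabla>\<phi> = 0\<close>.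

  If \<open>B = 0\<close>, then \<open>R\<close> is symmetric in pairs, and contracting the identity for \<open>R(X, Y) \<in> g\<^sub>2\<close> with \<open>\<phi>\<close>
  gives \<open>Ric = 0\<close>. Conversely, pair symmetry makes \<open>B\<close> a 4-form, \<open>Ric = 0\<close> says that
  \<open>\<Sum> B(X, e\<^sub>a, e\<^sub>b, e\<^sub>c) \<psi>(Y, e\<^sub>a, e\<^sub>b, e\<^sub>c) = 0\<close>, and this contraction is injective on 4-forms.

  Let \<open>B = 0\<close>. Then \<open>P\<close> is the 4-form \<open>- \<sigma> / 3\<close>. The pairing \<open>(d\<phi>, *\<phi>)\<close> is the contraction of \<open>T\<close> with
  \<open>\<phi>\<close>, so constant type makes the contraction of \<open>P\<close>, hence of \<open>\<sigma>\<close>, with \<open>\<phi>\<close> vanish. With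
  \<open>\<theta>\<^sub>j = T\<^sub>a\<^sub>b\<^sub>c \<psi>\<^sub>j\<^sub>a\<^sub>b\<^sub>c\<close> and \<open>C\<^sub>i\<^sub>j = T\<^sub>i\<^sub>a\<^sub>b \<phi>\<^sub>j\<^sub>a\<^sub>b\<close> this reads \<open>C\<theta> = 0\<close>; it puts \<open>\<theta>\<close> contracted with \<open>T\<close>
  into \<open>g\<^sub>2\<close>, which forces \<open>M\<theta> = 0\<close> for the symmetric matrix \<open>M = \<nabla>\<theta>\<close>. Where \<open>\<theta> \<noteq> 0\<close>, differentiating
  \<open>(C + C\<^sup>T)\<theta> = 0\<close> shows that \<open>M\<^sup>2\<close> anticommutes with the cross product by \<open>\<theta>\<close>, whence \<open>tr M\<^sup>2 = 0\<close>; where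
  \<open>\<theta> = 0\<close>, differentiating \<open>M\<theta> = 0\<close> gives \<open>M\<^sup>2 = 0\<close>. So \<open>M = 0\<close>, and \<open>P = 0\<close> by the injectivity above.
  The rest follows from \<open>\<nabla>\<^sup>gT = P + \<sigma> / 2\<close> and from the expression of \<open>d\<phi>\<close> through \<open>\<phi>\<close> and \<open>T\<close>.\<close>

section \<open>Contractions with the model form\<close>

lemma UNIV_7: "(UNIV :: 7 set) = {1, 2, 3, 4, 5, 6, 7}"
  by (rule card_subset_eq[symmetric]) simp_all

lemma sum_7: "sum f (UNIV :: 7 set) = f 1 + f 2 + f 3 + f 4 + f 5 + f 6 + (f 7 :: real)"
  unfolding UNIV_7 by simp

lemma forall_7: "(\<forall>i::7. P i) \<longleftrightarrow> P 1 \<and> P 2 \<and> P 3 \<and> P 4 \<and> P 5 \<and> P 6 \<and> P 7"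
proof
  assume "P 1 \<and> P 2 \<and> P 3 \<and> P 4 \<and> P 5 \<and> P 6 \<and> P 7"
  then have "\<forall>i\<in>UNIV. P i"
    unfolding UNIV_7 by simp
  then show "\<forall>i. P i"
    by simp
qed simp

text \<open>The value of \<open>e\<^sub>a \<and> e\<^sub>b \<and> e\<^sub>c\<close> on three vectors
  given by their coframe components; \<open>coforms_3\<close> makes this precise.\<close>

definition det3 :: "7 \<Rightarrow> 7 \<Rightarrow> 7 \<Rightarrow> real^7 \<Rightarrow> real^7 \<Rightarrow> real^7 \<Rightarrow> real" where
  "det3 a b c u v w = u $ a * (v $ b * w $ c - v $ c * w $ b)
     - u $ b * (v $ a * w $ c - v $ c * w $ a) + u $ c * (v $ a * w $ b - v $ b * w $ a)"

definition phi0 :: "real^7 \<Rightarrow> real^7 \<Rightarrow> real^7 \<Rightarrow> real" where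
  "phi0 u v w = det3 1 2 7 u v w + det3 1 3 5 u v w - det3 1 4 6 u v w - det3 2 3 6 u v w
     - det3 2 4 5 u v w + det3 3 4 7 u v w + det3 5 6 7 u v w"

definition phi :: "7 \<Rightarrow> 7 \<Rightarrow> 7 \<Rightarrow> real" where
  "phi i j k = phi0 (axis i 1) (axis j 1) (axis k 1)"

lemma phi_skew: "phi i j k = - phi j i k" "phi i j k = - phi i k j"
  by (simp_all add: phi_def phi0_def det3_def algebra_simps)

text \<open>Any two distinct indices lie in exactly one of the seven triples, the lines of a Fano
  plane. So each cross product of two basis vectors is a single basis vector up to sign.\<close>

lemma phi_table:
  "phi 1 2 j = (if j = 7 then 1 else 0)" "phi 1 3 j = (if j = 5 then 1 else 0)"
  "phi 1 4 j = (if j = 6 then -1 else 0)" "phi 1 5 j = (if j = 3 then -1 else 0)"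
  "phi 1 6 j = (if j = 4 then 1 else 0)" "phi 1 7 j = (if j = 2 then -1 else 0)"
  "phi 2 3 j = (if j = 6 then -1 else 0)" "phi 2 4 j = (if j = 5 then -1 else 0)"
  "phi 2 5 j = (if j = 4 then 1 else 0)" "phi 2 6 j = (if j = 3 then 1 else 0)"
  "phi 2 7 j = (if j = 1 then 1 else 0)" "phi 3 4 j = (if j = 7 then 1 else 0)"
  "phi 3 5 j = (if j = 1 then 1 else 0)" "phi 3 6 j = (if j = 2 then -1 else 0)"
  "phi 3 7 j = (if j = 4 then -1 else 0)" "phi 4 5 j = (if j = 2 then -1 else 0)"
  "phi 4 6 j = (if j = 1 then -1 else 0)" "phi 4 7 j = (if j = 3 then 1 else 0)"
  "phi 5 6 j = (if j = 7 then 1 else 0)" "phi 5 7 j = (if j = 6 then -1 else 0)"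
  "phi 6 7 j = (if j = 5 then 1 else 0)"
  unfolding phi_def phi0_def det3_def by (simp_all add: axis_def)

text \<open>Rewrites a skew array to increasing indices, so that identities between forms become linear
  identities between their independent components.\<close>

lemma skew_sort:
  fixes f :: "7 \<Rightarrow> 7 \<Rightarrow> real"
  assumes "\<And>a b. f a b = - f b a"
  shows "f a a = 0"
    "f 2 1 = - f 1 2" "f 3 1 = - f 1 3" "f 4 1 = - f 1 4" "f 5 1 = - f 1 5" "f 6 1 = - f 1 6"
    "f 7 1 = - f 1 7" "f 3 2 = - f 2 3" "f 4 2 = - f 2 4" "f 5 2 = - f 2 5" "f 6 2 = - f 2 6"
    "f 7 2 = - f 2 7" "f 4 3 = - f 3 4" "f 5 3 = - f 3 5" "f 6 3 = - f 3 6" "f 7 3 = - f 3 7"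
    "f 5 4 = - f 4 5" "f 6 4 = - f 4 6" "f 7 4 = - f 4 7" "f 6 5 = - f 5 6" "f 7 5 = - f 5 7"
    "f 7 6 = - f 6 7"
proof -
  show "f a a = 0"
    using assms[of a a] by simp
qed (rule assms)+

lemmas phi_simps = phi_table[of 1, simplified] phi_table[of 2, simplified] phi_table[of 3,
    simplified]
  phi_table[of 4, simplified] phi_table[of 5, simplified] phi_table[of 6, simplified]
  phi_table[of 7, simplified] skew_sort[of "\<lambda>i j. phi i j k" for k, OF phi_skew(1)]

text \<open>On skew matrices this detects the 7-dimensional summand of the 2-forms; its kernel there
  is \<open>g\<^sub>2\<close>.\<close>

definition phic :: "(7 \<Rightarrow> 7 \<Rightarrow> real) \<Rightarrow> 7 \<Rightarrow> real" where
  "phic X j = (\<Sum>a\<in>UNIV. \<Sum>b\<in>UNIV. phi j a b * X a b)"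

lemma phic_eval:
  "phic X 1 = (X 2 7 - X 7 2) + (X 3 5 - X 5 3) - (X 4 6 - X 6 4)"
  "phic X 2 = (X 7 1 - X 1 7) - (X 3 6 - X 6 3) - (X 4 5 - X 5 4)"
  "phic X 3 = (X 5 1 - X 1 5) - (X 6 2 - X 2 6) + (X 4 7 - X 7 4)"
  "phic X 4 = (X 1 6 - X 6 1) - (X 5 2 - X 2 5) + (X 7 3 - X 3 7)"
  "phic X 5 = (X 1 3 - X 3 1) - (X 2 4 - X 4 2) + (X 6 7 - X 7 6)"
  "phic X 6 = (X 4 1 - X 1 4) - (X 2 3 - X 3 2) + (X 7 5 - X 5 7)"
  "phic X 7 = (X 1 2 - X 2 1) + (X 3 4 - X 4 3) + (X 5 6 - X 6 5)"
  by (simp_all add: phic_def sum_7 phi_simps)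

definition cmat :: "(7 \<Rightarrow> 7 \<Rightarrow> 7 \<Rightarrow> real) \<Rightarrow> 7 \<Rightarrow> 7 \<Rightarrow> real" where
  "cmat t i = phic (t i)"

text \<open>By \<open>\<phi>\<^sub>i\<^sub>j\<^sub>m \<phi>\<^sub>k\<^sub>l\<^sub>m = \<delta>\<^sub>i\<^sub>k \<delta>\<^sub>j\<^sub>l - \<delta>\<^sub>i\<^sub>l \<delta>\<^sub>j\<^sub>k + \<psi>\<^sub>i\<^sub>j\<^sub>k\<^sub>l\<close>, on 3-forms \<open>cvec t j\<close> is the contraction
  \<open>\<psi>\<^sub>j\<^sub>a\<^sub>b\<^sub>c t\<^sub>a\<^sub>b\<^sub>c\<close> with the 4-form \<open>\<psi> = *\<phi>\<close>; for the torsion it is a multiple of the Lee form.\<close>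

definition cvec :: "(7 \<Rightarrow> 7 \<Rightarrow> 7 \<Rightarrow> real) \<Rightarrow> 7 \<Rightarrow> real" where
  "cvec t = phic (cmat t)"

locale skew3 =
  fixes t :: "7 \<Rightarrow> 7 \<Rightarrow> 7 \<Rightarrow> real"
  assumes skew: "t i j k = - t j i k" "t i j k = - t i k j"
begin
lemmas sort = skew_sort[of "\<lambda>i j. t i j k" for k, OF skew(1)] skew_sort[of "t i" for i, OF skew(2)]

lemma cvec_cmat_eval:
  shows
    "cvec t 1 = 6 * (t 2 3 4 + t 2 5 6 + t 3 6 7 + t 4 5 7)"
    "cvec t 2 = 6 * (- t 1 3 4 - t 1 5 6 + t 3 5 7 - t 4 6 7)"
    "cvec t 3 = 6 * (t 1 2 4 - t 1 6 7 - t 2 5 7 + t 4 5 6)"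
    "cvec t 4 = 6 * (- t 1 2 3 - t 1 5 7 + t 2 6 7 - t 3 5 6)"
    "cvec t 5 = 6 * (t 1 2 6 + t 1 4 7 + t 2 3 7 + t 3 4 6)"
    "cvec t 6 = 6 * (- t 1 2 5 + t 1 3 7 - t 2 4 7 - t 3 4 5)"
    "cvec t 7 = 6 * (- t 1 3 6 - t 1 4 5 - t 2 3 5 + t 2 4 6)"
    "cmat t i 1 = 2 * (t i 2 7 + t i 3 5 - t i 4 6)"
    "cmat t i 2 = 2 * (- t i 1 7 - t i 3 6 - t i 4 5)"
    "cmat t i 3 = 2 * (- t i 1 5 + t i 2 6 + t i 4 7)"
    "cmat t i 4 = 2 * (t i 1 6 + t i 2 5 - t i 3 7)"
    "cmat t i 5 = 2 * (t i 1 3 - t i 2 4 + t i 6 7)"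
    "cmat t i 6 = 2 * (- t i 1 4 - t i 2 3 - t i 5 7)"
    "cmat t i 7 = 2 * (t i 1 2 + t i 3 4 + t i 5 6)"
  by (simp_all add: cvec_def cmat_def phic_eval sort)

text \<open>Under \<open>G\<^sub>2\<close> the 3-forms split as 1 + 7 + 27 and the skew matrices as
  7 + 14. So the skew part of \<open>cmat t\<close> can only see the 7-dimensional component
  \<open>cvec t\<close>; evaluation gives the factor.\<close>

lemma cmat_antisym: "cmat t i j - cmat t j i = (1 / 3) * (\<Sum>a\<in>UNIV. phi i j a * cvec t a)"
proof -
  have "\<forall>i j. cmat t i j - cmat t j i = (1 / 3) * (\<Sum>a\<in>UNIV. phi i j a * cvec t a)"
    unfolding forall_7 by (simp add: sum_7 phi_simps cvec_cmat_eval sort)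
  then show ?thesis by blast
qed
end

locale skew4 =
  fixes w :: "7 \<Rightarrow> 7 \<Rightarrow> 7 \<Rightarrow> 7 \<Rightarrow> real"
  assumes skew: "w i j k l = - w j i k l" "w i j k l = - w i k j l" "w i j k l = - w i j l k"
begin
lemmas sort = skew_sort[of "\<lambda>i j. w i j k l" for k l, OF skew(1)]
  skew_sort[of "\<lambda>j k. w i j k l" for i l, OF skew(2)]
  skew_sort[of "\<lambda>k l. w i j k l" for i j, OF skew(3)]

lemma skew3: "skew3 (w i)"
  by unfold_locales (rule skew)+

lemmas eval = skew3.cvec_cmat_eval[OF skew3] sort

text \<open>The 4-forms split as 1 + 7 + 27 as well, and the traces on the right are their
  7-dimensional component. When these vanish, the contraction with \<psi> is a symmetric
  matrix.\<close>

lemma cvec_antisym: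
  "cvec (w i) j - cvec (w j) i = - (\<Sum>a\<in>UNIV. phi i j a * (\<Sum>b\<in>UNIV. cmat (w a) b b))"
proof -
  have "\<forall>i j. cvec (w i) j - cvec (w j) i =
      - (\<Sum>a\<in>UNIV. phi i j a * (\<Sum>b\<in>UNIV. cmat (w a) b b))"
    unfolding forall_7 by (simp add: sum_7 phi_simps eval)
  then show ?thesis by blast
qed

text \<open>The contraction with \<psi> determines a 4-form, hence also its contraction with \<phi>.
  This is the part of it that occurs when \<open>(C + C\<^sup>T)\<theta> = 0\<close> is
  differentiated.\<close>

lemma cmat_sym:
  "cmat (w y) i j + cmat (w y) j i =
     (1 / 3) * (\<Sum>a\<in>UNIV. cvec (w i) a * phi a j y + cvec (w j) a * phi a i y)"
proof -
  have "\<forall>y i j. cmat (w y) i j + cmat (w y) j i =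
     (1 / 3) * (\<Sum>a\<in>UNIV. cvec (w i) a * phi a j y + cvec (w j) a * phi a i y)"
    unfolding forall_7 by (simp add: sum_7 phi_simps eval)
  then show ?thesis by blast
qed

text \<open>The hypothesis consists of 49 linear equations in the 35 independent components; each
  component is a linear combination of them.\<close>

lemma eq_0_if_cvec_eq_0:
  assumes "\<And>i j. cvec (w i) j = 0"
  shows "w i j k l = 0"
proof -
  have "\<forall>i j. cvec (w i) j = 0"
    using assms by blast
  note M = this[unfolded forall_7, simplified eval, simplified]
  have
    "w 1 2 3 4 = 0" "w 1 2 3 5 = 0" "w 1 2 3 6 = 0" "w 1 2 3 7 = 0" "w 1 2 4 5 = 0"
    "w 1 2 4 6 = 0" "w 1 2 4 7 = 0" "w 1 2 5 6 = 0" "w 1 2 5 7 = 0" "w 1 2 6 7 = 0"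
    "w 1 3 4 5 = 0" "w 1 3 4 6 = 0" "w 1 3 4 7 = 0" "w 1 3 5 6 = 0" "w 1 3 5 7 = 0"
    "w 1 3 6 7 = 0" "w 1 4 5 6 = 0" "w 1 4 5 7 = 0" "w 1 4 6 7 = 0" "w 1 5 6 7 = 0"
    "w 2 3 4 5 = 0" "w 2 3 4 6 = 0" "w 2 3 4 7 = 0" "w 2 3 5 6 = 0" "w 2 3 5 7 = 0"
    "w 2 3 6 7 = 0" "w 2 4 5 6 = 0" "w 2 4 5 7 = 0" "w 2 4 6 7 = 0" "w 2 5 6 7 = 0"
    "w 3 4 5 6 = 0" "w 3 4 5 7 = 0" "w 3 4 6 7 = 0" "w 3 5 6 7 = 0" "w 4 5 6 7 = 0"
    using M by linarith+
  then have "\<forall>i j k l. w i j k l = 0"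
    unfolding forall_7 by (simp add: sort)
  then show ?thesis by blast
qed
end

section \<open>The dual 4-form and the Ricci contraction\<close>

definition delta :: "7 \<Rightarrow> 7 \<Rightarrow> real" where
  "delta i j = (if i = j then 1 else 0)"

lemma delta_sum [simp]:
  "(\<Sum>a\<in>UNIV. delta i a * f a) = f i" "(\<Sum>a\<in>UNIV. delta a i * f a) = f i"
  "(\<Sum>a\<in>UNIV. f a * delta i a) = f i" "(\<Sum>a\<in>UNIV. f a * delta a i) = f i"
  by (simp_all add: delta_def if_distrib if_distribR cong: if_cong)

lemma delta_val: "delta i i = 1"
    "delta 1 2 = 0" "delta 1 3 = 0" "delta 1 4 = 0" "delta 1 5 = 0" "delta 1 6 = 0" "delta 1 7 = 0"
    "delta 2 1 = 0" "delta 2 3 = 0" "delta 2 4 = 0" "delta 2 5 = 0" "delta 2 6 = 0" "delta 2 7 = 0"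
    "delta 3 1 = 0" "delta 3 2 = 0" "delta 3 4 = 0" "delta 3 5 = 0" "delta 3 6 = 0" "delta 3 7 = 0"
    "delta 4 1 = 0" "delta 4 2 = 0" "delta 4 3 = 0" "delta 4 5 = 0" "delta 4 6 = 0" "delta 4 7 = 0"
    "delta 5 1 = 0" "delta 5 2 = 0" "delta 5 3 = 0" "delta 5 4 = 0" "delta 5 6 = 0" "delta 5 7 = 0"
    "delta 6 1 = 0" "delta 6 2 = 0" "delta 6 3 = 0" "delta 6 4 = 0" "delta 6 5 = 0" "delta 6 7 = 0"
    "delta 7 1 = 0" "delta 7 2 = 0" "delta 7 3 = 0" "delta 7 4 = 0" "delta 7 5 = 0" "delta 7 6 = 0"
  by (simp_all add: delta_def)


lemma delta_commute: "delta i j = delta j i"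
  by (simp add: delta_def)

text \<open>The contraction identity for \<phi> is taken as the definition of \<psi>, so that what
  remains to be shown is its symmetry.\<close>

definition psi :: "7 \<Rightarrow> 7 \<Rightarrow> 7 \<Rightarrow> 7 \<Rightarrow> real" where
  "psi i j k l = (\<Sum>m\<in>UNIV. phi i j m * phi k l m) - delta i k * delta j l + delta i l * delta j k"

text \<open>Polarization of |u x v|^2 = |u|^2 |v|^2 - (u . v)^2 for the cross product given by
  \<phi>.\<close>

lemma phi_phi_sym:
  "(\<Sum>m\<in>UNIV. phi i a m * phi j b m) + (\<Sum>m\<in>UNIV. phi j a m * phi i b m) =
     2 * delta i j * delta a b - delta i a * delta j b - delta j a * delta i b"
proof -
  have "\<forall>i j a b. (\<Sum>m\<in>UNIV. phi i a m * phi j b m) + (\<Sum>m\<in>UNIV. phi j a m * phi i b m) =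
     2 * delta i j * delta a b - delta i a * delta j b - delta j a * delta i b"
    unfolding forall_7 by (simp add: sum_7 phi_simps delta_val)
  then show ?thesis by blast
qed

lemma psi_cyclic: "psi j a b c = psi j b c a"
proof -
  have 1: "psi i j k l = - psi j i k l" for i j k l
    by (simp add: psi_def phi_skew(1)[of i j] sum_negf)
  have 2: "psi i j k l = - psi i j l k" for i j k l
    by (simp add: psi_def phi_skew(1)[of k l] sum_negf)
  \<comment> \<open>Skewness in the first and third index is \<open>phi_phi_sym\<close>. Together
    with the two evident transpositions it generates the cyclic shift of the last three
    indices.\<close>
  have 3: "psi i j k l = - psi k j i l" for i j k l
    using phi_phi_sym[of i j k l] 
    by (simp add: psi_def delta_commute algebra_simps)
  show ?thesis
    using 1[of j a b c] 3[of a j b c] 1[of b j a c] 2[of j b a c] by (metis 1 2 3)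
qed

text \<open>As \<open>r\<close> need not be skew in its first two indices, the delta terms of the
  contraction identity survive as two traces; for curvature these carry the Ricci tensor.\<close>

lemma cvec_psi:
  "cvec r j = (\<Sum>a\<in>UNIV. r a j a) - (\<Sum>a\<in>UNIV. r a a j)
     + (\<Sum>a\<in>UNIV. \<Sum>b\<in>UNIV. \<Sum>c\<in>UNIV. psi j a b c * r a b c)"
proof -
  have "cvec r j = (\<Sum>a\<in>UNIV. \<Sum>m\<in>UNIV. \<Sum>b\<in>UNIV. \<Sum>c\<in>UNIV. phi j a m * phi m b c * r a b c)"
    by (simp add: cvec_def cmat_def phic_def sum_distrib_left mult.assoc)
  also have "\<dots> = (\<Sum>a\<in>UNIV. \<Sum>b\<in>UNIV. \<Sum>c\<in>UNIV. \<Sum>m\<in>UNIV. phi j a m * phi m b c * r a b c)"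
    by (subst sum.swap, subst (2) sum.swap) simp
  also have "\<dots> = (\<Sum>a\<in>UNIV. \<Sum>b\<in>UNIV. \<Sum>c\<in>UNIV. delta j b * delta a c * r a b c
      - delta j c * delta a b * r a b c + psi j a b c * r a b c)"
  proof (intro sum.cong refl)
    fix a b c
    have "phi m b c = phi b c m" for m
      by (metis phi_skew)
    then show "(\<Sum>m\<in>UNIV. phi j a m * phi m b c * r a b c) = delta j b * delta a c * r a b c
      - delta j c * delta a b * r a b c + psi j a b c * r a b c"
      by (simp add: psi_def left_diff_distrib distrib_right sum_distrib_right)
  qed
  also have "\<dots> = (\<Sum>a\<in>UNIV. r a j a) - (\<Sum>a\<in>UNIV. r a a j)
     + (\<Sum>a\<in>UNIV. \<Sum>b\<in>UNIV. \<Sum>c\<in>UNIV. psi j a b c * r a b c)"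
    by (simp add: sum.distrib sum_subtractf mult.assoc flip: sum_distrib_left)
  finally show ?thesis .
qed

lemma psi_sum_cyclic:
  "(\<Sum>a\<in>UNIV. \<Sum>b\<in>UNIV. \<Sum>c\<in>UNIV. psi j a b c * r c a b) =
   (\<Sum>a\<in>UNIV. \<Sum>b\<in>UNIV. \<Sum>c\<in>UNIV. psi j a b c * r a b c)"
proof -
  have "(\<Sum>a\<in>UNIV. \<Sum>b\<in>UNIV. \<Sum>c\<in>UNIV. psi j a b c * r c a b) =
      (\<Sum>a\<in>UNIV. \<Sum>b\<in>UNIV. \<Sum>c\<in>UNIV. psi j c a b * r c a b)"
    by (simp add: psi_cyclic[symmetric])
  also have "\<dots> = (\<Sum>a\<in>UNIV. \<Sum>c\<in>UNIV. \<Sum>b\<in>UNIV. psi j c a b * r c a b)"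
    by (rule sum.cong[OF refl], rule sum.swap)
  also have "\<dots> = (\<Sum>c\<in>UNIV. \<Sum>a\<in>UNIV. \<Sum>b\<in>UNIV. psi j c a b * r c a b)"
    by (rule sum.swap)
  finally show ?thesis .
qed

lemma psi_sum_bianchi:
  "(\<Sum>a\<in>UNIV. \<Sum>b\<in>UNIV. \<Sum>c\<in>UNIV. psi j a b c * (r a b c + r c a b + r b c a)) =
   3 * (\<Sum>a\<in>UNIV. \<Sum>b\<in>UNIV. \<Sum>c\<in>UNIV. psi j a b c * r a b c)"
  using psi_sum_cyclic[of j r] psi_sum_cyclic[of j "\<lambda>a b c. r c a b"]
  by (simp add: distrib_left sum.distrib)

text \<open>For \<open>r a b c = R(X, e\<^sub>a, e\<^sub>b, e\<^sub>c)\<close> the sum is \<open>- Ric(X, e\<^sub>j)\<close>.\<close>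

lemma trace_eq_0_if_bianchi:
  assumes skew: "\<And>a b c. r a b c = - r a c b" and g2: "\<And>a. phic (r a) = (\<lambda>_. 0)"
    and bianchi: "\<And>a b c. r a b c + r c a b + r b c a = 0"
  shows "(\<Sum>a\<in>UNIV. r a j a) = 0"
proof -
  have "cvec r j = 0"
    by (simp add: cvec_def cmat_def g2 phic_def)
  moreover have "(\<Sum>a\<in>UNIV. r a a j) = - (\<Sum>a\<in>UNIV. r a j a)"
    by (subst skew) (simp add: sum_negf)
  ultimately show ?thesis
    using psi_sum_bianchi[of j r] by (simp add: cvec_psi bianchi)
qed

text \<open>Since \<open>cvec r\<close> vanishes, \<open>cvec_psi\<close> makes the
  \<psi>-contraction of \<open>r\<close> a multiple of its trace. The cyclic sum \<open>w\<close>
  has three times this contraction and, being skew, no traces of its own.\<close>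

lemma cvec_bianchi_eq_0_if_trace_eq_0:
  assumes skew: "\<And>a b c. r a b c = - r a c b" and g2: "\<And>a. phic (r a) = (\<lambda>_. 0)"
    and w: "skew3 w" "\<And>a b c. w a b c = r a b c + r c a b + r b c a"
    and trace: "(\<Sum>a\<in>UNIV. r a j a) = 0"
  shows "cvec w j = 0"
proof -
  have "cvec r j = 0"
    by (simp add: cvec_def cmat_def g2 phic_def)
  moreover have "(\<Sum>a\<in>UNIV. r a a j) = 0"
    by (subst skew) (simp add: sum_negf trace)
  moreover have "w a a b = 0" "w a b a = 0" for a b
    using skew3.sort[OF w(1)] skew3.skew(2)[OF w(1), of a b a] by simp_all
  ultimately show ?thesis
    using psi_sum_bianchi[of j r] w(2) trace by (simp add: cvec_psi)
qed

text \<open>The derivative of the components of a 3-tensor when the frame moves by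
  \<open>e\<^sub>i \<mapsto> \<Sum>\<^sub>l K i l e\<^sub>l\<close>.\<close>

definition act3 :: "(7 \<Rightarrow> 7 \<Rightarrow> real) \<Rightarrow> (7 \<Rightarrow> 7 \<Rightarrow> 7 \<Rightarrow> real) \<Rightarrow> 7 \<Rightarrow> 7 \<Rightarrow> 7 \<Rightarrow> real" where
  "act3 K t i j k = (\<Sum>l\<in>UNIV. K i l * t l j k + K j l * t i l k + K k l * t i j l)"

locale skew2 =
  fixes K :: "7 \<Rightarrow> 7 \<Rightarrow> real"
  assumes skew: "K i j = - K j i"
begin
lemmas sort = skew_sort[of K, OF skew]

lemma phic_skew_eval:
  "phic K 1 = 2 * (K 2 7 + K 3 5 - K 4 6)"
  "phic K 2 = 2 * (- K 1 7 - K 3 6 - K 4 5)"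
  "phic K 3 = 2 * (- K 1 5 + K 2 6 + K 4 7)"
  "phic K 4 = 2 * (K 1 6 + K 2 5 - K 3 7)"
  "phic K 5 = 2 * (K 1 3 - K 2 4 + K 6 7)"
  "phic K 6 = 2 * (- K 1 4 - K 2 3 - K 5 7)"
  "phic K 7 = 2 * (K 1 2 + K 3 4 + K 5 6)"
  by (simp_all add: phic_eval sort)

text \<open>The seven equations eliminate seven of the 21 entries of \<open>K\<close>; in the
  remaining 14 parameters of \<open>g\<^sub>2\<close> the stabilizer equations hold
  identically.\<close>

lemma act3_phi_eq_0:
  assumes "\<And>j. phic K j = 0"
  shows "act3 K phi i j k = 0"
proof -
  have "\<forall>j. phic K j = 0"
    using assms by blast
  note h = this[unfolded forall_7 phic_skew_eval, simplified]
  have "K 2 7 = - K 3 5 + K 4 6" "K 1 7 = - K 3 6 - K 4 5" "K 1 5 = K 2 6 + K 4 7"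
    "K 1 6 = - K 2 5 + K 3 7" "K 1 3 = K 2 4 - K 6 7" "K 1 4 = - K 2 3 - K 5 7"
    "K 1 2 = - K 3 4 - K 5 6"
    using h by linarith+
  then have "\<forall>i j k. act3 K phi i j k = 0"
    unfolding forall_7 act3_def by (simp add: sum_7 phi_simps sort)
  then show ?thesis by blast
qed

lemma phic_eq_0:
  assumes "\<And>i j k. act3 K phi i j k = 0"
  shows "phic K j = 0"
proof -
  have "\<forall>j. phic K j = 0"
    unfolding forall_7 phic_skew_eval
    \<comment> \<open>Ten of the 35 stabilizer equations already yield all seven components.\<close>
    using assms[of 1 2 3] assms[of 1 2 4] assms[of 1 2 5] assms[of 1 2 6] assms[of 1 3 4]
      assms[of 1 3 6] assms[of 1 3 7] assms[of 1 4 5] assms[of 1 4 7] assms[of 2 3 4]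
    by (simp add: act3_def sum_7 phi_simps sort)
  then show ?thesis by blast
qed
end

section \<open>The infinitesimal stabilizer of the model form\<close>

lemma phic_add: "phic (\<lambda>a b. X a b + Y a b) j = phic X j + phic Y j"
  by (simp add: phic_def distrib_left sum.distrib)

lemma phic_sum: "phic (\<lambda>a b. \<Sum>l\<in>UNIV. c l * X l a b) j = (\<Sum>l\<in>UNIV. c l * phic (X l) j)"
proof -
  have "phic (\<lambda>a b. \<Sum>l\<in>UNIV. c l * X l a b) j =
      (\<Sum>a\<in>UNIV. \<Sum>b\<in>UNIV. \<Sum>l\<in>UNIV. c l * (phi j a b * X l a b))"
    by (simp add: phic_def sum_distrib_left mult.left_commute)
  also have "\<dots> = (\<Sum>l\<in>UNIV. \<Sum>a\<in>UNIV. \<Sum>b\<in>UNIV. c l * (phi j a b * X l a b))"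
    by (subst (2) sum.swap, subst sum.swap) simp
  finally show ?thesis
    by (simp add: phic_def sum_distrib_left)
qed

lemma cmat_sum: "cmat (\<lambda>i a b. \<Sum>l\<in>UNIV. c l * X l i a b) i j = (\<Sum>l\<in>UNIV. c l * cmat (X l) i j)"
  unfolding cmat_def by (rule phic_sum)

lemma cvec_sum: "cvec (\<lambda>i a b. \<Sum>l\<in>UNIV. c l * X l i a b) j = (\<Sum>l\<in>UNIV. c l * cvec (X l) j)"
  unfolding cvec_def cmat_sum by (rule phic_sum)

lemma phi_sum_cyclic:
  "(\<Sum>a\<in>UNIV. \<Sum>b\<in>UNIV. \<Sum>c\<in>UNIV. phi a b c * h c a b) =
   (\<Sum>a\<in>UNIV. \<Sum>b\<in>UNIV. \<Sum>c\<in>UNIV. phi a b c * h a b c)"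
proof -
  have "phi a b c = phi c a b" for a b c
    by (metis phi_skew)
  then have "(\<Sum>a\<in>UNIV. \<Sum>b\<in>UNIV. \<Sum>c\<in>UNIV. phi a b c * h c a b) =
      (\<Sum>a\<in>UNIV. \<Sum>b\<in>UNIV. \<Sum>c\<in>UNIV. phi c a b * h c a b)"
    by simp
  also have "\<dots> = (\<Sum>a\<in>UNIV. \<Sum>c\<in>UNIV. \<Sum>b\<in>UNIV. phi c a b * h c a b)"
    by (rule sum.cong[OF refl], rule sum.swap)
  also have "\<dots> = (\<Sum>c\<in>UNIV. \<Sum>a\<in>UNIV. \<Sum>b\<in>UNIV. phi c a b * h c a b)"
    by (rule sum.swap)
  finally show ?thesis .
qed

lemma phi_sum_swap:
  "(\<Sum>a\<in>UNIV. \<Sum>b\<in>UNIV. \<Sum>c\<in>UNIV. phi a b c * h b a c) =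
   - (\<Sum>a\<in>UNIV. \<Sum>b\<in>UNIV. \<Sum>c\<in>UNIV. phi a b c * h a b c)"
proof -
  have "(\<Sum>a\<in>UNIV. \<Sum>b\<in>UNIV. \<Sum>c\<in>UNIV. phi a b c * h b a c) =
      (\<Sum>b\<in>UNIV. \<Sum>a\<in>UNIV. \<Sum>c\<in>UNIV. phi a b c * h b a c)"
    by (rule sum.swap)
  also have "\<dots> = (\<Sum>a\<in>UNIV. \<Sum>b\<in>UNIV. \<Sum>c\<in>UNIV. - (phi a b c * h a b c))"
    by (subst phi_skew(1)) simp
  finally show ?thesis
    by (simp add: sum_negf)
qed

lemma skew_sum_eq_0:
  fixes A B :: "7 \<Rightarrow> 7 \<Rightarrow> real"
  assumes "\<And>i j. A i j = - A j i" "\<And>i j. B i j = B j i"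
  shows "(\<Sum>i\<in>UNIV. \<Sum>j\<in>UNIV. A i j * B i j) = 0"
proof -
  have "(\<Sum>i\<in>UNIV. \<Sum>j\<in>UNIV. A i j * B i j) = (\<Sum>j\<in>UNIV. \<Sum>i\<in>UNIV. A i j * B i j)"
    by (rule sum.swap)
  also have "\<dots> = (\<Sum>j\<in>UNIV. \<Sum>i\<in>UNIV. - (A j i * B j i))"
  proof (intro sum.cong refl)
    show "A i j * B i j = - (A j i * B j i)" for i j
      using assms(1)[of i j] assms(2)[of i j] by simp
  qed
  finally show ?thesis
    by (simp add: sum_negf)
qed

locale g2_algebra = skew2 +
  assumes act3_phi: "act3 K phi i j k = 0"
begin

text \<open>Contraction with \<phi> is equivariant: skewness moves \<open>K\<close> from both slots
  of \<open>X\<close> onto \<phi>, and the stabilizer equation trades these two terms for the action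
  on the free index.\<close>

lemma phic_act:
  "phic (\<lambda>a b. \<Sum>l\<in>UNIV. K a l * X l b + K b l * X a l) j = (\<Sum>m\<in>UNIV. K j m * phic X m)"
proof -
  have 1: "(\<Sum>a\<in>UNIV. \<Sum>l\<in>UNIV. phi j a b * (K a l * X l b)) =
      (\<Sum>a\<in>UNIV. \<Sum>l\<in>UNIV. - (K a l * phi j l b * X a b))" for b
    by (subst sum.swap, subst skew) (simp add: mult_ac)
  have 2: "(\<Sum>b\<in>UNIV. \<Sum>l\<in>UNIV. phi j a b * (K b l * X a l)) =
      (\<Sum>b\<in>UNIV. \<Sum>l\<in>UNIV. - (K b l * phi j a l * X a b))" for a
    by (subst sum.swap, subst skew) (simp add: mult_ac)
  have 3: "(\<Sum>a\<in>UNIV. \<Sum>b\<in>UNIV. \<Sum>l\<in>UNIV. phi j a b * (K a l * X l b)) =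
      (\<Sum>a\<in>UNIV. \<Sum>b\<in>UNIV. \<Sum>l\<in>UNIV. - (K a l * phi j l b * X a b))"
    (is "?l = ?r")
  proof -
    have "?l = (\<Sum>b\<in>UNIV. \<Sum>a\<in>UNIV. \<Sum>l\<in>UNIV. phi j a b * (K a l * X l b))"
      by (rule sum.swap)
    also have "\<dots> = ?r"
      unfolding 1 by (rule sum.swap)
    finally show ?thesis .
  qed
  have "phic (\<lambda>a b. \<Sum>l\<in>UNIV. K a l * X l b + K b l * X a l) j =
      (\<Sum>a\<in>UNIV. \<Sum>b\<in>UNIV. \<Sum>l\<in>UNIV. phi j a b * (K a l * X l b)) +
      (\<Sum>a\<in>UNIV. \<Sum>b\<in>UNIV. \<Sum>l\<in>UNIV. phi j a b * (K b l * X a l))"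
    by (simp add: phic_def sum.distrib sum_distrib_left distrib_left)
  also have "\<dots> = (\<Sum>a\<in>UNIV. \<Sum>b\<in>UNIV. \<Sum>l\<in>UNIV. - (K a l * phi j l b * X a b)) +
      (\<Sum>a\<in>UNIV. \<Sum>b\<in>UNIV. \<Sum>l\<in>UNIV. - (K b l * phi j a l * X a b))"
    unfolding 2 3 ..
  also have "\<dots> = (\<Sum>a\<in>UNIV. \<Sum>b\<in>UNIV.
      (\<Sum>l\<in>UNIV. - (K a l * phi j l b + K b l * phi j a l)) * X a b)"
    by (simp only: sum.distrib[symmetric] sum_distrib_right) (simp add: algebra_simps)
  also have "\<dots> = (\<Sum>a\<in>UNIV. \<Sum>b\<in>UNIV. (\<Sum>l\<in>UNIV. K j l * phi l a b) * X a b)"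
  proof (intro sum.cong refl)
    fix a b
    show "(\<Sum>l\<in>UNIV. - (K a l * phi j l b + K b l * phi j a l)) * X a b =
        (\<Sum>l\<in>UNIV. K j l * phi l a b) * X a b"
      using act3_phi[of j a b] by (simp add: act3_def sum.distrib sum_subtractf sum_negf)
  qed
  also have "\<dots> = (\<Sum>a\<in>UNIV. \<Sum>b\<in>UNIV. \<Sum>l\<in>UNIV. K j l * (phi l a b * X a b))"
    by (simp add: sum_distrib_right mult.assoc)
  also have "\<dots> = (\<Sum>l\<in>UNIV. \<Sum>a\<in>UNIV. \<Sum>b\<in>UNIV. K j l * (phi l a b * X a b))"
    by (subst (2) sum.swap, subst sum.swap) simp
  finally show ?thesis
    by (simp add: phic_def sum_distrib_left)
qed

lemma cmat_act3: "cmat (act3 K t) i j = (\<Sum>l\<in>UNIV. K i l * cmat t l j + K j l * cmat t i l)"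
proof -
  have "act3 K t i = (\<lambda>a b. (\<Sum>l\<in>UNIV. K i l * t l a b) + (\<Sum>l\<in>UNIV. K a l * t i l b + K b l * t i a
      l))"
    by (simp add: act3_def sum.distrib fun_eq_iff)
  then have "cmat (act3 K t) i j = phic (\<lambda>a b. \<Sum>l\<in>UNIV. K i l * t l a b) j +
      phic (\<lambda>a b. \<Sum>l\<in>UNIV. K a l * t i l b + K b l * t i a l) j"
    by (simp only: cmat_def phic_add)
  then show ?thesis
    by (simp only: phic_sum phic_act) (simp add: cmat_def sum.distrib)
qed

lemma cvec_act3: "cvec (act3 K t) j = (\<Sum>m\<in>UNIV. K j m * cvec t m)"
  unfolding cvec_def using phic_act[of "cmat t"] by (simp add: cmat_act3[abs_def])

text \<open>The full contraction with \<phi> is invariant under \<open>g\<^sub>2\<close>, so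
  rotating the adapted frame does not change it.\<close>

lemma trace_cmat_act3: "(\<Sum>i\<in>UNIV. cmat (act3 K t) i i) = 0"
proof -
  have "(\<Sum>i\<in>UNIV. \<Sum>l\<in>UNIV. K i l * (cmat t l i + cmat t i l)) = 0"
    by (rule skew_sum_eq_0[OF skew]) simp
  then show ?thesis
    by (simp add: cmat_act3 distrib_left)
qed
end

text \<open>Components in an orthonormal frame of the form \<sigma>, with
  \<open>g(T(X, Y), T(Z, V))\<close> expanded over the frame index \<open>m\<close>.\<close>

definition sigma_form :: "(7 \<Rightarrow> 7 \<Rightarrow> 7 \<Rightarrow> real) \<Rightarrow> 7 \<Rightarrow> 7 \<Rightarrow> 7 \<Rightarrow> 7 \<Rightarrow> real" where
  "sigma_form t i a b c =
     (\<Sum>m\<in>UNIV. t i a m * t b c m + t a b m * t i c m + t b i m * t a c m)"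

context skew3
begin

lemma skew4_sigma: "skew4 (sigma_form t)"
proof
  fix i j k l
  have s: "t b a m = - t a b m" for a b m
    by (rule skew)
  show "sigma_form t i j k l = - sigma_form t j i k l"
    unfolding sigma_form_def sum_negf[symmetric]
    by (intro sum.cong refl) (use s[of j i] s[of k i] s[of k j] in \<open>simp add: algebra_simps\<close>)
  show "sigma_form t i j k l = - sigma_form t i k j l"
    unfolding sigma_form_def sum_negf[symmetric]
    by (intro sum.cong refl) (use s[of j i] s[of k i] s[of k j] in \<open>simp add: algebra_simps\<close>)
  show "sigma_form t i j k l = - sigma_form t i j l k"
    unfolding sigma_form_def sum_negf[symmetric]
    by (intro sum.cong refl) (use s[of k i] s[of l i] s[of l k] s[of l j] s[of k j] in \<open>simp add:
        algebra_simps\<close>)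
qed

text \<open>Inserting a vector into \<sigma> amounts to letting the skew matrix \<open>v\<close>
  contracted with \<open>t\<close> act on \<open>t\<close>; this becomes useful when that matrix
  lies in \<open>g\<^sub>2\<close>.\<close>

lemma contract_sigma:
  "(\<Sum>i\<in>UNIV. v i * sigma_form t i a b c) = act3 (\<lambda>j k. \<Sum>i\<in>UNIV. v i * t i j k) t a b c"
proof -
  have e: "v i * (t i a m * t b c m + t a b m * t i c m + t b i m * t a c m) =
     v i * t i a m * t m b c + v i * t i b m * t a m c + v i * t i c m * t a b m" for i m
    using skew(1)[of b i m] skew(2)[of a c m] skew(2)[of b c m] skew(1)[of b m c]
    by (simp add: algebra_simps)
  have "(\<Sum>i\<in>UNIV. v i * sigma_form t i a b c) = (\<Sum>i\<in>UNIV. \<Sum>m\<in>UNIV.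
     v i * t i a m * t m b c + v i * t i b m * t a m c + v i * t i c m * t a b m)"
    by (simp add: sigma_form_def sum_distrib_left e)
  also have "\<dots> = (\<Sum>m\<in>UNIV. \<Sum>i\<in>UNIV.
     v i * t i a m * t m b c + v i * t i b m * t a m c + v i * t i c m * t a b m)"
    by (rule sum.swap)
  finally show ?thesis
    by (simp add: act3_def sum.distrib sum_distrib_right)
qed

text \<open>The three terms of \<sigma> contribute equally by the symmetry of \<phi>. In the
  resulting product \<open>t x\<close> is skew, so only the skew part of \<open>cmat t\<close>
  counts, which \<open>cmat_antisym\<close> expresses by \<open>cvec t\<close>.\<close>

lemma trace_cmat_sigma:
  "(\<Sum>b\<in>UNIV. cmat (sigma_form t x) b b) = - (1 / 2) * (\<Sum>a\<in>UNIV. cvec t a * cmat t x a)"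
proof -
  define h where "h a b c = (\<Sum>m\<in>UNIV. t x a m * t b c m)" for a b c
  have "sigma_form t x a b c = h a b c + h c a b - h b a c" for a b c
    using skew(1)[of b x] by (simp add: sigma_form_def h_def sum.distrib sum_subtractf mult.commute)
  then have "(\<Sum>b\<in>UNIV. cmat (sigma_form t x) b b) =
      3 * (\<Sum>a\<in>UNIV. \<Sum>b\<in>UNIV. \<Sum>c\<in>UNIV. phi a b c * h a b c)"
    using phi_sum_cyclic[of h] phi_sum_swap[of h]
    by (simp add: cmat_def phic_def distrib_left right_diff_distrib sum.distrib sum_subtractf)
  also have "(\<Sum>a\<in>UNIV. \<Sum>b\<in>UNIV. \<Sum>c\<in>UNIV. phi a b c * h a b c) =
      (\<Sum>a\<in>UNIV. phic (\<lambda>b c. \<Sum>m\<in>UNIV. t x a m * t m b c) a)"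
  proof -
    have "t b c m = t m b c" for b c m
      by (metis skew)
    then show ?thesis
      by (simp add: phic_def h_def)
  qed
  also have "\<dots> = (\<Sum>a\<in>UNIV. \<Sum>m\<in>UNIV. t x a m * cmat t m a)"
    by (simp add: phic_sum cmat_def)
  finally have 1: "(\<Sum>b\<in>UNIV. cmat (sigma_form t x) b b) =
      3 * (\<Sum>a\<in>UNIV. \<Sum>m\<in>UNIV. t x a m * cmat t m a)" .
  have "(\<Sum>a\<in>UNIV. \<Sum>m\<in>UNIV. t x a m * (cmat t m a + cmat t a m)) = 0"
    by (rule skew_sum_eq_0[OF skew(2)]) simp
  then have "2 * (\<Sum>a\<in>UNIV. \<Sum>m\<in>UNIV. t x a m * cmat t m a) =
      (\<Sum>a\<in>UNIV. \<Sum>m\<in>UNIV. t x a m * (cmat t m a - cmat t a m))"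
    by (simp add: distrib_left right_diff_distrib sum.distrib sum_subtractf)
  also have "\<dots> = (\<Sum>a\<in>UNIV. \<Sum>m\<in>UNIV. \<Sum>c\<in>UNIV. - (1 / 3) * (cvec t c * (phi c a m * t x a m)))"
  proof (intro sum.cong refl)
    fix a m
    have "phi m a c = - phi c a m" for c
      by (metis phi_skew)
    then show "t x a m * (cmat t m a - cmat t a m) =
        (\<Sum>c\<in>UNIV. - (1 / 3) * (cvec t c * (phi c a m * t x a m)))"
      by (simp only: cmat_antisym sum_distrib_left) (simp add: mult_ac)
  qed
  also have "\<dots> = (\<Sum>a\<in>UNIV. \<Sum>c\<in>UNIV. \<Sum>m\<in>UNIV. - (1 / 3) * (cvec t c * (phi c a m * t x a m)))"
    by (rule sum.cong[OF refl], rule sum.swap)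
  also have "\<dots> = (\<Sum>c\<in>UNIV. \<Sum>a\<in>UNIV. \<Sum>m\<in>UNIV. - (1 / 3) * (cvec t c * (phi c a m * t x a m)))"
    by (rule sum.swap)
  also have "\<dots> = - (1 / 3) * (\<Sum>c\<in>UNIV. cvec t c * cmat t x c)"
    by (simp only: cmat_def phic_def sum_distrib_left)
  finally show ?thesis
    using 1 by linarith
qed

text \<open>Write \<open>\<theta> = cvec t\<close> and \<open>C = cmat t\<close>. The trace formula
  gives \<open>C\<theta> = 0\<close>; the skew part of \<open>C\<close> is \<theta> inserted into
  \<phi> and kills \<theta>, so \<open>C\<^sup>T\<theta> = 0\<close> too. The latter says that
  \<tau>, which is \<theta> inserted into \<open>t\<close>, lies in \<open>g\<^sub>2\<close>. The
  last sum is then \<tau> applied to \<theta>, which is zero as \<open>t\<close> is skew.\<close>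

lemma sigma_cvec_eq_0:
  assumes "\<And>x. (\<Sum>b\<in>UNIV. cmat (sigma_form t x) b b) = 0"
  shows "(\<Sum>j\<in>UNIV. cmat t i j * cvec t j) = 0"
    and "(\<Sum>i\<in>UNIV. cvec t i * cmat t i j) = 0"
    and "(\<Sum>i\<in>UNIV. cvec t i * cvec (sigma_form t i) j) = 0"
proof -
  show 1: "(\<Sum>j\<in>UNIV. cmat t i j * cvec t j) = 0" for i
    using assms[of i] by (simp add: trace_cmat_sigma mult.commute)
  show 2: "(\<Sum>i\<in>UNIV. cvec t i * cmat t i j) = 0" for j
  proof -
    have "(\<Sum>i\<in>UNIV. \<Sum>a\<in>UNIV. phi j i a * (cvec t i * cvec t a)) = 0"
      by (rule skew_sum_eq_0) (rule phi_skew, simp)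
    then have z: "(\<Sum>i\<in>UNIV. (1 / 3) * (\<Sum>a\<in>UNIV. phi j i a * (cvec t i * cvec t a))) = 0"
      by (simp only: sum_distrib_left[symmetric])
    have "cmat t i j = cmat t j i - (1 / 3) * (\<Sum>a\<in>UNIV. phi j i a * cvec t a)" for i
      using cmat_antisym[of j i] by simp
    then have "cvec t i * cmat t i j = cmat t j i * cvec t i
        - (1 / 3) * (\<Sum>a\<in>UNIV. phi j i a * (cvec t i * cvec t a))" for i
      by (simp add: right_diff_distrib sum_distrib_left mult_ac)
    then show ?thesis
      by (simp only: sum_subtractf 1 z)
  qed
  define \<tau> where "\<tau> j k = (\<Sum>i\<in>UNIV. cvec t i * t i j k)" for j k
  interpret \<tau>: skew2 \<tau>
    by unfold_locales (simp add: \<tau>_def sum_negf[symmetric] flip: mult_minus_right skew(2))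
  have "phic \<tau> k = 0" for k
    using 2[of k] by (simp add: \<tau>_def[abs_def] phic_sum cmat_def)
  then interpret \<tau>: g2_algebra \<tau>
    by unfold_locales (rule \<tau>.act3_phi_eq_0)
  have "(\<Sum>i\<in>UNIV. cvec t i * cvec (sigma_form t i) j) = cvec (act3 \<tau> t) j"
    by (simp add: cvec_sum[symmetric] contract_sigma \<tau>_def[abs_def])
  also have "\<dots> = (\<Sum>m\<in>UNIV. \<Sum>i\<in>UNIV. t i j m * (cvec t i * cvec t m))"
    by (simp add: \<tau>.cvec_act3 \<tau>_def sum_distrib_left sum_distrib_right mult_ac)
  also have "\<dots> = 0"
  proof (rule skew_sum_eq_0)
    show "t i j m = - t m j i" for i m
      by (metis skew)
  qed simp
  finally show "(\<Sum>i\<in>UNIV. cvec t i * cvec (sigma_form t i) j) = 0" .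
qed
end


section \<open>Cross product by a vector\<close>

lemma cross_square:
  defines "F \<equiv> \<lambda>v a y. \<Sum>j\<in>UNIV. phi a j y * v j"
  shows "(\<Sum>y\<in>UNIV. F v a y * F v k y) = (\<Sum>j\<in>UNIV. v j * v j) * delta a k - v a * v k"
proof -
  define H where "H j l = (\<Sum>y\<in>UNIV. phi j a y * phi l k y)" for j l
  have F: "F v a y = - (\<Sum>j\<in>UNIV. phi j a y * v j)" for a y
    by (simp add: F_def phi_skew(1)[of a] sum_negf)
  have "(\<Sum>y\<in>UNIV. F v a y * F v k y) =
      (\<Sum>y\<in>UNIV. \<Sum>j\<in>UNIV. \<Sum>l\<in>UNIV. v j * v l * (phi j a y * phi l k y))"
    by (simp add: F sum_product mult_ac)
  also have "\<dots> = (\<Sum>j\<in>UNIV. \<Sum>y\<in>UNIV. \<Sum>l\<in>UNIV. v j * v l * (phi j a y * phi l k y))"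
    by (rule sum.swap)
  also have "\<dots> = (\<Sum>j\<in>UNIV. \<Sum>l\<in>UNIV. \<Sum>y\<in>UNIV. v j * v l * (phi j a y * phi l k y))"
    by (rule sum.cong[OF refl], rule sum.swap)
  finally have 1: "(\<Sum>y\<in>UNIV. F v a y * F v k y) = (\<Sum>j\<in>UNIV. \<Sum>l\<in>UNIV. v j * v l * H j l)"
    by (simp add: H_def sum_distrib_left)
  also have "\<dots> = (\<Sum>l\<in>UNIV. \<Sum>j\<in>UNIV. v j * v l * H j l)"
    by (rule sum.swap)
  also have "\<dots> = (\<Sum>j\<in>UNIV. \<Sum>l\<in>UNIV. v j * v l * H l j)"
    by (simp add: mult_ac)
  \<comment> \<open>The coefficients \<open>v j * v l\<close> are symmetric, so \<open>H\<close> may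
    be symmetrized and \<open>phi_phi_sym\<close> applies.\<close>
  finally have "2 * (\<Sum>y\<in>UNIV. F v a y * F v k y) =
      (\<Sum>j\<in>UNIV. \<Sum>l\<in>UNIV. v j * v l * (H j l + H l j))"
    using 1 by (simp add: distrib_left sum.distrib)
  also have "\<dots> = (\<Sum>j\<in>UNIV. \<Sum>l\<in>UNIV. 2 * delta a k * (v j * (v l * delta j l))
      - v j * delta j a * (v l * delta l k) - v j * delta j k * (v l * delta l a))"
    unfolding H_def phi_phi_sym by (simp add: algebra_simps)
  also have "\<dots> = 2 * ((\<Sum>j\<in>UNIV. v j * v j) * delta a k - v a * v k)"
    by (simp add: sum_subtractf sum_distrib_left[symmetric] sum_distrib_right[symmetric])
  finally show ?thesis
    by simp
qed

text \<open>With \<open>f\<close> the skew matrix of the cross product by \<open>v\<close>, the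
  relation reads \<open>m f = -3 s m\<close>. Hence \<open>d = m m f = -3 m s m\<close> is
  symmetric, and its trace against the skew \<open>f\<close> vanishes. On the other hand
  \<open>d f\<^sup>T = |v|\<^sup>2 m m\<close> because \<open>m v = 0\<close>, so the sum of squares
  of the entries of \<open>m\<close> is zero.\<close>

lemma eq_0_if_commute_cross:
  fixes M S :: "7 \<Rightarrow> 7 \<Rightarrow> real" and v :: "7 \<Rightarrow> real"
  assumes M: "\<And>i j. M i j = M j i" and S: "\<And>i j. S i j = S j i"
    and Mv: "\<And>i. (\<Sum>j\<in>UNIV. M i j * v j) = 0"
    and rel: "\<And>i y. (1 / 3) * (\<Sum>a\<in>UNIV. M i a * (\<Sum>j\<in>UNIV. phi a j y * v j))
        + (\<Sum>j\<in>UNIV. S i j * M y j) = 0"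
    and nz: "v k \<noteq> 0"
  shows "M i j = 0"
proof -
  define m s f :: "real^7^7" where "m = (\<chi> i j. M i j)" and "s = (\<chi> i j. S i j)"
    and "f = (\<chi> a y. \<Sum>j\<in>UNIV. phi a j y * v j)"
  have m: "transpose m = m"
    unfolding vec_eq_iff transpose_def m_def vec_lambda_beta using M by blast
  have s: "transpose s = s"
    unfolding vec_eq_iff transpose_def s_def vec_lambda_beta using S by blast
  have f: "transpose f = - f"
  proof -
    have "(\<Sum>j\<in>UNIV. phi a j y * v j) = - (\<Sum>j\<in>UNIV. phi y j a * v j)" for a y
      unfolding sum_negf[symmetric] by (intro sum.cong refl) (metis phi_skew mult_minus_left)
    then show ?thesis
      unfolding vec_eq_iff transpose_def f_def vector_uminus_component vec_lambda_beta by blast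
  qed
  have mf: "m ** f = (- 3) *\<^sub>R (s ** m)"
  proof -
    have "(\<Sum>a\<in>UNIV. M i a * (\<Sum>j\<in>UNIV. phi a j y * v j)) = - 3 * (\<Sum>j\<in>UNIV. S i j * M j y)" for i y
      using rel[of i y] M[of _ y] by simp
    then show ?thesis
      by (simp add: vec_eq_iff matrix_matrix_mult_def m_def s_def f_def)
  qed
  define d where "d = m ** (m ** f)"
  have "d = (- 3) *\<^sub>R (m ** s ** m)"
    by (simp only: d_def mf matrix_scalar_ac matrix_mul_assoc scalar_matrix_assoc)
  then have d: "transpose d = d"
    by (simp only: transpose_scalar matrix_transpose_mul m s matrix_mul_assoc)
  have ff: "f ** transpose f = (\<chi> a k. (\<Sum>j\<in>UNIV. v j * v j) * delta a k - v a * v k)"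
    by (simp add: vec_eq_iff matrix_matrix_mult_def transpose_def f_def cross_square)
  have mff: "m ** (f ** transpose f) = (\<Sum>j\<in>UNIV. v j * v j) *\<^sub>R m"
  proof -
    have "(\<Sum>k\<in>UNIV. M i k * (n * delta k j - v k * v j)) = n * M i j" for i j n
    proof -
      have "(\<Sum>k\<in>UNIV. M i k * (n * delta k j - v k * v j)) =
          (\<Sum>k\<in>UNIV. n * (M i k * delta k j) - M i k * v k * v j)"
        by (simp add: algebra_simps)
      then show ?thesis
        by (simp add: sum_subtractf Mv sum_distrib_left[symmetric] sum_distrib_right[symmetric])
    qed
    then show ?thesis
      unfolding ff by (simp add: vec_eq_iff matrix_matrix_mult_def m_def)
  qed
  have "trace (d ** transpose f) = - trace (d ** f)"
    by (simp add: f trace_def matrix_matrix_mult_def sum_negf)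
  moreover have "trace (d ** transpose f) = trace (d ** f)"
  proof -
    have "trace (d ** f) = trace (transpose (d ** f))"
      by (simp add: trace_def transpose_def)
    also have "\<dots> = trace (transpose f ** d)"
      by (simp add: matrix_transpose_mul d)
    finally show ?thesis
      by (simp only: trace_mul_sym[of d "transpose f"])
  qed
  moreover have "d ** transpose f = (\<Sum>j\<in>UNIV. v j * v j) *\<^sub>R (m ** m)"
    unfolding d_def matrix_mul_assoc[symmetric] mff by (simp only: matrix_scalar_ac
        scalar_matrix_assoc)
  ultimately have "(\<Sum>j\<in>UNIV. v j * v j) * trace (m ** m) = 0"
    by (simp add: trace_def sum_distrib_left)
  moreover have "(\<Sum>j\<in>UNIV. v j * v j) \<noteq> 0"
    using nz by (subst sum_nonneg_eq_0_iff) auto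
  ultimately have "trace (m ** m) = 0"
    by simp
  then have "(\<Sum>i\<in>UNIV. \<Sum>j\<in>UNIV. M i j * M i j) = 0"
    using M by (simp add: trace_def matrix_matrix_mult_def m_def)
  then show ?thesis
    by (simp add: sum_nonneg_eq_0_iff sum_nonneg)
qed

section \<open>The stabilizer of the model form is orthogonal\<close>

definition outer :: "real^7 \<Rightarrow> real^7 \<Rightarrow> real^7^7" where
  "outer u v = (\<chi> i j. u $ i * v $ j)"

lemma outer_mult:
  "outer u v ** outer w z = (v \<bullet> w) *\<^sub>R outer u z"
  "A ** outer u v = outer (A *v u) v"
  "outer u v ** A = outer u (transpose A *v v)"
  by (simp_all add: vec_eq_iff matrix_matrix_mult_def matrix_vector_mult_def transpose_def outer_def
      inner_vec_def sum_distrib_left sum_distrib_right mult_ac)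

lemma transpose_outer [simp]: "transpose (outer u v) = outer v u"
  by (simp add: outer_def transpose_def vec_eq_iff mult.commute)

lemma outer_linear:
  "outer (c *\<^sub>R u) v = c *\<^sub>R outer u v" "outer u (c *\<^sub>R v) = c *\<^sub>R outer u v"
  "outer (u + u') v = outer u v + outer u' v" "outer u (v + v') = outer u v + outer u v'"
  by (simp_all add: outer_def vec_eq_iff algebra_simps)

lemma transpose_add: "transpose (A + B) = transpose A + transpose (B :: real^7^7)"
  by (simp add: transpose_def vec_eq_iff)

lemma matrix_add_rdistrib: "(A + B) ** C = A ** C + B ** (C :: real^7^7)"
  by (simp add: matrix_matrix_mult_def vec_eq_iff distrib_right sum.distrib)

lemma minus_matrix_vector_mult: "(- A) *v x = - (A *v (x :: real^7))"
  by (simp add: vec_eq_iff matrix_vector_mult_def sum_negf)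

lemma outer_vec: "outer u v *v w = (v \<bullet> w) *\<^sub>R u"
  by (simp add: vec_eq_iff matrix_vector_mult_def outer_def inner_vec_def sum_distrib_left
      sum_distrib_right mult_ac)

lemmas mat_simps = matrix_add_ldistrib matrix_add_rdistrib matrix_scalar_ac
  scalar_matrix_assoc[symmetric] scaleR_matrix_vector_assoc[symmetric]
      matrix_vector_mult_add_rdistrib
  outer_vec

lemma det_mat1_add_outer_self: "det (mat 1 + \<kappa> *\<^sub>R outer u u) = 1 + \<kappa> * (u \<bullet> u)"
proof -
  \<comment> \<open>An orthogonal map takes \<open>u\<close> to a multiple of the first basis
    vector, where the matrix is diagonal.\<close>
  define v :: "real^7" where "v = norm u *\<^sub>R axis 1 1"
  have "norm v = norm u"
    by (simp add: v_def norm_axis_1)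
  then obtain f where f: "orthogonal_transformation f" "f v = u"
    using orthogonal_transformation_exists by metis
  define P where "P = matrix f"
  have P: "orthogonal_matrix P" and Pv: "P *v v = u"
    using f orthogonal_transformation_matrix[of f] by (auto simp: P_def matrix_works)
  have "P ** (mat 1 + \<kappa> *\<^sub>R outer v v) ** transpose P = mat 1 + \<kappa> *\<^sub>R outer u u"
    using P Pv by (simp add: mat_simps outer_mult outer_linear orthogonal_matrix_def)
  then have "det (mat 1 + \<kappa> *\<^sub>R outer u u) = det P * det (mat 1 + \<kappa> *\<^sub>R outer v v) * det (transpose
      P)"
    by (metis det_mul)
  also have "\<dots> = (det P * det P) * det (mat 1 + \<kappa> *\<^sub>R outer v v)"
    by simp
  also have "det P * det P = 1"
    using det_orthogonal_matrix[OF P] by auto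
  also have "det (mat 1 + \<kappa> *\<^sub>R outer v v) = (\<Prod>i\<in>UNIV. (mat 1 + \<kappa> *\<^sub>R outer v v) $ i $ i)"
    by (rule det_diagonal) (auto simp: mat_def outer_def v_def axis_def)
  also have "\<dots> = (\<Prod>i\<in>UNIV. if i = (1::7) then 1 + \<kappa> * (u \<bullet> u) else 1)"
    by (intro prod.cong refl) (simp add: mat_def outer_def v_def axis_def
        power2_norm_eq_inner[symmetric] power2_eq_square)
  finally show ?thesis
    by simp
qed

text \<open>The reflection \<open>R\<close> in the hyperplane orthogonal to \<open>u\<close>
  conjugates the matrix into \<open>mat 1 + outer u (- d)\<close>, which is its inverse. So the
  determinant equals its own reciprocal.\<close>

lemma det_mat1_add_outer_orthogonal:
  assumes "u \<bullet> d = 0" "u \<noteq> 0"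
  shows "det (mat 1 + outer u d) ^ 2 = 1"
proof -
  define c where "c = - (2 / (u \<bullet> u))"
  have c: "c * (u \<bullet> u) = - 2"
    using assms(2) by (simp add: c_def)
  define R where "R = mat 1 + c *\<^sub>R outer u u"
  have "det R = - 1"
    by (simp add: R_def det_mat1_add_outer_self c)
  have Rd: "R *v (- d) = - d" and R: "transpose R = R"
    using assms(1) by (simp_all add: R_def mat_simps transpose_add transpose_scalar)
  have "R *v u = u + (c * (u \<bullet> u)) *\<^sub>R u"
    by (simp add: R_def mat_simps)
  then have Ru: "R *v u = - u"
    by (simp add: c) (simp add: vec_eq_iff)
  have "R ** (mat 1 + outer u d) = R + outer (- u) d"
    by (simp add: mat_simps outer_mult Ru)
  also have "\<dots> = (mat 1 + outer u (- d)) ** R"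
    using Rd by (simp add: mat_simps outer_mult R) (simp add: outer_def vec_eq_iff)
  finally have "det R * det (mat 1 + outer u d) = det (mat 1 + outer u (- d)) * det R"
    by (metis det_mul)
  then have "det (mat 1 + outer u d) = det (mat 1 + outer u (- d))"
    by (simp add: \<open>det R = - 1\<close>)
  moreover have "(mat 1 + outer u d) ** (mat 1 + outer u (- d)) = mat 1"
    using assms(1) by (simp add: mat_simps outer_mult inner_commute) (simp add: outer_def
        vec_eq_iff)
  ultimately show ?thesis
    by (metis det_I det_mul power2_eq_square)
qed

section \<open>Determinants built from the cross product\<close>

definition cross_mat :: "real^7 \<Rightarrow> real^7^7" where
  "cross_mat u = (\<chi> a b. \<Sum>j\<in>UNIV. phi a j b * u $ j)"

lemma transpose_cross_mat: "transpose (cross_mat u) = - cross_mat u"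
proof -
  have "(\<Sum>j\<in>UNIV. phi a j b * u $ j) = - (\<Sum>j\<in>UNIV. phi b j a * u $ j)" for a b
    unfolding sum_negf[symmetric] by (intro sum.cong refl) (metis phi_skew mult_minus_left)
  then show ?thesis
    unfolding vec_eq_iff transpose_def cross_mat_def vector_uminus_component vec_lambda_beta by
        blast
qed

lemma cross_mat_self: "cross_mat u *v u = 0"
proof -
  have "(\<Sum>b\<in>UNIV. \<Sum>j\<in>UNIV. phi a j b * (u $ j * u $ b)) = 0" for a
    by (subst sum.swap, rule skew_sum_eq_0) (rule phi_skew, simp)
  then show ?thesis
    by (simp add: vec_eq_iff matrix_vector_mult_def cross_mat_def sum_distrib_right mult.assoc)
qed

lemma cross_mat_square:
  "cross_mat u ** transpose (cross_mat u) = mat (u \<bullet> u) + (- 1) *\<^sub>R outer u u"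
  by (simp add: vec_eq_iff matrix_matrix_mult_def transpose_def cross_mat_def cross_square
      outer_def mat_def inner_vec_def delta_def)

lemma phi0_cross_mat: "v \<bullet> (cross_mat u *v w) = phi0 v u w"
  by (simp add: inner_vec_def matrix_vector_mult_def cross_mat_def sum_7 phi_simps phi0_def det3_def
      algebra_simps)

text \<open>For \<open>s = 1 / |u|\<close> the matrix is |u| times an orthogonal one, which settles
  this case. Every other \<open>s\<close> is reached by a factor
  \<open>mat 1 + \<kappa> *\<^sub>R outer u u\<close> of known determinant.\<close>

lemma det_cross_mat_add_outer_self:
  assumes "u \<noteq> 0"
  shows "det (cross_mat u + s *\<^sub>R outer u u) ^ 2 = s ^ 2 * (u \<bullet> u) ^ 8"
proof -
  define n where "n = u \<bullet> u"
  define r where "r = 1 / sqrt n"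
  have n: "n > 0"
    using assms by (simp add: n_def)
  then have r: "r * r * n = 1" "r > 0"
    by (simp_all add: r_def field_simps)
  define Z where "Z = cross_mat u + r *\<^sub>R outer u u"
  have "transpose (cross_mat u) *v u = 0"
    by (simp add: transpose_cross_mat cross_mat_self minus_matrix_vector_mult)
  moreover have "outer u 0 = 0" "outer 0 u = 0"
    by (simp_all add: outer_def vec_eq_iff)
  ultimately have "Z ** transpose Z = mat n + (r * r * n - 1) *\<^sub>R outer u u"
    by (simp add: Z_def transpose_add transpose_scalar mat_simps outer_mult outer_linear
        cross_mat_square cross_mat_self
        n_def algebra_simps)
  then have "Z ** transpose Z = mat n"
    using r by simp
  then have "det Z * det Z = det (mat n :: real^7^7)"
    by (metis det_mul det_transpose)
  also have "\<dots> = n ^ 7"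
    by (subst det_diagonal) (auto simp: mat_def)
  finally have Z: "det Z ^ 2 = n ^ 7"
    by (simp add: power2_eq_square)
  define \<kappa> where "\<kappa> = (s / r - 1) / n"
  have k: "1 + \<kappa> * n = s / r"
    using n by (simp add: \<kappa>_def)
  have "Z ** (mat 1 + \<kappa> *\<^sub>R outer u u) = cross_mat u + (r * (1 + \<kappa> * n)) *\<^sub>R outer u u"
    by (simp add: Z_def mat_simps outer_mult cross_mat_self \<open>outer 0 u = 0\<close> outer_linear n_def
        algebra_simps)
  also have "\<dots> = cross_mat u + s *\<^sub>R outer u u"
    unfolding k using r by simp
  finally have "det (cross_mat u + s *\<^sub>R outer u u) = det Z * (s / r)"
    by (metis det_mul det_mat1_add_outer_self k n_def)
  then have "det (cross_mat u + s *\<^sub>R outer u u) ^ 2 = n ^ 7 * (s ^ 2 / (r * r))"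
    by (simp add: power_mult_distrib power_divide Z) (simp add: power2_eq_square)
  also have "1 / (r * r) = n"
    using r by (simp add: field_simps)
  then have "n ^ 7 * (s ^ 2 / (r * r)) = n ^ 7 * (s ^ 2 * n)"
    by (metis times_divide_eq_right mult.right_neutral)
  also have "\<dots> = s ^ 2 * n ^ 8"
    by algebra
  finally show ?thesis
    by (simp add: n_def)
qed

text \<open>Since \<open>cross_mat u\<close> annihilates \<open>u\<close> from both sides,
  congruence by the shear \<open>Q = mat 1 + outer u d\<close> leaves it fixed. With \<beta> and
  \<open>d\<close> from the splitting of \<open>b\<close> along \<open>u\<close>, it turns the rank
  one term of \<open>\<beta> u\<close> into that of \<open>b\<close>.\<close>

lemma det_cross_mat_add_outer:
  assumes "u \<noteq> 0" "b \<bullet> u \<noteq> 0"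
  shows "det (cross_mat u + outer b b) ^ 2 = (b \<bullet> u) ^ 4 * (u \<bullet> u) ^ 4"
proof -
  define n \<beta> where "n = u \<bullet> u" and "\<beta> = (b \<bullet> u) / n"
  have n: "n \<noteq> 0" and \<beta>: "\<beta> \<noteq> 0" "\<beta> * n = b \<bullet> u"
    using assms by (simp_all add: n_def \<beta>_def)
  define d where "d = (1 / (\<beta> * n)) *\<^sub>R (b - \<beta> *\<^sub>R u)"
  define Q where "Q = mat 1 + outer u d"
  have "u \<bullet> d = 0"
    using \<beta> by (simp add: d_def inner_diff_right inner_commute flip: n_def)
  then have Q: "det Q ^ 2 = 1"
    unfolding Q_def by (rule det_mat1_add_outer_orthogonal) fact
  have "b = \<beta> *\<^sub>R u + (\<beta> * n) *\<^sub>R d"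
    using n \<beta>(1) by (simp add: d_def)
  then have b: "b = \<beta> *\<^sub>R (transpose Q *v u)"
    by (simp add: Q_def transpose_add mat_simps scaleR_right_distrib flip: n_def)
  have "outer u 0 = 0" "outer 0 u = 0" for u
    by (simp_all add: outer_def vec_eq_iff)
  moreover have "transpose (cross_mat u) *v u = 0"
    by (simp add: transpose_cross_mat cross_mat_self minus_matrix_vector_mult)
  ultimately have "transpose Q ** (cross_mat u + (\<beta> * \<beta>) *\<^sub>R outer u u) ** Q = cross_mat u + outer b
      b"
    unfolding b by (simp add: Q_def transpose_add mat_simps outer_mult cross_mat_self outer_linear
        algebra_simps)
  from arg_cong[OF this, of det]
  have "det (cross_mat u + outer b b) ^ 2 =
      det Q ^ 2 * det (cross_mat u + (\<beta> * \<beta>) *\<^sub>R outer u u) ^ 2 * det Q ^ 2"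
    by (simp only: det_mul det_transpose flip: power_mult_distrib)
  also have "\<dots> = (\<beta> * \<beta>) ^ 2 * n ^ 8"
    by (simp add: Q det_cross_mat_add_outer_self[OF assms(1)] n_def)
  also have "\<dots> = (\<beta> * n) ^ 4 * n ^ 4"
    by algebra
  finally show ?thesis
    unfolding \<beta>(2) unfolding n_def .
qed


lemma eq_if_inner_eq:
  fixes A B :: "real^7^7"
  assumes "\<And>x y. x \<bullet> (A *v y) = x \<bullet> (B *v y)"
  shows "A = B"
  unfolding matrix_eq by (metis assms vector_eq_ldot)

text \<open>The determinant of \<open>cross_mat u + b b\<^sup>T\<close> transforms under the stabilizer by \<open>(det A)\<^sup>2\<close>, and its
  square is \<open>(b \<bullet> u)\<^sup>4 (u \<bullet> u)\<^sup>4\<close>; this shows that \<open>A\<close> is conformal with a factor determined by \<open>det A\<close>.\<close>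

lemma phi0_stabilizer_orthogonal:
  assumes "invertible A" and phi0: "\<And>u v w. phi0 (A *v u) (A *v v) (A *v w) = phi0 u v w"
  shows "(A *v u) \<bullet> (A *v v) = u \<bullet> v"
proof -
  define c where "c = \<bar>det A\<bar>"
  have c: "c > 0"
    using assms(1) by (simp add: c_def invertible_det_nz)
  have inj: "A *v u \<noteq> 0" if "u \<noteq> 0" for u
    using assms(1) that by (metis invertible_def matrix_vector_mul_assoc matrix_vector_mul_lid
        matrix_vector_mult_0_right)
  have norm: "u \<bullet> u = c * ((A *v u) \<bullet> (A *v u))" for u
  proof (cases "u = 0")
    case False
    \<comment> \<open>With this \<open>b\<close> the congruence by \<open>A\<close> pulls
      \<open>outer u' u'\<close> back to \<open>outer b b\<close>, while invariance of \<phi> pulls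
      \<open>cross_mat u'\<close> back to \<open>cross_mat u\<close>.\<close>
    define u' b n n' where "u' = A *v u" and "b = transpose A *v u'" and "n = u \<bullet> u" and "n' = u' \<bullet>
        u'"
    have n: "n > 0" "n' > 0"
      using False inj[of u] by (simp_all add: n_def n'_def u'_def)
    have b: "b \<bullet> u = n'"
      by (simp add: b_def n'_def u'_def dot_lmul_matrix)
    have "transpose A ** cross_mat u' ** A = cross_mat u"
    proof (rule eq_if_inner_eq)
      fix x y
      have "x \<bullet> ((transpose A ** cross_mat u' ** A) *v y) = (A *v x) \<bullet> (cross_mat u' *v (A *v y))"
        by (metis dot_lmul_matrix inner_commute matrix_vector_mul_assoc vector_transpose_matrix)
      then show "x \<bullet> ((transpose A ** cross_mat u' ** A) *v y) = x \<bullet> (cross_mat u *v y)"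
        by (simp add: phi0_cross_mat u'_def phi0)
    qed
    then have "transpose A ** (cross_mat u' + outer u' u') ** A = cross_mat u + outer b b"
      by (simp add: mat_simps outer_mult b_def)
    from arg_cong[OF this, of det]
    have "det (cross_mat u + outer b b) = det A * det (cross_mat u' + outer u' u') * det A"
      by (simp add: det_mul)
    then have "det A ^ 4 * det (cross_mat u' + outer u' u') ^ 2 = det (cross_mat u + outer b b) ^ 2"
      by algebra
    then have "c ^ 4 * det (cross_mat u' + 1 *\<^sub>R outer u' u') ^ 2 = det (cross_mat u + outer b b) ^
        2"
      by (simp add: c_def)
    then have "c ^ 4 * n' ^ 8 = n' ^ 4 * n ^ 4"
      using det_cross_mat_add_outer_self[of u' 1] det_cross_mat_add_outer[of u b] n b False inj[of
          u]
      by (simp add: n_def n'_def u'_def)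
    moreover have "n' ^ 4 * (c * n') ^ 4 = c ^ 4 * n' ^ 8"
      by algebra
    ultimately have "n' ^ 4 * (c * n') ^ 4 = n' ^ 4 * n ^ 4"
      by simp
    moreover have "n' ^ 4 \<noteq> 0"
      using n by simp
    ultimately have "(c * n') ^ 4 = n ^ 4"
      using mult_left_cancel by blast
    then have "c * n' = n"
      using n c power_eq_iff_eq_base[of 4 "c * n'" n] by simp
    then show ?thesis
      by (simp add: n_def n'_def u'_def)
  qed simp
  have inner: "u \<bullet> v = c * ((A *v u) \<bullet> (A *v v))" for u v
    using norm[of u] norm[of v] norm[of "u + v"]
    by (simp add: matrix_vector_right_distrib inner_add_left inner_add_right inner_commute
        algebra_simps)
  \<comment> \<open>Determinants now fix the conformal factor: in dimension 7 they give
    \<open>c ^ 7 * c ^ 2 = 1\<close>.\<close>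
  have "mat 1 = c *\<^sub>R (transpose A ** A)"
  proof (rule eq_if_inner_eq)
    fix x y
    show "x \<bullet> (mat 1 *v y) = x \<bullet> ((c *\<^sub>R (transpose A ** A)) *v y)"
    proof -
      have "x \<bullet> ((transpose A ** A) *v y) = (A *v x) \<bullet> (A *v y)"
        by (metis dot_lmul_matrix inner_commute matrix_vector_mul_assoc vector_transpose_matrix)
      then show ?thesis
        using inner[of x y] by (simp only: scaleR_matrix_vector_assoc[symmetric] inner_scaleR_right
            matrix_vector_mul_lid)
    qed
  qed
  also have "\<dots> = mat c ** (transpose A ** A)"
    by (simp add: vec_eq_iff matrix_matrix_mult_def mat_def if_distrib if_distribR cong: if_cong)
  finally have "det (mat 1 :: real^7^7) = det (mat c :: real^7^7) * (det A * det A)"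
    by (metis det_mul det_transpose)
  moreover have "det (mat c :: real^7^7) = c ^ 7"
    by (subst det_diagonal) (auto simp: mat_def)
  moreover have "det A * det A = c * c"
    by (simp add: c_def)
  ultimately have "c ^ 7 * (c * c) = 1"
    by (metis det_I)
  then have "c ^ 9 = 1"
    by algebra
  then have "c = 1"
    using c power_eq_1_iff[of c 9] by auto
  then show ?thesis
    using inner[of u v] by simp
qed

section \<open>Coordinate formulas for wedge product and Hodge star\<close>

lemma nths_single:
  assumes "k < length vs"
  shows "nths vs {k} = [vs ! k]" "nths vs (- {k}) = take k vs @ drop (Suc k) vs"
  using assms
proof (induction vs arbitrary: k)
  case (Cons x vs)
  have c1: "{j. Suc j \<in> {k}} = (if k = 0 then {} else {k - 1})"
    "{j. Suc j \<in> - {k}} = (if k = 0 then UNIV else - {k - 1})"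
    by auto
  have c2: "{j. j \<noteq> n} = - {n}" for n :: nat
    by auto
  {
    case 1 show ?case
      using Cons \<open>k < _\<close> by (cases k) (simp_all add: nths_Cons 1)
  next
    case 2 show ?case
      using Cons \<open>k < _\<close> by (cases k) (simp_all add: nths_Cons c1 c2 nths_all)
  }
qed simp_all

text \<open>A 1-form vanishes on lists of length other than one, so only singletons
  \<open>{k}\<close> contribute; the pairs counted by the sign are the \<open>k\<close> positions
  before \<open>k\<close>.\<close>

lemma wedge_tensor1:
  "wedge (tensor1 f) \<beta> vs =
     (\<Sum>k<length vs. (- 1) ^ k * f (vs ! k) * \<beta> (take k vs @ drop (Suc k) vs))"
proof -
  define n where "n = length vs"
  define g where "g S = (- 1) ^ card {(i, j). i \<in> {..<n} - S \<and> j \<in> S \<and> i < j}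
       * tensor1 f (nths vs S) * \<beta> (nths vs (- S))" for S
  have "wedge (tensor1 f) \<beta> vs = sum g (Pow {..<n})"
    by (simp add: wedge_def g_def n_def)
  also have "\<dots> = sum g ((\<lambda>k. {k}) ` {..<n})"
  proof (rule sum.mono_neutral_right)
    show "\<forall>S\<in>Pow {..<n} - (\<lambda>k. {k}) ` {..<n}. g S = 0"
    proof
      fix S assume S: "S \<in> Pow {..<n} - (\<lambda>k. {k}) ` {..<n}"
      have "{i. i < length vs \<and> i \<in> S} = S"
        using S by (auto simp: n_def)
      then have "length (nths vs S) = card S"
        by (simp add: length_nths)
      moreover have "card S \<noteq> 1"
        using S by (auto simp: card_1_singleton_iff)
      ultimately show "g S = 0"
        by (simp add: g_def tensor1_def)
    qed
  qed auto
  also have "\<dots> = (\<Sum>k<n. g {k})"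
    by (subst sum.reindex) (auto simp: inj_on_def)
  also have "\<dots> = (\<Sum>k<n. (- 1) ^ k * f (vs ! k) * \<beta> (take k vs @ drop (Suc k) vs))"
  proof (intro sum.cong refl)
    fix k assume "k \<in> {..<n}"
    then have k: "k < length vs"
      by (simp add: n_def)
    then have "{(i, j). i \<in> {..<n} - {k} \<and> j \<in> {k} \<and> i < j} = (\<lambda>i. (i, k)) ` {..<k}"
      by (auto simp: n_def)
    then have "card {(i, j). i \<in> {..<n} - {k} \<and> j \<in> {k} \<and> i < j} = k"
      by (simp add: card_image inj_on_def)
    then show "g {k} = (- 1) ^ k * f (vs ! k) * \<beta> (take k vs @ drop (Suc k) vs)"
      using k by (simp add: g_def nths_single tensor1_def)
  qed
  finally show ?thesis
    by (simp add: n_def)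
qed

lemma coforms_Cons:
  "coforms E (i # I) vs =
     (\<Sum>k<length vs. (- 1) ^ k * (E *v vs ! k) $ i * coforms E I (take k vs @ drop (Suc k) vs))"
  by (simp add: coforms_def coform_def wedge_tensor1)

lemma coforms_Nil: "coforms E [] vs = (if vs = [] then 1 else 0)"
  by (simp add: coforms_def)

lemma coforms_eq_0: "length vs \<noteq> length I \<Longrightarrow> coforms E I vs = 0"
proof (induction I arbitrary: vs)
  case (Cons i I)
  have "coforms E I (take k vs @ drop (Suc k) vs) = 0" if "k < length vs" for k
    using that Cons.prems by (intro Cons.IH) auto
  then show ?case
    by (simp add: coforms_Cons)
qed (simp add: coforms_Nil)

lemma coforms_3: "coforms E [i, j, k] [u, v, w] = det3 i j k (E *v u) (E *v v) (E *v w)"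
  by (simp add: coforms_Cons coforms_Nil sum.lessThan_Suc numeral_2_eq_2 det3_def) algebra

lemma g2_model_3: "g2_model E [u, v, w] = phi0 (E *v u) (E *v v) (E *v w)"
  by (simp add: g2_model_def phi0_def coforms_3)

lemma g2_model_eq_0: "length vs \<noteq> 3 \<Longrightarrow> g2_model E vs = 0"
  by (simp add: g2_model_def coforms_eq_0)

lemma matrix_inv:
  fixes E :: "real^7^7"
  assumes "invertible E"
  shows "E ** matrix_inv E = mat 1" "matrix_inv E ** E = mat 1"
  using someI_ex[OF assms[unfolded invertible_def]] by (simp_all add: matrix_inv_def)

lemma frame:
  assumes "invertible E"
  shows "E *v frame E i = axis i 1"
proof -
  have "E *v frame E i = column i (E ** matrix_inv E)"
    by (simp add: frame_def column_def matrix_matrix_mult_def matrix_vector_mult_def vec_eq_iff)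
  also have "\<dots> = axis i 1"
    using assms by (simp add: matrix_inv column_def mat_def axis_def vec_eq_iff)
  finally show ?thesis .
qed

lemma frame_expand:
  assumes "invertible A"
  shows "v = (\<Sum>l\<in>UNIV. (A *v v) $ l *\<^sub>R frame A l)"
proof -
  have "A *v (\<Sum>l\<in>UNIV. (A *v v) $ l *\<^sub>R frame A l) = (\<Sum>l\<in>UNIV. (A *v v) $ l *\<^sub>R axis l 1)"
    by (simp add: linear_sum[OF matrix_vector_mul_linear] matrix_vector_mult_scaleR frame[OF assms])
  also have "\<dots> = A *v v"
    by (simp add: vec_eq_iff axis_def if_distrib cong: if_cong)
  finally have "matrix_inv A *v (A *v (\<Sum>l\<in>UNIV. (A *v v) $ l *\<^sub>R frame A l)) = matrix_inv A *v (A *v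
      v)"
    by (rule arg_cong)
  then show ?thesis
    unfolding matrix_vector_mul_assoc matrix_inv(2)[OF assms] matrix_vector_mul_lid by (rule sym)
qed

lemma linear_frame_expand:
  fixes f :: "real^7 \<Rightarrow> real"
  assumes "invertible A" "linear f"
  shows "f v = (\<Sum>l\<in>UNIV. (A *v v) $ l * f (frame A l))"
proof -
  have "f v = f (\<Sum>l\<in>UNIV. (A *v v) $ l *\<^sub>R frame A l)"
    by (rule arg_cong[OF frame_expand[OF assms(1)]])
  then show ?thesis
    by (simp add: linear_sum[OF assms(2)] linear_cmul[OF assms(2)])
qed

text \<open>The coefficients are written through the metric alone, so the expansion can be compared
  between different coframes of the same metric.\<close>

lemma linear_frame_expand_inner:
  fixes f :: "real^7 \<Rightarrow> real"
  assumes "invertible A" "linear f"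
  shows "f v = (\<Sum>l\<in>UNIV. ((A *v v) \<bullet> (A *v frame A l)) * f (frame A l))"
  using linear_frame_expand[OF assms, of v] by (simp add: frame[OF assms(1)] inner_axis)

text \<open>The coframe selected by \<open>SOME\<close> and the given \<open>E\<close> differ by a
  stabilizer of the model form, which is orthogonal.\<close>

lemma g2_metric_eq:
  assumes "g2_adapted \<phi> E"
  shows "g2_metric \<phi> u v = (E *v u) \<bullet> (E *v v)"
proof -
  define E' where "E' = g2_coframe \<phi>"
  have "g2_adapted \<phi> E'"
    unfolding E'_def g2_coframe_def using assms by (rule someI)
  then have E': "invertible E'" "\<phi> = g2_model E'"
    by (simp_all add: g2_adapted_def)
  have E: "invertible E" "\<phi> = g2_model E"
    using assms by (simp_all add: g2_adapted_def)
  define A where "A = E' ** matrix_inv E"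
  have inv: "matrix_inv E *v (E *v x) = x" "E *v (matrix_inv E *v x) = x" for x
    using E(1) by (simp_all add: matrix_vector_mul_assoc matrix_inv)
  have A: "A *v (E *v x) = E' *v x" for x
    by (simp add: A_def inv flip: matrix_vector_mul_assoc)
  have "phi0 (A *v u) (A *v v) (A *v w) = phi0 u v w" for u v w
  proof -
    have "g2_model E' [matrix_inv E *v u, matrix_inv E *v v, matrix_inv E *v w] =
        g2_model E [matrix_inv E *v u, matrix_inv E *v v, matrix_inv E *v w]"
      using E(2) E'(2) by simp
    then show ?thesis
      by (simp add: g2_model_3 inv A_def flip: matrix_vector_mul_assoc)
  qed
  moreover have "invertible A"
    unfolding A_def using E(1) E'(1) by (metis invertible_def invertible_mult matrix_inv)
  ultimately have "(A *v (E *v u)) \<bullet> (A *v (E *v v)) = (E *v u) \<bullet> (E *v v)"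
    by (intro phi0_stabilizer_orthogonal)
  then show ?thesis
    by (simp add: A g2_metric_def E'_def)
qed

text \<open>Values of \<open>e\<^sub>I\<close> on the dual frame, in a form that the simplifier can compute.\<close>

definition coforms_index :: "7 list \<Rightarrow> 7 list \<Rightarrow> real" where
  "coforms_index I J = coforms (mat 1) I (map (\<lambda>i. axis i 1) J)"

lemma coforms_frame:
  assumes "invertible E"
  shows "coforms E I (map (frame E) J) = coforms_index I J"
proof (induction I arbitrary: J)
  case (Cons i I)
  show ?case
    by (simp add: coforms_Cons coforms_index_def Cons frame[OF assms] take_map drop_map flip:
        map_append)
qed (simp add: coforms_index_def coforms_Nil)

lemma coforms_index_Nil: "coforms_index [] J = (if J = [] then 1 else 0)"
  by (simp add: coforms_index_def coforms_Nil)

lemma coforms_index_Cons: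
  "coforms_index (i # I) J =
     (\<Sum>k<length J. if J ! k = i then (- 1) ^ k * coforms_index I (take k J @ drop (Suc k) J) else
         0)"
proof -
  show ?thesis
    by (auto simp: coforms_index_def coforms_Cons axis_def take_map drop_map simp flip: map_append
        intro!: sum.cong)
qed

lemma sum_incr_3:
  fixes f :: "7 list \<Rightarrow> real"
  assumes "\<And>I. length I \<noteq> 3 \<Longrightarrow> f I = 0"
  shows "(\<Sum>I\<leftarrow>incr_indices. f I) =
    (\<Sum>I\<leftarrow>filter (\<lambda>I. length I = 3) incr_indices. f I)"
  by (rule sum_list_map_filter[symmetric]) (auto simp: assms)

lemma coframe_star_g2_model:
  assumes E: "invertible E"
  shows "coframe_star E (g2_model E) (map (frame E) I) =
    (let c = \<lambda>J. coforms_index [1, 2, 3, 4, 5, 6, 7] (J @ I) in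
     c [1, 2, 7] + c [1, 3, 5] - c [1, 4, 6] - c [2, 3, 6] - c [2, 4, 5] + c [3, 4, 7] + c [5, 6,
         7])"
proof -
  have "coframe_star E (g2_model E) (map (frame E) I) =
      (\<Sum>J\<leftarrow>incr_indices. g2_model E (map (frame E) J) * coforms_index [1, 2, 3, 4, 5, 6, 7] (J @ I))"
    by (simp add: coframe_star_def coforms_frame[OF E] flip: map_append)
  also have "\<dots> = (\<Sum>J\<leftarrow>filter (\<lambda>I. length I = 3) incr_indices.
      g2_model E (map (frame E) J) * coforms_index [1, 2, 3, 4, 5, 6, 7] (J @ I))"
    by (rule sum_incr_3) (simp add: g2_model_eq_0)
  also have "filter (\<lambda>I. length I = 3) incr_indices =
     [[1,2,3],[1,2,4],[1,2,5],[1,2,6],[1,2,7],[1,3,4],[1,3,5],[1,3,6],[1,3,7],[1,4,5],[1,4,6],[1,4,7],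
      [1,5,6],[1,5,7],[1,6,7],[2,3,4],[2,3,5],[2,3,6],[2,3,7],[2,4,5],[2,4,6],[2,4,7],[2,5,6],[2,5,7],
      [2,6,7],[3,4,5],[3,4,6],[3,4,7],[3,5,6],[3,5,7],[3,6,7],[4,5,6],[4,5,7],[4,6,7],[5,6,7]]"
    by (simp add: incr_indices_def)
  finally show ?thesis
    by (simp add: g2_model_3 frame[OF E] phi_def[symmetric] phi_simps)
qed

lemma coframe_inner_star:
  assumes E: "invertible E" and \<omega>: "\<And>vs. length vs \<noteq> 4 \<Longrightarrow> \<omega> vs = 0"
  defines "w \<equiv> \<lambda>i j k l. \<omega> [frame E i, frame E j, frame E k, frame E l]"
  shows "coframe_inner E \<omega> (coframe_star E (g2_model E)) =
     w 3 4 5 6 - w 2 4 6 7 + w 2 3 5 7 + w 1 4 5 7 + w 1 3 6 7 + w 1 2 5 6 + w 1 2 3 4"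
proof -
  have "coframe_inner E \<omega> (coframe_star E (g2_model E)) =
      (\<Sum>I\<leftarrow>incr_indices. \<omega> (map (frame E) I) * coframe_star E (g2_model E) (map (frame E) I))"
    by (simp add: coframe_inner_def)
  also have "\<dots> = (\<Sum>I\<leftarrow>filter (\<lambda>I. length I = 4) incr_indices.
      \<omega> (map (frame E) I) * coframe_star E (g2_model E) (map (frame E) I))"
    by (rule sum_list_map_filter[symmetric]) (auto simp: \<omega>)
  also have "filter (\<lambda>I. length I = 4) incr_indices =
     [[1,2,3,4],[1,2,3,5],[1,2,3,6],[1,2,3,7],[1,2,4,5],[1,2,4,6],[1,2,4,7],[1,2,5,6],[1,2,5,7],
      [1,2,6,7],[1,3,4,5],[1,3,4,6],[1,3,4,7],[1,3,5,6],[1,3,5,7],[1,3,6,7],[1,4,5,6],[1,4,5,7],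
      [1,4,6,7],[1,5,6,7],[2,3,4,5],[2,3,4,6],[2,3,4,7],[2,3,5,6],[2,3,5,7],[2,3,6,7],[2,4,5,6],
      [2,4,5,7],[2,4,6,7],[2,5,6,7],[3,4,5,6],[3,4,5,7],[3,4,6,7],[3,5,6,7],[4,5,6,7]]"
    by (simp add: incr_indices_def)
  finally show ?thesis
    by (simp add: coframe_star_g2_model[OF E] Let_def coforms_index_Cons coforms_index_Nil
        sum.lessThan_Suc w_def)
qed

section \<open>Calculus on open sets\<close>

lemma frechet_derivative_cong_open:
  assumes "open V" "x \<in> V" "\<And>y. y \<in> V \<Longrightarrow> f y = g y"
  shows "frechet_derivative f (at x) = frechet_derivative g (at x)"
    and "f differentiable (at x) \<longleftrightarrow> g differentiable (at x)"
proof -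
  have "(f has_derivative f') (at x) \<longleftrightarrow> (g has_derivative f') (at x)" for f'
    using assms has_derivative_transform_within_open[of f f' x UNIV V g]
      has_derivative_transform_within_open[of g f' x UNIV V f] by auto
  then show "frechet_derivative f (at x) = frechet_derivative g (at x)"
    and "f differentiable (at x) \<longleftrightarrow> g differentiable (at x)"
    by (simp_all add: frechet_derivative_def differentiable_def)
qed

text \<open>The mean value theorem along \<open>u\<close> reduces the second difference to an
  increment of the first derivative, and differentiability of the latter at the single point
  \<open>x\<close> gives the limit.\<close>

lemma second_difference_tendsto:
  fixes f :: "'a::real_normed_vector \<Rightarrow> real"
  assumes "open V" "x \<in> V" and f: "\<And>y. y \<in> V \<Longrightarrow> (f has_derivative f' y) (at y)"
    and L: "((\<lambda>y. f' y u) has_derivative L) (at x)"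
  shows "((\<lambda>h. (f (x + h *\<^sub>R u + h *\<^sub>R v) - f (x + h *\<^sub>R u) - f (x + h *\<^sub>R v) + f x) / h\<^sup>2) \<longlongrightarrow> L v)
    (at_right 0)"
proof (rule tendstoI)
  fix e :: real assume "e > 0"
  \<comment> \<open>The two points where the derivative is evaluated have distances from
    \<open>x\<close> adding up to at most \<open>h * (2 * norm u + norm v)\<close>; the summand 1
    keeps \<open>c\<close> positive.\<close>
  define c where "c = 2 * norm u + norm v + 1"
  have c: "c > 0"
    unfolding c_def by (smt (verit) norm_ge_zero)
  obtain r where r: "r > 0" "ball x r \<subseteq> V"
    using assms(1,2) open_contains_ball by blast
  obtain d where d: "d > 0" "\<And>y. norm (y - x) < d \<Longrightarrow>
      norm (f' y u - f' x u - L (y - x)) \<le> (e / (2 * c)) * norm (y - x)"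
  proof -
    have "e / (2 * c) > 0"
      using \<open>e > 0\<close> c by simp
    then show ?thesis
      using L[unfolded has_derivative_at_alt, THEN conjunct2, rule_format, of "e / (2 * c)"] that by
          blast
  qed
  have L_lin: "linear L"
    using L has_derivative_linear by blast
  define \<delta> where "\<delta> = min r d / c"
  have "\<delta> > 0"
    using r d c by (simp add: \<delta>_def)
  moreover have "dist ((f (x + h *\<^sub>R u + h *\<^sub>R v) - f (x + h *\<^sub>R u) - f (x + h *\<^sub>R v) + f x) / h\<^sup>2)
      (L v) < e"
    if h: "0 < h" "h < \<delta>" for h
  proof -
    have hc: "h * c < min r d"
      using h c by (simp add: \<delta>_def field_simps)
    have near: "norm (s *\<^sub>R u + k *\<^sub>R v) < min r d" if "0 \<le> s" "s \<le> h" "0 \<le> k" "k \<le> h" for s k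
    proof -
      have "norm (s *\<^sub>R u + k *\<^sub>R v) \<le> s * norm u + k * norm v"
        using that by (metis abs_of_nonneg norm_scaleR norm_triangle_ineq)
      also have "\<dots> \<le> h * norm u + h * norm v"
        using that by (intro add_mono mult_right_mono) auto
      also have "\<dots> \<le> h * c"
        using h by (simp add: c_def algebra_simps)
      finally show ?thesis
        using hc by linarith
    qed
    have inV: "x + s *\<^sub>R u + k *\<^sub>R v \<in> V" if "0 \<le> s" "s \<le> h" "0 \<le> k" "k \<le> h" for s k
    proof (rule subsetD[OF r(2)])
      have "dist (x + s *\<^sub>R u + k *\<^sub>R v) x < r"
        using near[OF that] by (simp add: dist_norm add.assoc)
      then show "x + s *\<^sub>R u + k *\<^sub>R v \<in> ball x r"
        by (simp add: dist_commute)
    qed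
    define q where "q s = f (x + s *\<^sub>R u + h *\<^sub>R v) - f (x + s *\<^sub>R u + 0 *\<^sub>R v)" for s
    have dq: "(q has_derivative (\<lambda>k. k * (f' (x + s *\<^sub>R u + h *\<^sub>R v) u - f' (x + s *\<^sub>R u + 0 *\<^sub>R v)
        u)))
        (at s within {0..h})" if s: "s \<in> {0..h}" for s
    proof -
      have 1: "((\<lambda>s. f (x + s *\<^sub>R u + k *\<^sub>R v)) has_derivative (\<lambda>m. m * f' (x + s *\<^sub>R u + k *\<^sub>R v)
          u))
          (at s within {0..h})" if "0 \<le> k" "k \<le> h" for k
      proof -
        have "((\<lambda>s. x + s *\<^sub>R u + k *\<^sub>R v) has_derivative (\<lambda>m. m *\<^sub>R u)) (at s within {0..h})"
          by (auto intro!: derivative_eq_intros)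
        then have "((\<lambda>s. f (x + s *\<^sub>R u + k *\<^sub>R v)) has_derivative (\<lambda>m. f' (x + s *\<^sub>R u + k *\<^sub>R v)
            (m *\<^sub>R u)))
          (at s within {0..h})"
          by (rule has_derivative_compose[OF _ f]) (use inV that s in auto)
        moreover have "linear (f' (x + s *\<^sub>R u + k *\<^sub>R v))"
          using f has_derivative_linear inV[of s k] that s by auto
        ultimately show ?thesis
          by (simp add: linear_cmul)
      qed
      show ?thesis
        unfolding q_def using has_derivative_diff[OF 1[of h] 1[of 0]] h by (simp add: algebra_simps)
    qed
    obtain s where s: "0 < s" "s < h" and
      q: "q h - q 0 = (h - 0) * (f' (x + s *\<^sub>R u + h *\<^sub>R v) u - f' (x + s *\<^sub>R u + 0 *\<^sub>R v) u)"
      using mvt_simple[OF h(1) dq] by auto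
    have "norm (s *\<^sub>R u + h *\<^sub>R v) < d" "norm (s *\<^sub>R u + 0 *\<^sub>R v) < d"
      using near[of s h] near[of s 0] s h by auto
    then have b: "\<bar>f' (x + s *\<^sub>R u + h *\<^sub>R v) u - f' x u - L (s *\<^sub>R u + h *\<^sub>R v)\<bar> \<le> (e / (2 * c)) *
        norm (s *\<^sub>R u + h *\<^sub>R v)"
      "\<bar>f' (x + s *\<^sub>R u + 0 *\<^sub>R v) u - f' x u - L (s *\<^sub>R u + 0 *\<^sub>R v)\<bar> \<le> (e / (2 * c)) * norm (s *\<^sub>R
          u + 0 *\<^sub>R v)"
      using d(2)[of "x + s *\<^sub>R u + h *\<^sub>R v"] d(2)[of "x + s *\<^sub>R u + 0 *\<^sub>R v"] by (simp_all add:
          add.assoc)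
    have Lv: "L (s *\<^sub>R u + h *\<^sub>R v) - L (s *\<^sub>R u + 0 *\<^sub>R v) = h * L v"
      using L_lin by (simp add: linear_add linear_cmul)
    have "norm (s *\<^sub>R u + h *\<^sub>R v) + norm (s *\<^sub>R u + 0 *\<^sub>R v) \<le> h * (2 * norm u + norm v)"
    proof -
      have "norm (s *\<^sub>R u + h *\<^sub>R v) \<le> s * norm u + h * norm v"
        using s h by (metis abs_of_pos norm_scaleR norm_triangle_ineq)
      moreover have "s * norm u \<le> h * norm u"
        using s by (intro mult_right_mono) auto
      moreover have "norm (s *\<^sub>R u + 0 *\<^sub>R v) = s * norm u"
        using s by simp
      moreover have "h * (2 * norm u + norm v) = 2 * (h * norm u) + h * norm v"
        by algebra
      ultimately show ?thesis
        by linarith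
    qed
    also have "\<dots> < h * c"
      using h by (simp add: c_def)
    finally have n: "(e / (2 * c)) * norm (s *\<^sub>R u + h *\<^sub>R v) + (e / (2 * c)) * norm (s *\<^sub>R u + 0
        *\<^sub>R v) \<le> (e / (2 * c)) * (h * c)"
      unfolding distrib_left[symmetric] using \<open>e > 0\<close> c by (intro mult_left_mono) auto
    define \<Delta> where "\<Delta> = f (x + h *\<^sub>R u + h *\<^sub>R v) - f (x + h *\<^sub>R u) - f (x + h *\<^sub>R v) + f x"
    have \<Delta>: "\<Delta> = h * (f' (x + s *\<^sub>R u + h *\<^sub>R v) u - f' (x + s *\<^sub>R u + 0 *\<^sub>R v) u)"
      using q by (simp add: q_def \<Delta>_def)
    then have "\<Delta> / h\<^sup>2 - L v = ((f' (x + s *\<^sub>R u + h *\<^sub>R v) u - f' (x + s *\<^sub>R u + 0 *\<^sub>R v) u) - h *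
        L v) / h"
    proof -
      have "h * w / h\<^sup>2 - l = (w - h * l) / h" for w l
        using h by (simp add: power2_eq_square field_simps)
      then show ?thesis
        unfolding \<Delta> .
    qed
    moreover have "\<bar>(f' (x + s *\<^sub>R u + h *\<^sub>R v) u - f' (x + s *\<^sub>R u + 0 *\<^sub>R v) u) - h * L v\<bar> \<le> (e /
        (2 * c)) * (h * c)"
      using b n Lv by linarith
    ultimately have "\<bar>\<Delta> / h\<^sup>2 - L v\<bar> \<le> (e / (2 * c)) * (h * c) / h"
      using h by (simp add: divide_right_mono)
    also have "\<dots> = e / 2"
      using h c by simp
    finally show ?thesis
      using \<open>e > 0\<close> by (simp add: dist_real_def \<Delta>_def)
  qed
  ultimately show "\<forall>\<^sub>F h in at_right 0. dist ((f (x + h *\<^sub>R u + h *\<^sub>R v) - f (x + h *\<^sub>R u) - f (x +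
      h *\<^sub>R v) + f x) / h\<^sup>2) (L v) < e"
    unfolding eventually_at_right_field by (intro exI[of _ \<delta>]) auto
qed

text \<open>The second difference is symmetric in \<open>u\<close> and \<open>v\<close>, so its two
  limits agree.\<close>

lemma frechet_derivative_commute:
  fixes f :: "'a::real_normed_vector \<Rightarrow> real"
  assumes V: "open V" "x \<in> V" and f: "\<And>y. y \<in> V \<Longrightarrow> f differentiable (at y)"
    and f': "\<And>u. (\<lambda>y. frechet_derivative f (at y) u) differentiable (at x)"
  shows "frechet_derivative (\<lambda>y. frechet_derivative f (at y) u) (at x) v =
    frechet_derivative (\<lambda>y. frechet_derivative f (at y) v) (at x) u"
proof -
  have f: "(f has_derivative frechet_derivative f (at y)) (at y)" if "y \<in> V" for y
    using f[OF that] frechet_derivative_works by blast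
  have L: "((\<lambda>y. frechet_derivative f (at y) u) has_derivative
      frechet_derivative (\<lambda>y. frechet_derivative f (at y) u) (at x)) (at x)" for u
    using f'[of u] frechet_derivative_works by blast
  have "((\<lambda>h. (f (x + h *\<^sub>R u + h *\<^sub>R v) - f (x + h *\<^sub>R u) - f (x + h *\<^sub>R v) + f x) / h\<^sup>2) \<longlongrightarrow>
      frechet_derivative (\<lambda>y. frechet_derivative f (at y) v) (at x) u) (at_right 0)"
    using second_difference_tendsto[OF V f L[of v], of u] by (simp add: algebra_simps)
  then show ?thesis
    using second_difference_tendsto[OF V f L[of u], of v] tendsto_unique trivial_limit_at_right_real
        by blast
qed

lemma linear_slot_expand:
  fixes B :: "real^7 \<Rightarrow> 'b::real_normed_vector"
  assumes "linear B"
  shows "B w = (\<Sum>k\<in>UNIV. w $ k *\<^sub>R B (axis k 1))"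
proof -
  have "w = (\<Sum>k\<in>UNIV. w $ k *\<^sub>R axis k 1)"
    by (simp add: vec_eq_iff axis_def if_distrib cong: if_cong)
  then show ?thesis
    using assms by (metis (no_types, lifting) linear_cmul linear_sum sum.cong)
qed

text \<open>Product rule for a field of linear maps of which only the values on constant arguments
  are known to be differentiable; expanding the argument in the standard basis reduces it to
  finitely many such values.\<close>

lemma has_derivative_slot:
  fixes B :: "real^7 \<Rightarrow> real^7 \<Rightarrow> 'b::real_normed_vector" and a :: "real^7 \<Rightarrow> real^7"
  assumes V: "open V" "x \<in> V" and lin: "\<And>y. y \<in> V \<Longrightarrow> linear (B y)"
    and B: "\<And>w. (\<lambda>y. B y w) differentiable (at x)" and a: "a differentiable (at x)"
  shows "((\<lambda>y. B y (a y)) has_derivative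
    (\<lambda>v. frechet_derivative (\<lambda>y. B y (a x)) (at x) v + B x (frechet_derivative a (at x) v))) (at x)"
proof -
  have B: "((\<lambda>y. B y w) has_derivative frechet_derivative (\<lambda>y. B y w) (at x)) (at x)" for w
    using B[of w] frechet_derivative_works by blast
  have a: "(a has_derivative frechet_derivative a (at x)) (at x)"
    using a frechet_derivative_works by blast
  define D where "D c v = (\<Sum>k\<in>UNIV. a x $ k *\<^sub>R frechet_derivative (\<lambda>y. B y (axis k 1)) (at x) v
      + c v $ k *\<^sub>R B x (axis k 1))" for c :: "real^7 \<Rightarrow> real^7" and v
  have main: "((\<lambda>y. B y (c y)) has_derivative D c') (at x)"
    if c: "(c has_derivative c') (at x)" "c x = a x" for c c'
  proof (rule has_derivative_transform_within_open[OF _ V(1,2)])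
    have ck: "((\<lambda>y. c y $ k) has_derivative (\<lambda>v. c' v $ k)) (at x)" for k
      using bounded_linear.has_derivative[OF bounded_linear_vec_nth c(1)] .
    show "((\<lambda>y. \<Sum>k\<in>UNIV. c y $ k *\<^sub>R B y (axis k 1)) has_derivative D c') (at x)"
      unfolding D_def c(2)[symmetric]
      by (rule has_derivative_sum) (rule has_derivative_scaleR[OF ck B])
    show "\<And>y. y \<in> V \<Longrightarrow> (\<Sum>k\<in>UNIV. c y $ k *\<^sub>R B y (axis k 1)) = B y (c y)"
      using linear_slot_expand[OF lin] by simp
  qed
  \<comment> \<open>The same formula for the constant argument \<open>a x\<close> identifies the
    first part of \<open>D\<close>.\<close>
  have "frechet_derivative (\<lambda>y. B y (a x)) (at x) = D (\<lambda>_. 0)"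
    using main[of "\<lambda>_. a x" "\<lambda>_. 0"] by (simp add: frechet_derivative_at[symmetric])
  then have "D c' v = frechet_derivative (\<lambda>y. B y (a x)) (at x) v + B x (c' v)" for c' v
    using linear_slot_expand[OF lin[OF V(2)], of "c' v"] by (simp add: D_def sum.distrib)
  then show ?thesis
    using main[OF a refl] by presburger
qed

section \<open>Connections with skew torsion preserving the form\<close>

abbreviation dd :: "('a::real_normed_vector \<Rightarrow> 'b::real_normed_vector) \<Rightarrow> 'a \<Rightarrow> 'a \<Rightarrow> 'b" where
  "dd f x v \<equiv> frechet_derivative f (at x) v"

lemma has_derivative_slot3:
  fixes B :: "real^7 \<Rightarrow> real^7 \<Rightarrow> real^7 \<Rightarrow> real^7 \<Rightarrow> real"
  assumes V: "open V" "x \<in> V"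
    and lin: "\<And>y v w. y \<in> V \<Longrightarrow> linear (\<lambda>u. B y u v w)" "\<And>y u w. y \<in> V \<Longrightarrow> linear (\<lambda>v. B y u v w)"
      "\<And>y u v. y \<in> V \<Longrightarrow> linear (\<lambda>w. B y u v w)"
    and B: "\<And>u v w. (\<lambda>y. B y u v w) differentiable (at x)"
    and abc: "a differentiable (at x)" "b differentiable (at x)" "c differentiable (at x)"
  shows "((\<lambda>y. B y (a y) (b y) (c y)) has_derivative (\<lambda>u. dd (\<lambda>y. B y (a x) (b x) (c x)) x u
      + B x (dd a x u) (b x) (c x) + B x (a x) (dd b x u) (c x) + B x (a x) (b x) (dd c x u))) (at
          x)"
proof -
  have 1: "((\<lambda>y. B y (a y) v w) has_derivative
      (\<lambda>u. dd (\<lambda>y. B y (a x) v w) x u + B x (dd a x u) v w)) (at x)" for v w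
    using has_derivative_slot[OF V, of "\<lambda>y u. B y u v w" a] lin(1) B abc(1) by simp
  then have d1: "(\<lambda>y. B y (a y) v w) differentiable (at x)" for v w
    unfolding differentiable_def by blast
  have e1: "dd (\<lambda>y. B y (a y) v w) x u = dd (\<lambda>y. B y (a x) v w) x u + B x (dd a x u) v w" for v w u
    by (rule fun_cong[OF frechet_derivative_at[OF 1, symmetric]])
  have 2: "((\<lambda>y. B y (a y) (b y) w) has_derivative
      (\<lambda>u. dd (\<lambda>y. B y (a x) (b x) w) x u + B x (dd a x u) (b x) w + B x (a x) (dd b x u) w)) (at
          x)" for w
    using has_derivative_slot[OF V, of "\<lambda>y v. B y (a y) v w" b] lin(2) d1 abc(2) by (simp add: e1)
  then have d2: "(\<lambda>y. B y (a y) (b y) w) differentiable (at x)" for w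
    unfolding differentiable_def by blast
  have e2: "dd (\<lambda>y. B y (a y) (b y) w) x u =
      dd (\<lambda>y. B y (a x) (b x) w) x u + B x (dd a x u) (b x) w + B x (a x) (dd b x u) w" for w u
    by (rule fun_cong[OF frechet_derivative_at[OF 2, symmetric]])
  show ?thesis
    using has_derivative_slot[OF V, of "\<lambda>y w. B y (a y) (b y) w" c] lin(3) d2 abc(3) by (simp add:
        e2)
qed

lemma has_derivative_slot2:
  fixes B :: "real^7 \<Rightarrow> real^7 \<Rightarrow> real^7 \<Rightarrow> real"
  assumes V: "open V" "x \<in> V"
    and lin: "\<And>y v. y \<in> V \<Longrightarrow> linear (\<lambda>u. B y u v)" "\<And>y u. y \<in> V \<Longrightarrow> linear (\<lambda>v. B y u v)"
    and B: "\<And>u v. (\<lambda>y. B y u v) differentiable (at x)"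
    and abc: "a differentiable (at x)" "b differentiable (at x)"
  shows "((\<lambda>y. B y (a y) (b y)) has_derivative (\<lambda>u. dd (\<lambda>y. B y (a x) (b x)) x u
      + B x (dd a x u) (b x) + B x (a x) (dd b x u))) (at x)"
proof -
  have 1: "((\<lambda>y. B y (a y) v) has_derivative
      (\<lambda>u. dd (\<lambda>y. B y (a x) v) x u + B x (dd a x u) v)) (at x)" for v
    using has_derivative_slot[OF V, of "\<lambda>y u. B y u v" a] lin(1) B abc(1) by simp
  then have d1: "(\<lambda>y. B y (a y) v) differentiable (at x)" for v
    unfolding differentiable_def by blast
  have e1: "dd (\<lambda>y. B y (a y) v) x u = dd (\<lambda>y. B y (a x) v) x u + B x (dd a x u) v" for v u
    by (rule fun_cong[OF frechet_derivative_at[OF 1, symmetric]])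
  show ?thesis
    using has_derivative_slot[OF V, of "\<lambda>y v. B y (a y) v" b] lin(2) d1 abc(2) by (simp add: e1)
qed

lemma linear_matrix_vector_mult_left: "linear (\<lambda>A :: real^7^7. A *v v)"
  by (rule linearI) (simp_all add: matrix_vector_mult_add_rdistrib scaleR_matrix_vector_assoc)

lemma bounded_linear_differentiable:
  assumes "bounded_linear f" "g differentiable (at x)"
  shows "(\<lambda>y. f (g y)) differentiable (at x)"
  using bounded_linear.has_derivative[OF assms(1)] assms(2) unfolding differentiable_def by blast

lemma differentiable_matrix_vector_mult:
  fixes E :: "real^7 \<Rightarrow> real^7^7"
  assumes "E differentiable (at x)"
  shows "(\<lambda>y. E y *v v) differentiable (at x)"
  by (rule bounded_linear_differentiable[OF linear_matrix_vector_mult_left[of v, unfolded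
      linear_conv_bounded_linear] assms])

lemma differentiable_vec_nth:
  fixes f :: "real^7 \<Rightarrow> real^7"
  assumes "f differentiable (at x)"
  shows "(\<lambda>y. f y $ i) differentiable (at x)"
  by (rule bounded_linear_differentiable[OF bounded_linear_vec_nth assms])

lemma differentiable_phi0:
  fixes a b c :: "real^7 \<Rightarrow> real^7"
  assumes "a differentiable (at x)" "b differentiable (at x)" "c differentiable (at x)"
  shows "(\<lambda>y. phi0 (a y) (b y) (c y)) differentiable (at x)"
  unfolding phi0_def det3_def using assms[THEN differentiable_vec_nth]
  by (intro differentiable_add differentiable_diff differentiable_mult)

lemma linear_phi0: "linear (\<lambda>u. phi0 u v w)" "linear (\<lambda>v. phi0 u v w)" "linear (\<lambda>w. phi0 u v w)"
  by (rule linearI; simp add: phi0_def det3_def algebra_simps)+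

lemma phi0_skew: "phi0 u v w = - phi0 v u w" "phi0 u v w = - phi0 u w v"
  by (simp_all add: phi0_def det3_def algebra_simps)

lemma differentiable_prod:
  fixes f :: "'i \<Rightarrow> 'a::real_normed_vector \<Rightarrow> real"
  assumes "finite I" "\<And>i. i \<in> I \<Longrightarrow> f i differentiable (at x)"
  shows "(\<lambda>y. \<Prod>i\<in>I. f i y) differentiable (at x)"
  using assms by (induction I rule: finite_induct) (simp_all add: differentiable_mult)

lemma differentiable_det:
  fixes A :: "'a::real_normed_vector \<Rightarrow> real^7^7"
  assumes "\<And>i j. (\<lambda>y. A y $ i $ j) differentiable (at x)"
  shows "(\<lambda>y. det (A y)) differentiable (at x)"
  unfolding det_def
  by (intro differentiable_sum differentiable_mult differentiable_const differentiable_prod ballI)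
    (auto simp: assms)

text \<open>By Cramer's rule the dual frame is a quotient of determinants in the entries of the
  coframe.\<close>

lemma differentiable_frame:
  assumes V: "open V" "x \<in> V" and E: "E differentiable (at x)" "\<And>y. y \<in> V \<Longrightarrow> invertible (E y)"
  shows "(\<lambda>y. frame (E y) i) differentiable (at x)"
proof -
  define h where "h y = (\<chi> k. det (\<chi> a b. if b = k then axis i 1 $ a else E y $ a $ b) / det (E y))"
      for y
  have "(\<lambda>y. E y $ a $ b) differentiable (at x)" for a b
    by (intro bounded_linear_differentiable[OF bounded_linear_vec_nth]) (rule E(1))
  note d = this
  then have "(\<lambda>y. if b = k then axis i 1 $ a else E y $ a $ b) differentiable (at x)" for a b k
    by (cases "b = k") simp_all
  then have "(\<lambda>y. det (\<chi> a b. if b = k then axis i 1 $ a else E y $ a $ b) / det (E y))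
      differentiable (at x)" for k
    using d E(2)[OF V(2), unfolded invertible_det_nz]
    by (intro differentiable_divide differentiable_det) auto
  then have "(\<lambda>y. \<Sum>k\<in>UNIV. (det (\<chi> a b. if b = k then axis i 1 $ a else E y $ a $ b) / det (E y))
      *\<^sub>R
      (axis k 1 :: real^7)) differentiable (at x)"
    by (intro differentiable_sum ballI differentiable_scaleR) simp_all
  also have "(\<lambda>y. \<Sum>k\<in>UNIV. (det (\<chi> a b. if b = k then axis i 1 $ a else E y $ a $ b) / det (E y))
      *\<^sub>R
      (axis k 1 :: real^7)) = h"
    by (simp add: h_def fun_eq_iff vec_eq_iff axis_def if_distrib cong: if_cong)
  finally have "h differentiable (at x)" .
  moreover have "frame (E y) i = h y" if "y \<in> V" for y
    using cramer[of "E y" "frame (E y) i" "axis i 1"] frame[of "E y" i] E(2)[OF that]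
    by (simp add: h_def invertible_det_nz)
  ultimately show ?thesis
    using frechet_derivative_cong_open(2)[OF V, of "\<lambda>y. frame (E y) i" h] by simp
qed


definition met :: "(real^7 \<Rightarrow> real^7^7) \<Rightarrow> real^7 \<Rightarrow> real^7 \<Rightarrow> real^7 \<Rightarrow> real" where
  "met E y u v = (E y *v u) \<bullet> (E y *v v)"

definition phi_at :: "(real^7 \<Rightarrow> real^7^7) \<Rightarrow> real^7 \<Rightarrow> real^7 \<Rightarrow> real^7 \<Rightarrow> real^7 \<Rightarrow> real" where
  "phi_at E y u v w = phi0 (E y *v u) (E y *v v) (E y *v w)"

definition tau :: "christoffel \<Rightarrow> christoffel" where
  "tau \<Gamma> y u v = \<Gamma> y u v - \<Gamma> y v u"

definition curv :: "christoffel \<Rightarrow> real^7 \<Rightarrow> real^7 \<Rightarrow> real^7 \<Rightarrow> real^7 \<Rightarrow> real^7" where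
  "curv \<Gamma> y u v w = dd (\<lambda>y. \<Gamma> y v w) y u - dd (\<lambda>y. \<Gamma> y u w) y v
     + \<Gamma> y u (\<Gamma> y v w) - \<Gamma> y v (\<Gamma> y u w)"

text \<open>The characteristic connection over an open set with a differentiable adapted coframe, in
  terms of constant vectors. As \<open>tau\<close> is skew by definition,
  \<open>torsion_skew\<close> makes the torsion a 3-form.\<close>

locale g2_local =
  fixes V :: "(real^7) set" and E :: "real^7 \<Rightarrow> real^7^7" and \<Gamma> :: christoffel
  assumes open_V: "open V"
    and E_diff: "y \<in> V \<Longrightarrow> E differentiable (at y)"
    and E_inv: "y \<in> V \<Longrightarrow> invertible (E y)"
    and bilinear_\<Gamma>: "y \<in> V \<Longrightarrow> bilinear (\<Gamma> y)"
    and \<Gamma>_diff: "y \<in> V \<Longrightarrow> (\<lambda>y. \<Gamma> y u v) differentiable (at y)"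
    and met_parallel: "y \<in> V \<Longrightarrow>
      dd (\<lambda>y. met E y v w) y u = met E y (\<Gamma> y u v) w + met E y v (\<Gamma> y u w)"
    and phi_parallel: "y \<in> V \<Longrightarrow>
      dd (\<lambda>y. phi_at E y v w z) y u =
        phi_at E y (\<Gamma> y u v) w z + phi_at E y v (\<Gamma> y u w) z + phi_at E y v w (\<Gamma> y u z)"
    and torsion_skew: "y \<in> V \<Longrightarrow> met E y (tau \<Gamma> y u v) w = - met E y (tau \<Gamma> y u w) v"
begin

abbreviation "g \<equiv> met E"
abbreviation "F \<equiv> phi_at E"
abbreviation "\<tau> \<equiv> tau \<Gamma>"
abbreviation "R \<equiv> curv \<Gamma>"

definition T :: "real^7 \<Rightarrow> real^7 \<Rightarrow> real^7 \<Rightarrow> real^7 \<Rightarrow> real" where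
  "T y u v w = g y (\<tau> y u v) w"

definition P :: "real^7 \<Rightarrow> real^7 \<Rightarrow> real^7 \<Rightarrow> real^7 \<Rightarrow> real^7 \<Rightarrow> real" where
  "P y u v w z = dd (\<lambda>y. T y v w z) y u - T y (\<Gamma> y u v) w z - T y v (\<Gamma> y u w) z - T y v w (\<Gamma> y u z)"

lemma linear_\<Gamma>: "y \<in> V \<Longrightarrow> linear (\<lambda>u. \<Gamma> y u v)" "y \<in> V \<Longrightarrow> linear (\<lambda>v. \<Gamma> y u v)"
  using bilinear_\<Gamma> by (auto simp: bilinear_def)

lemmas \<Gamma>_simps = linear_\<Gamma>[THEN linear_add] linear_\<Gamma>[THEN linear_diff] linear_\<Gamma>[THEN linear_neg]
  linear_\<Gamma>[THEN linear_cmul]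

lemma g_commute: "g y u v = g y v u"
  by (simp add: met_def inner_commute)

lemma linear_g: "linear (\<lambda>u. g y u v)" "linear (\<lambda>v. g y u v)"
  by (rule linearI; simp add: met_def matrix_vector_right_distrib matrix_vector_mult_scaleR
      inner_add_left inner_add_right)+

lemmas g_simps = linear_g[THEN linear_add] linear_g[THEN linear_diff] linear_g[THEN linear_neg]
  linear_g[THEN linear_cmul]

lemma linear_F: "linear (\<lambda>u. F y u v w)" "linear (\<lambda>v. F y u v w)" "linear (\<lambda>w. F y u v w)"
  by (rule linearI; simp add: phi_at_def matrix_vector_right_distrib matrix_vector_mult_scaleR
      linear_phi0[THEN linear_add] linear_phi0[THEN linear_cmul])+

lemmas F_simps = linear_F[THEN linear_add] linear_F[THEN linear_diff] linear_F[THEN linear_neg]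
  linear_F[THEN linear_cmul]

lemma F_skew: "F y u v w = - F y v u w" "F y u v w = - F y u w v"
  unfolding phi_at_def by (rule phi0_skew)+

lemma g_diff: "y \<in> V \<Longrightarrow> (\<lambda>y. g y u v) differentiable (at y)"
proof -
  assume "y \<in> V"
  then have E: "(\<lambda>y. (E y *v u) $ i * (E y *v v) $ i) differentiable (at y)" for i
    by (intro differentiable_mult differentiable_vec_nth differentiable_matrix_vector_mult E_diff)
  then show ?thesis
    unfolding met_def inner_vec_def inner_real_def by (intro differentiable_sum) auto
qed

lemma F_diff: "y \<in> V \<Longrightarrow> (\<lambda>y. F y u v w) differentiable (at y)"
  unfolding phi_at_def
  by (intro differentiable_phi0 differentiable_matrix_vector_mult E_diff)

lemma \<tau>_diff: "y \<in> V \<Longrightarrow> (\<lambda>y. \<tau> y u v) differentiable (at y)"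
  unfolding tau_def by (intro differentiable_diff \<Gamma>_diff)

lemma linear_\<tau>: "y \<in> V \<Longrightarrow> linear (\<lambda>u. \<tau> y u v)" "y \<in> V \<Longrightarrow> linear (\<lambda>v. \<tau> y u v)"
  by (rule linearI; simp add: tau_def \<Gamma>_simps algebra_simps)+

lemma linear_T:
  "y \<in> V \<Longrightarrow> linear (\<lambda>u. T y u v w)" "y \<in> V \<Longrightarrow> linear (\<lambda>v. T y u v w)"
  "y \<in> V \<Longrightarrow> linear (\<lambda>w. T y u v w)"
  unfolding T_def using linear_compose[OF linear_\<tau>(1) linear_g(1), unfolded o_def]
    linear_compose[OF linear_\<tau>(2) linear_g(1), unfolded o_def] linear_g(2) by auto

lemma T_skew:
  "T y u v w = - T y v u w" "y \<in> V \<Longrightarrow> T y u v w = - T y u w v"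
  using torsion_skew by (simp_all add: T_def tau_def g_simps)

text \<open>Leibniz rule in which \<open>dd a y u + \<Gamma> y u (a y)\<close> is the covariant
  derivative of the field \<open>a\<close>; there is no further term because \<open>g\<close> is
  parallel. For \<open>F\<close> it is the same, while for \<open>T\<close> the extra term is
  \<open>P\<close>.\<close>

lemma has_derivative_g:
  assumes "y \<in> V" "a differentiable (at y)" "b differentiable (at y)"
  shows "((\<lambda>y. g y (a y) (b y)) has_derivative
    (\<lambda>u. g y (dd a y u + \<Gamma> y u (a y)) (b y) + g y (a y) (dd b y u + \<Gamma> y u (b y)))) (at y)"
  using has_derivative_slot2[OF open_V assms(1) linear_g g_diff[OF assms(1)] assms(2,3)]
  by (simp add: met_parallel[OF assms(1)] g_simps algebra_simps)

lemma has_derivative_F: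
  assumes "y \<in> V" "a differentiable (at y)" "b differentiable (at y)" "c differentiable (at y)"
  shows "((\<lambda>y. F y (a y) (b y) (c y)) has_derivative
    (\<lambda>u. F y (dd a y u + \<Gamma> y u (a y)) (b y) (c y) + F y (a y) (dd b y u + \<Gamma> y u (b y)) (c y)
       + F y (a y) (b y) (dd c y u + \<Gamma> y u (c y)))) (at y)"
  using has_derivative_slot3[OF open_V assms(1) linear_F F_diff[OF assms(1)] assms(2-4)]
  by (simp add: phi_parallel[OF assms(1)] F_simps algebra_simps)

lemma T_diff: "y \<in> V \<Longrightarrow> (\<lambda>y. T y u v w) differentiable (at y)"
  unfolding T_def by (rule differentiableI[OF has_derivative_g[OF _ \<tau>_diff differentiable_const]])

lemma has_derivative_T:
  assumes "y \<in> V" "a differentiable (at y)" "b differentiable (at y)" "c differentiable (at y)"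
  shows "((\<lambda>y. T y (a y) (b y) (c y)) has_derivative
    (\<lambda>u. P y u (a y) (b y) (c y) + T y (dd a y u + \<Gamma> y u (a y)) (b y) (c y)
       + T y (a y) (dd b y u + \<Gamma> y u (b y)) (c y)
       + T y (a y) (b y) (dd c y u + \<Gamma> y u (c y)))) (at y)"
  using has_derivative_slot3[OF open_V assms(1) linear_T T_diff[OF assms(1)] assms(2-4)]
  by (simp add: P_def linear_T[THEN linear_add] assms(1) algebra_simps)

lemma P_eq:
  assumes "y \<in> V"
  shows "P y u v w z =
    g y (dd (\<lambda>y. \<tau> y v w) y u + \<Gamma> y u (\<tau> y v w) - \<tau> y (\<Gamma> y u v) w - \<tau> y v (\<Gamma> y u w)) z"
proof -
  have "dd (\<lambda>y. T y v w z) y u =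
      g y (dd (\<lambda>y. \<tau> y v w) y u + \<Gamma> y u (\<tau> y v w)) z + g y (\<tau> y v w) (\<Gamma> y u z)"
    unfolding T_def
    using fun_cong[OF frechet_derivative_at[OF has_derivative_g[OF assms \<tau>_diff[OF assms], of "\<lambda>_.
        z"], symmetric]]
    by (simp add: g_simps)
  then show ?thesis
    by (simp add: P_def T_def g_simps)
qed

text \<open>First Bianchi identity for a connection with torsion. Since \<open>P_eq\<close> pulls
  the derivative inside \<open>g\<close>, it becomes an identity of vectors in \<Gamma> and its
  first derivatives.\<close>

lemma bianchi_torsion:
  assumes "y \<in> V"
  shows "g y (R y u v w) z + g y (R y v w u) z + g y (R y w u v) z =
    P y u v w z + P y v w u z + P y w u v z
      + T y (\<tau> y u v) w z + T y (\<tau> y v w) u z + T y (\<tau> y w u) v z"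
proof -
  have d: "dd (\<lambda>y. \<tau> y v w) y u = dd (\<lambda>y. \<Gamma> y v w) y u - dd (\<lambda>y. \<Gamma> y w v) y u" for u v w
    using has_derivative_diff[OF \<Gamma>_diff[OF assms, of v w, THEN frechet_derivative_works[THEN iffD1]]
      \<Gamma>_diff[OF assms, of w v, THEN frechet_derivative_works[THEN iffD1]]]
    unfolding tau_def by (rule fun_cong[OF frechet_derivative_at[symmetric]])
  show ?thesis
    unfolding P_eq[OF assms] d T_def g_simps(1,2)[symmetric] linear_add[OF linear_g(1), symmetric]
    by (rule arg_cong[where f = "\<lambda>a. g y a z"])
      (simp add: curv_def tau_def \<Gamma>_simps assms algebra_simps)
qed

lemma R_skew: "R y u v w = - R y v u w"
  by (simp add: curv_def)

text \<open>Second derivatives of the function \<open>g y w z\<close> commute; computed twice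
  through \<open>\<nabla>g = 0\<close>, their difference is the action of curvature on
  \<open>g\<close>. \<open>F_R\<close> is the same argument for \<phi>.\<close>

lemma g_R_skew:
  assumes "x \<in> V"
  shows "g x (R x u v w) z = - g x (R x u v z) w"
proof -
  define q where "q u y = g y (\<Gamma> y u w) z + g y w (\<Gamma> y u z)" for u y
  have q: "dd (\<lambda>y. g y w z) y u = q u y" if "y \<in> V" for y u
    using met_parallel[OF that] by (simp add: q_def)
  have dq: "(q u has_derivative (\<lambda>v. g x (dd (\<lambda>y. \<Gamma> y u w) x v + \<Gamma> x v (\<Gamma> x u w)) z + g x (\<Gamma> x u w)
      (\<Gamma> x v z)
      + (g x (\<Gamma> x v w) (\<Gamma> x u z) + g x w (dd (\<lambda>y. \<Gamma> y u z) x v + \<Gamma> x v (\<Gamma> x u z))))) (at x)" for u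
    unfolding q_def
    using has_derivative_add[OF has_derivative_g[OF assms \<Gamma>_diff[OF assms], of "\<lambda>_. z" u w]
      has_derivative_g[OF assms _ \<Gamma>_diff[OF assms], of "\<lambda>_. w" u z]]
    by simp
  have dd: "dd (\<lambda>y. dd (\<lambda>y. g y w z) y u) x = dd (q u) x" for u
    by (rule frechet_derivative_cong_open(1)[OF open_V assms]) (rule q)
  have "dd (q u) x v = dd (q v) x u"
    unfolding dd[symmetric]
  proof (rule frechet_derivative_commute[OF open_V assms])
    show "(\<lambda>y. dd (\<lambda>y. g y w z) y u) differentiable at x" for u
      using dq[of u] by (subst frechet_derivative_cong_open(2)[OF open_V assms q]) (auto intro:
          differentiableI)
  qed (rule g_diff)
  then show ?thesis
    unfolding frechet_derivative_at[OF dq, symmetric]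
    by (simp add: curv_def g_simps algebra_simps g_commute)
qed

lemma F_R:
  assumes "x \<in> V"
  shows "F x (R x u v a) b c + F x a (R x u v b) c + F x a b (R x u v c) = 0"
proof -
  define q where "q u y = F y (\<Gamma> y u a) b c + F y a (\<Gamma> y u b) c + F y a b (\<Gamma> y u c)" for u y
  have q: "dd (\<lambda>y. F y a b c) y u = q u y" if "y \<in> V" for y u
    using phi_parallel[OF that] by (simp add: q_def)
  have dq: "(q u has_derivative (\<lambda>v.
      (F x (dd (\<lambda>y. \<Gamma> y u a) x v + \<Gamma> x v (\<Gamma> x u a)) b c + F x (\<Gamma> x u a) (\<Gamma> x v b) c + F x (\<Gamma> x u a)
          b (\<Gamma> x v c))
      + (F x (\<Gamma> x v a) (\<Gamma> x u b) c + F x a (dd (\<lambda>y. \<Gamma> y u b) x v + \<Gamma> x v (\<Gamma> x u b)) c + F x a (\<Gamma> x u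
          b) (\<Gamma> x v c))
      + (F x (\<Gamma> x v a) b (\<Gamma> x u c) + F x a (\<Gamma> x v b) (\<Gamma> x u c) + F x a b (dd (\<lambda>y. \<Gamma> y u c) x v + \<Gamma> x
          v (\<Gamma> x u c))))) (at x)" for u
    unfolding q_def
    using has_derivative_add[OF has_derivative_add[OF
      has_derivative_F[OF assms \<Gamma>_diff[OF assms], of "\<lambda>_. b" "\<lambda>_. c" u a]
      has_derivative_F[OF assms _ \<Gamma>_diff[OF assms], of "\<lambda>_. a" "\<lambda>_. c" u b]]
      has_derivative_F[OF assms _ _ \<Gamma>_diff[OF assms], of "\<lambda>_. a" "\<lambda>_. b" u c]]
    by simp
  have dd: "dd (\<lambda>y. dd (\<lambda>y. F y a b c) y u) x = dd (q u) x" for u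
    by (rule frechet_derivative_cong_open(1)[OF open_V assms]) (rule q)
  have "dd (q u) x v = dd (q v) x u"
    unfolding dd[symmetric]
  proof (rule frechet_derivative_commute[OF open_V assms])
    show "(\<lambda>y. dd (\<lambda>y. F y a b c) y u) differentiable at x" for u
      using dq[of u] by (subst frechet_derivative_cong_open(2)[OF open_V assms q]) (auto intro:
          differentiableI)
  qed (rule F_diff)
  then show ?thesis
    unfolding frechet_derivative_at[OF dq, symmetric]
    by (simp add: curv_def F_simps algebra_simps)
qed

end

section \<open>Adapted frames and the Bianchi identity\<close>

lemma linear_dd:
  fixes B :: "real^7 \<Rightarrow> real^7 \<Rightarrow> 'b::real_normed_vector"
  assumes V: "open V" "y \<in> V" and lin: "\<And>z. z \<in> V \<Longrightarrow> linear (B z)"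
    and B: "\<And>v. (\<lambda>z. B z v) differentiable (at y)"
  shows "linear (\<lambda>v. dd (\<lambda>z. B z v) y u)"
proof (rule linearI)
  have B: "((\<lambda>z. B z v) has_derivative frechet_derivative (\<lambda>z. B z v) (at y)) (at y)" for v
    using B frechet_derivative_works by blast
  have "dd (\<lambda>z. B z (v + w)) y = dd (\<lambda>z. B z v + B z w) y" for v w
    by (rule frechet_derivative_cong_open(1)[OF V]) (rule linear_add[OF lin])
  then show "dd (\<lambda>z. B z (v + w)) y u = dd (\<lambda>z. B z v) y u + dd (\<lambda>z. B z w) y u" for v w
    using fun_cong[OF frechet_derivative_at[OF has_derivative_add[OF B B], symmetric]] by simp
  have "dd (\<lambda>z. B z (c *\<^sub>R v)) y = dd (\<lambda>z. c *\<^sub>R B z v) y" for c v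
    by (rule frechet_derivative_cong_open(1)[OF V]) (rule linear_cmul[OF lin])
  then show "dd (\<lambda>z. B z (c *\<^sub>R v)) y u = c *\<^sub>R dd (\<lambda>z. B z v) y u" for c v
    using fun_cong[OF frechet_derivative_at[OF has_derivative_scaleR_right[OF B], symmetric]] by
        simp
qed

lemma has_derivative_phic:
  assumes "\<And>a b. ((\<lambda>y. X y a b) has_derivative (\<lambda>u. X' u a b)) (at x)"
  shows "((\<lambda>y. phic (X y) j) has_derivative (\<lambda>u. phic (X' u) j)) (at x)"
  unfolding phic_def by (intro has_derivative_sum has_derivative_mult_right assms)

lemma has_derivative_cmat:
  assumes "\<And>i a b. ((\<lambda>y. X y i a b) has_derivative (\<lambda>u. X' u i a b)) (at x)"
  shows "((\<lambda>y. cmat (X y) i j) has_derivative (\<lambda>u. cmat (X' u) i j)) (at x)"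
  unfolding cmat_def by (rule has_derivative_phic) (rule assms)

lemma has_derivative_cvec:
  assumes "\<And>i a b. ((\<lambda>y. X y i a b) has_derivative (\<lambda>u. X' u i a b)) (at x)"
  shows "((\<lambda>y. cvec (X y) j) has_derivative (\<lambda>u. cvec (X' u) j)) (at x)"
  unfolding cvec_def by (rule has_derivative_phic) (rule has_derivative_cmat[OF assms])

lemma cmat_add: "cmat (\<lambda>i j k. s i j k + t i j k) i j = cmat s i j + cmat t i j"
  unfolding cmat_def by (rule phic_add)

lemma cvec_add: "cvec (\<lambda>i j k. s i j k + t i j k) j = cvec s j + cvec t j"
  unfolding cvec_def cmat_add by (rule phic_add)

lemma cvec_cmult: "cvec (\<lambda>i j k. c * t i j k) j = c * cvec t j"
  by (simp add: cvec_def cmat_def phic_def sum_distrib_left mult.left_commute)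

lemma cmat_cmult: "cmat (\<lambda>i j k. c * t i j k) i j = c * cmat t i j"
  by (simp add: cmat_def phic_def sum_distrib_left mult.left_commute)

lemma has_derivative_eq_0_on_open:
  assumes "open V" "x \<in> V" "\<And>y. y \<in> V \<Longrightarrow> f y = c" "(f has_derivative f') (at x)"
  shows "f' u = 0"
proof -
  have "((\<lambda>_. c) has_derivative f') (at x)"
    using has_derivative_transform_within_open[OF assms(4,1,2)] assms(3) by simp
  then have "f' = (\<lambda>_. 0)"
    using has_derivative_unique has_derivative_const by blast
  then show ?thesis
    by simp
qed

text \<open>The classical octahedron argument: four cyclic identities, combined by the two skew
  symmetries, leave twice the difference of the two sides.\<close>

lemma pair_symmetric:
  fixes r :: "'a \<Rightarrow> 'a \<Rightarrow> 'a \<Rightarrow> 'a \<Rightarrow> real"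
  assumes s1: "\<And>a b c d. r a b c d = - r b a c d" and s2: "\<And>a b c d. r a b c d = - r a b d c"
    and b: "\<And>a b c d. r a b c d + r b c a d + r c a b d = 0"
  shows "r u v w z = r w z u v"
  using b[of u v w z] b[of v w z u] b[of w z u v] b[of z u v w]
    s1[of v u w z] s1[of v u z w] s1[of w u v z] s1[of w u z v] s1[of w v u z] s1[of w v z u]
      s1[of z u v w] s1[of z u w v] s1[of z v u w] s1[of z v w u] s1[of z w u v] s1[of z w v u]
      s2[of u v z w] s2[of u w z v] s2[of u z w v] s2[of v w z u] s2[of v z w u] s2[of w z v u]
  by linarith

context g2_local
begin

section \<open>Moving adapted frames\<close>

definition e :: "real^7 \<Rightarrow> 7 \<Rightarrow> real^7" where
  "e y i = frame (E y) i"

definition t :: "real^7 \<Rightarrow> 7 \<Rightarrow> 7 \<Rightarrow> 7 \<Rightarrow> real" where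
  "t y i j k = T y (e y i) (e y j) (e y k)"

definition p :: "real^7 \<Rightarrow> 7 \<Rightarrow> 7 \<Rightarrow> 7 \<Rightarrow> 7 \<Rightarrow> real" where
  "p y l i j k = P y (e y l) (e y i) (e y j) (e y k)"

text \<open>Connection form of the adapted frame: \<open>\<nabla>\<^sub>u e\<^sub>i = \<Sum>\<^sub>l conn y u i l e\<^sub>l\<close>.\<close>

definition conn :: "real^7 \<Rightarrow> real^7 \<Rightarrow> 7 \<Rightarrow> 7 \<Rightarrow> real" where
  "conn y u i l = (E y *v (dd (\<lambda>y. e y i) y u + \<Gamma> y u (e y i))) $ l"

lemma E_e: "y \<in> V \<Longrightarrow> E y *v e y i = axis i 1"
  unfolding e_def by (rule frame[OF E_inv])

lemma e_diff: "y \<in> V \<Longrightarrow> (\<lambda>y. e y i) differentiable (at y)"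
  unfolding e_def by (rule differentiable_frame[OF open_V _ E_diff E_inv])

lemma expand: "y \<in> V \<Longrightarrow> v = (\<Sum>l\<in>UNIV. (E y *v v) $ l *\<^sub>R e y l)"
  unfolding e_def by (rule frame_expand[OF E_inv])

lemma linear_expand:
  fixes f :: "real^7 \<Rightarrow> real"
  assumes "y \<in> V" "linear f"
  shows "f v = (\<Sum>l\<in>UNIV. (E y *v v) $ l * f (e y l))"
  unfolding e_def by (rule linear_frame_expand[OF E_inv[OF assms(1)] assms(2)])

lemma linear_eq_0:
  fixes f :: "real^7 \<Rightarrow> real"
  assumes "y \<in> V" "linear f" "\<And>l. f (e y l) = 0"
  shows "f v = 0"
  using linear_expand[OF assms(1,2), of v] assms(3) by simp

lemma E_component: "y \<in> V \<Longrightarrow> (E y *v v) $ l = g y v (e y l)"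
  by (simp add: met_def E_e inner_axis)

lemma g_frame: "y \<in> V \<Longrightarrow> g y (e y i) (e y j) = delta i j"
  by (simp add: met_def E_e inner_axis_axis delta_def)

lemma F_frame: "y \<in> V \<Longrightarrow> F y (e y i) (e y j) (e y k) = phi i j k"
  by (simp add: phi_at_def E_e phi_def)

lemma g_nondegenerate:
  assumes "y \<in> V" "\<And>w. g y v w = 0"
  shows "v = 0"
  using expand[OF assms(1), of v] assms(2) by (simp add: E_component[OF assms(1)])

text \<open>An endomorphism annihilating \<open>g\<close> and \<phi> as a derivation has its frame
  matrix in \<open>g\<^sub>2\<close>; this serves both the connection form and the
  curvature.\<close>

lemma g2_algebraI:
  assumes "y \<in> V" and K: "\<And>i l. K i l = g y (A i) (e y l)"
    and "\<And>i j. g y (A i) (e y j) + g y (e y i) (A j) = 0"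
    and F: "\<And>i j k. F y (A i) (e y j) (e y k) + F y (e y i) (A j) (e y k) + F y (e y i) (e y j) (A
        k) = 0"
  shows "g2_algebra K"
proof unfold_locales
  show "K i j = - K j i" for i j
    using assms(3)[of i j] by (simp add: K g_commute)
  have "(E y *v A i) $ l = K i l" for i l
    by (simp add: K E_component[OF assms(1)])
  then have "F y (A i) v w = (\<Sum>l\<in>UNIV. K i l * F y (e y l) v w)"
    "F y v (A i) w = (\<Sum>l\<in>UNIV. K i l * F y v (e y l) w)"
    "F y v w (A i) = (\<Sum>l\<in>UNIV. K i l * F y v w (e y l))" for i v w
    using linear_expand[OF assms(1) linear_F(1), of y "A i" v w]
      linear_expand[OF assms(1) linear_F(2), of y v "A i" w]
      linear_expand[OF assms(1) linear_F(3), of y v w "A i"] by simp_all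
  then show "act3 K phi i j k = 0" for i j k
    using F[of i j k] by (simp add: act3_def F_frame[OF assms(1)] sum.distrib)
qed

text \<open>In an adapted frame the components of \<open>g\<close> and \<phi> are constant, so the
  Leibniz rules for these parallel tensors say that the connection form annihilates both.\<close>

lemma conn_g2_algebra:
  assumes "y \<in> V"
  shows "g2_algebra (conn y u)"
proof (rule g2_algebraI[OF assms, where A = "\<lambda>i. dd (\<lambda>y. e y i) y u + \<Gamma> y u (e y i)"])
  show "conn y u i l = g y (dd (\<lambda>y. e y i) y u + \<Gamma> y u (e y i)) (e y l)" for i l
    by (simp add: conn_def E_component[OF assms])
  show "g y (dd (\<lambda>y. e y i) y u + \<Gamma> y u (e y i)) (e y j) +
      g y (e y i) (dd (\<lambda>y. e y j) y u + \<Gamma> y u (e y j)) = 0" for i j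
    using has_derivative_eq_0_on_open[OF open_V assms _ has_derivative_g[OF assms e_diff e_diff]]
      g_frame assms by blast
  show "F y (dd (\<lambda>y. e y i) y u + \<Gamma> y u (e y i)) (e y j) (e y k) +
      F y (e y i) (dd (\<lambda>y. e y j) y u + \<Gamma> y u (e y j)) (e y k) +
      F y (e y i) (e y j) (dd (\<lambda>y. e y k) y u + \<Gamma> y u (e y k)) = 0" for i j k
    using has_derivative_eq_0_on_open[OF open_V assms _ has_derivative_F[OF assms e_diff e_diff
        e_diff]]
      F_frame assms by blast
qed

text \<open>Differentiating frame components gives the covariant derivative plus the action of the
  connection form. The latter lies in \<open>g\<^sub>2\<close> and so passes through all
  contractions with \<phi>.\<close>

lemma has_derivative_t:
  assumes "y \<in> V"
  shows "((\<lambda>y. t y i j k) has_derivative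
    (\<lambda>u. P y u (e y i) (e y j) (e y k) + act3 (conn y u) (t y) i j k)) (at y)"
proof -
  define A where "A u i = dd (\<lambda>y. e y i) y u + \<Gamma> y u (e y i)" for u i
  have A: "(E y *v A u i) $ l = conn y u i l" for u i l
    by (simp add: A_def conn_def)
  have "T y (A u i) v w = (\<Sum>l\<in>UNIV. conn y u i l * T y (e y l) v w)"
    "T y v (A u i) w = (\<Sum>l\<in>UNIV. conn y u i l * T y v (e y l) w)"
    "T y v w (A u i) = (\<Sum>l\<in>UNIV. conn y u i l * T y v w (e y l))" for u i v w
    using linear_expand[OF assms linear_T(1), of y "A u i" v w] linear_expand[OF assms linear_T(2),
        of y v "A u i" w]
      linear_expand[OF assms linear_T(3), of y v w "A u i"] assms by (simp_all add: A)
  then show ?thesis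
    using has_derivative_T[OF assms e_diff[OF assms] e_diff[OF assms] e_diff[OF assms], of i j k]
    by (simp add: t_def[abs_def] act3_def sum.distrib add.assoc flip: A_def)
qed

lemma skew3_t: "y \<in> V \<Longrightarrow> skew3 (t y)"
  unfolding t_def by unfold_locales (rule T_skew, rule T_skew(2))

lemma T_tau:
  assumes "y \<in> V"
  shows "T y (\<tau> y u v) w z = (\<Sum>m\<in>UNIV. T y u v (e y m) * T y (e y m) w z)"
  using linear_expand[OF assms linear_T(1)[OF assms], of "\<tau> y u v" w z]
  by (simp add: E_component[OF assms] T_def[of y u v])

lemma P_skew:
  assumes "y \<in> V"
  shows "P y u v w z = - P y u w v z" "P y u v w z = - P y u v z w"
proof -
  have d: "dd (\<lambda>y. T y v w z) y = dd (\<lambda>y. - T y w v z) y" "dd (\<lambda>y. T y v w z) y = dd (\<lambda>y. - T y v z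
      w) y"
    using T_skew by (intro frechet_derivative_cong_open(1)[OF open_V assms]; blast)+
  have m: "dd (\<lambda>y. - T y v w z) y u = - dd (\<lambda>y. T y v w z) y u" for v w z
    using fun_cong[OF frechet_derivative_at[OF has_derivative_minus[OF T_diff[OF assms, THEN
        frechet_derivative_works[THEN iffD1]]], symmetric]]
    by simp
  show "P y u v w z = - P y u w v z" "P y u v w z = - P y u v z w"
    using d[THEN fun_cong, of u] m[of w v z] m[of v z w] T_skew(1)[of y "\<Gamma> y u v" w z] T_skew(1)[of
        y v "\<Gamma> y u w" z] T_skew(1)[of y v w "\<Gamma> y u z"]
      T_skew(2)[OF assms, of "\<Gamma> y u v" w z] T_skew(2)[OF assms, of v "\<Gamma> y u w" z] T_skew(2)[OF
          assms, of v w "\<Gamma> y u z"]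
    unfolding P_def by linarith+
qed

lemma linear_P:
  assumes "y \<in> V"
  shows "linear (\<lambda>u. P y u v w z)" "linear (\<lambda>v. P y u v w z)" "linear (\<lambda>w. P y u v w z)"
    "linear (\<lambda>z. P y u v w z)"
proof -
  have d: "linear (\<lambda>u. dd (\<lambda>y. T y v w z) y u)"
    using linear_frechet_derivative[OF T_diff[OF assms]] .
  show "linear (\<lambda>u. P y u v w z)"
    by (rule linearI; simp add: P_def linear_T[OF assms, THEN linear_add] linear_T[OF assms, THEN
        linear_cmul]
        linear_add[OF d] linear_cmul[OF d] \<Gamma>_simps[OF assms] algebra_simps)
  have d1: "linear (\<lambda>v. dd (\<lambda>y. T y v w z) y u)"
    by (rule linear_dd[OF open_V assms linear_T(1) T_diff[OF assms]])
  show "linear (\<lambda>v. P y u v w z)"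
    by (rule linearI; simp add: P_def linear_T[OF assms, THEN linear_add] linear_T[OF assms, THEN
        linear_cmul]
        linear_add[OF d1] linear_cmul[OF d1] \<Gamma>_simps[OF assms] algebra_simps)
  have d2: "linear (\<lambda>w. dd (\<lambda>y. T y v w z) y u)"
    by (rule linear_dd[OF open_V assms linear_T(2) T_diff[OF assms]])
  show "linear (\<lambda>w. P y u v w z)"
    by (rule linearI; simp add: P_def linear_T[OF assms, THEN linear_add] linear_T[OF assms, THEN
        linear_cmul]
        linear_add[OF d2] linear_cmul[OF d2] \<Gamma>_simps[OF assms] algebra_simps)
  have d3: "linear (\<lambda>z. dd (\<lambda>y. T y v w z) y u)"
    by (rule linear_dd[OF open_V assms linear_T(3) T_diff[OF assms]])
  show "linear (\<lambda>z. P y u v w z)"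
    by (rule linearI; simp add: P_def linear_T[OF assms, THEN linear_add] linear_T[OF assms, THEN
        linear_cmul]
        linear_add[OF d3] linear_cmul[OF d3] \<Gamma>_simps[OF assms] algebra_simps)
qed

lemma P_eq_0I:
  assumes "y \<in> V" "\<And>l i j k. p y l i j k = 0"
  shows "P y u v w z = 0"
  by (rule linear_eq_0[OF assms(1) linear_P(1)[OF assms(1)]], rule linear_eq_0[OF assms(1)
      linear_P(2)[OF assms(1)]],
      rule linear_eq_0[OF assms(1) linear_P(3)[OF assms(1)]], rule linear_eq_0[OF assms(1)
          linear_P(4)[OF assms(1)]])
    (rule assms(2)[unfolded p_def])

lemma g_R_frame:
  assumes "y \<in> V"
  shows "skew2 (\<lambda>i j. g y (R y u v (e y i)) (e y j))" "phic (\<lambda>i j. g y (R y u v (e y i)) (e y j)) =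
      (\<lambda>_. 0)"
proof -
  interpret g2_algebra "\<lambda>i j. g y (R y u v (e y i)) (e y j)"
  proof (rule g2_algebraI[OF assms refl])
    show "g y (R y u v (e y i)) (e y j) + g y (e y i) (R y u v (e y j)) = 0" for i j
      using g_R_skew[OF assms, of u v "e y i" "e y j"] g_commute[of y "e y i"] by simp
  qed (rule F_R[OF assms])
  show "skew2 (\<lambda>i j. g y (R y u v (e y i)) (e y j))" ..
  show "phic (\<lambda>i j. g y (R y u v (e y i)) (e y j)) = (\<lambda>_. 0)"
    using phic_eq_0[OF act3_phi] by blast
qed

lemma linear_R:
  assumes "y \<in> V"
  shows "linear (\<lambda>u. R y u v w)" "linear (\<lambda>v. R y u v w)" "linear (\<lambda>w. R y u v w)"
proof -
  have "linear (\<lambda>u. dd (\<lambda>y. \<Gamma> y v w) y u)" for v w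
    by (rule linear_frechet_derivative[OF \<Gamma>_diff[OF assms]])
  moreover have "linear (\<lambda>v. dd (\<lambda>y. \<Gamma> y v w) y u)" for u w
    by (rule linear_dd[OF open_V assms]) (rule linear_\<Gamma>, assumption, rule \<Gamma>_diff[OF assms])
  moreover have "linear (\<lambda>w. dd (\<lambda>y. \<Gamma> y v w) y u)" for u v
    by (rule linear_dd[OF open_V assms]) (rule linear_\<Gamma>, assumption, rule \<Gamma>_diff[OF assms])
  ultimately have d: "linear (\<lambda>u. dd (\<lambda>y. \<Gamma> y v w) y u)" "linear (\<lambda>v. dd (\<lambda>y. \<Gamma> y v w) y u)"
    "linear (\<lambda>w. dd (\<lambda>y. \<Gamma> y v w) y u)" for u v w
    by blast+
  show "linear (\<lambda>u. R y u v w)" "linear (\<lambda>v. R y u v w)" "linear (\<lambda>w. R y u v w)"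
    by (rule linearI; simp add: curv_def \<Gamma>_simps[OF assms] d[THEN linear_add] d[THEN linear_cmul]
        algebra_simps)+
qed

section \<open>Bianchi identity and Ricci tensor\<close>

definition riem :: "real^7 \<Rightarrow> real^7 \<Rightarrow> real^7 \<Rightarrow> real^7 \<Rightarrow> real^7 \<Rightarrow> real" where
  "riem y u v w z = g y (R y u v w) z"

definition ric :: "real^7 \<Rightarrow> real^7 \<Rightarrow> real^7 \<Rightarrow> real" where
  "ric y u v = (\<Sum>i\<in>UNIV. riem y (e y i) u v (e y i))"

definition bianchi_sum :: "real^7 \<Rightarrow> real^7 \<Rightarrow> real^7 \<Rightarrow> real^7 \<Rightarrow> real^7 \<Rightarrow> real" where
  "bianchi_sum y u v w z = riem y u v w z + riem y v w u z + riem y w u v z"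

lemma riem_skew:
  "riem y u v w z = - riem y v u w z"
  "y \<in> V \<Longrightarrow> riem y u v w z = - riem y u v z w"
  using R_skew[of y u v w] g_R_skew[of y u v w z] by (simp_all add: riem_def g_simps)

lemma linear_riem:
  assumes "y \<in> V"
  shows "linear (\<lambda>u. riem y u v w z)" "linear (\<lambda>v. riem y u v w z)" "linear (\<lambda>w. riem y u v w z)"
    "linear (\<lambda>z. riem y u v w z)"
  by (rule linearI; simp add: riem_def linear_R[OF assms, THEN linear_add] linear_R[OF assms, THEN
      linear_cmul] g_simps)+

lemma riem_pair_symmetric:
  assumes "y \<in> V" "\<And>u v w z. bianchi_sum y u v w z = 0"
  shows "riem y u v w z = riem y w z u v"
  by (rule pair_symmetric[OF riem_skew(1) riem_skew(2)[OF assms(1)] assms(2)[unfolded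
      bianchi_sum_def]])

lemma ric_eq_0_if_bianchi:
  assumes y: "y \<in> V" and b: "\<And>u v w z. bianchi_sum y u v w z = 0"
  shows "ric y u v = 0"
proof (rule linear_eq_0[OF y])
  show "linear (\<lambda>v. ric y u v)"
    by (rule linearI; simp add: ric_def linear_riem[OF y, THEN linear_add] linear_riem[OF y, THEN
        linear_cmul]
        sum.distrib sum_distrib_left)
  fix j
  define r where "r a b c = riem y u (e y a) (e y b) (e y c)" for a b c
  have "(\<Sum>a\<in>UNIV. r a j a) = 0"
  proof (rule trace_eq_0_if_bianchi[where r = r])
    show "r a b c = - r a c b" for a b c
      unfolding r_def by (rule riem_skew(2)[OF y])
    show "phic (r a) = (\<lambda>_. 0)" for a
      unfolding r_def riem_def by (rule g_R_frame(2)[OF y])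
    show "r a b c + r c a b + r b c a = 0" for a b c
    proof -
      \<comment> \<open>Pair symmetry carries the fixed argument from the last slot, which the
        cyclic sum leaves alone, to the first, as the trace lemma requires.\<close>
      have "riem y a b c u = - riem y u c a b" for a b c
        using riem_pair_symmetric[OF y b, of a b c u] riem_skew(1)[of y c u a b] by simp
      then show ?thesis
        using b[of "e y a" "e y b" "e y c" u] by (simp add: r_def bianchi_sum_def)
    qed
  qed
  then show "ric y u (e y j) = 0"
    by (simp add: ric_def r_def riem_skew(1)[of y u] sum_negf)
qed

lemma bianchi_if_pair_symmetric_ricci_flat:
  assumes y: "y \<in> V" and sym: "\<And>u v w z. riem y u v w z = riem y w z u v" and ric: "\<And>u v. ric y u v
      = 0"
  shows "bianchi_sum y u v w z = 0"
proof -
  define w where "w i a b c = bianchi_sum y (e y i) (e y a) (e y b) (e y c)" for i a b c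
  \<comment> \<open>Skewness in the first three arguments comes from that of the first pair of
    \<open>riem\<close>; the last two arguments need pair symmetry.\<close>
  have s: "bianchi_sum y u v w z = - bianchi_sum y v u w z" "bianchi_sum y u v w z = - bianchi_sum y
      u w v z"
    "bianchi_sum y u v w z = - bianchi_sum y u v z w" for u v w z
    using riem_skew(1)[of y u v w z] riem_skew(1)[of y v w u z] riem_skew(1)[of y w u v z]
      riem_skew(2)[OF y, of u v w z] riem_skew(2)[OF y, of v w u z] riem_skew(1)[of y u w v z]
      sym[of v z u w] sym[of z u v w]
    unfolding bianchi_sum_def by linarith+
  interpret w: skew4 w
    unfolding w_def by unfold_locales (rule s)+
  have "cvec (w i) j = 0" for i j
  proof (rule cvec_bianchi_eq_0_if_trace_eq_0)
    define r where "r a b c = riem y (e y i) (e y a) (e y b) (e y c)" for a b c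
    show "r a b c = - r a c b" for a b c
      unfolding r_def by (rule riem_skew(2)[OF y])
    show "phic (r a) = (\<lambda>_. 0)" for a
      unfolding r_def riem_def by (rule g_R_frame(2)[OF y])
    show "w i a b c = r a b c + r c a b + r b c a" for a b c
      using sym[of "e y a" "e y b" "e y i" "e y c"] riem_skew(1)[of y "e y b" "e y i" "e y a" "e y
          c"]
        riem_skew(2)[OF y, of "e y i" "e y b" "e y a" "e y c"]
      unfolding w_def bianchi_sum_def r_def by linarith
    show "(\<Sum>a\<in>UNIV. r a j a) = 0"
      using ric[of "e y i" "e y j"] by (simp add: ric_def r_def riem_skew(1)[of y "e y i"] sum_negf)
  qed (rule w.skew3)
  then have "bianchi_sum y (e y i) (e y a) (e y b) (e y c) = 0" for i a b c
    using w.eq_0_if_cvec_eq_0 unfolding w_def by blast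
  note 0 = this
  have l: "linear (\<lambda>u. bianchi_sum y u v w z)" "linear (\<lambda>v. bianchi_sum y u v w z)" "linear (\<lambda>w.
      bianchi_sum y u v w z)"
    "linear (\<lambda>z. bianchi_sum y u v w z)" for u v w z
    by (rule linearI; simp add: bianchi_sum_def linear_riem[OF y, THEN linear_add] linear_riem[OF y,
        THEN linear_cmul]
        algebra_simps)+
  show ?thesis
    by (rule linear_eq_0[OF y l(1)], rule linear_eq_0[OF y l(2)], rule linear_eq_0[OF y l(3)],
        rule linear_eq_0[OF y l(4)]) (rule 0)
qed

lemma bianchi_sum_torsion:
  assumes "y \<in> V"
  shows "bianchi_sum y u v w z = P y u v w z + P y v w u z + P y w u v z
    + (T y (\<tau> y u v) w z + T y (\<tau> y v w) u z + T y (\<tau> y w u) v z)"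
  using bianchi_torsion[OF assms, of u v w z] by (simp add: bianchi_sum_def riem_def)

lemma sigma_t:
  assumes "y \<in> V"
  shows "T y (\<tau> y (e y a) (e y b)) (e y c) (e y d) + T y (\<tau> y (e y b) (e y c)) (e y a) (e y d)
    + T y (\<tau> y (e y c) (e y a)) (e y b) (e y d) = sigma_form (t y) a b c d"
proof -
  have "t y m c d = t y c d m" for m c d
    using skew3.skew(1)[OF skew3_t[OF assms], of m c d] skew3.skew(2)[OF skew3_t[OF assms], of c m
        d] by simp
  then have "(\<Sum>m\<in>UNIV. t y a b m * t y m c d) = (\<Sum>m\<in>UNIV. t y a b m * t y c d m)" for a b c d
    by (intro sum.cong refl arg_cong2[where f = "(*)"])
  then show ?thesis
    unfolding T_tau[OF assms] t_def[symmetric] by (simp only: sigma_form_def sum.distrib)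
qed

text \<open>\<open>P\<close> is skew in its last three slots, so for four given vectors its values
  are, up to sign, four numbers, one for each vector in the first slot. Each of the four Bianchi
  identities puts the sum of three of them at minus \<sigma>, hence each equals minus a third of
  \<sigma>.\<close>

lemma p_eq_sigma:
  assumes y: "y \<in> V" and b: "\<And>u v w z. bianchi_sum y u v w z = 0"
  shows "p y a b c d = - (1 / 3) * sigma_form (t y) a b c d"
proof -
  interpret skew4 "sigma_form (t y)"
    by (rule skew3.skew4_sigma[OF skew3_t[OF y]])
  have q: "p y a b c d + p y b c a d + p y c a b d = - sigma_form (t y) a b c d" for a b c d
    using bianchi_sum_torsion[OF y, of "e y a" "e y b" "e y c" "e y d"] b by (simp add: p_def
        sigma_t[OF y])
  have s: "p y a b c d = - p y a c b d" "p y a b c d = - p y a b d c" for a b c d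
    unfolding p_def by (rule P_skew[OF y])+
  show ?thesis
    using q[of a b c d] q[of b c d a] q[of c d a b] q[of d a b c]
      s(1)[of b c a d] s(2)[of b c d a] s(1)[of c d b a] s(2)[of c b d a] s(1)[of c b a d]
      s(2)[of d b c a] s(1)[of d b a c] s(1)[of c d a b] s(2)[of c a d b] s(2)[of d a c b]
      s(2)[of a c d b] s(1)[of a c b d] s(2)[of a b d c] s(1)[of b d a c] s(2)[of b a d c]
      skew(3)[of b c d a] skew(2)[of b c a d] skew(1)[of b a c d] skew(2)[of c d a b]
      skew(1)[of c a d b] skew(3)[of a c d b] skew(2)[of a c b d] skew(1)[of d a b c]
      skew(2)[of a d b c] skew(3)[of a b d c]
    by linarith
qed

end

section \<open>Parallel torsion\<close>

lemma linear_sumI: "(\<And>i. linear (f i)) \<Longrightarrow> linear (\<lambda>x. \<Sum>i\<in>(UNIV :: 7 set). f i x :: real)"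
  by (rule linear_compose_sum) auto

lemma linear_multI: "linear f \<Longrightarrow> linear (\<lambda>x. f x * (c :: real))" "linear f \<Longrightarrow> linear (\<lambda>x. (c :: real)
    * f x)"
  by (simp_all add: linear_iff algebra_simps)

context g2_local
begin

lemma cvec_t_derivative:
  assumes "y \<in> V"
  shows "((\<lambda>y. cvec (t y) j) has_derivative (\<lambda>u. cvec (\<lambda>a b c. P y u (e y a) (e y b) (e y c)) j
    + (\<Sum>m\<in>UNIV. conn y u j m * cvec (t y) m))) (at y)"
  using has_derivative_cvec[where X = t and x = y and
      X' = "\<lambda>u i j k. P y u (e y i) (e y j) (e y k) + act3 (conn y u) (t y) i j k", OF
          has_derivative_t[OF assms]]
  by (simp add: cvec_add g2_algebra.cvec_act3[OF conn_g2_algebra[OF assms]])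

lemma cmat_t_derivative:
  assumes "y \<in> V"
  shows "((\<lambda>y. cmat (t y) i j) has_derivative (\<lambda>u. cmat (\<lambda>a b c. P y u (e y a) (e y b) (e y c)) i j
    + (\<Sum>l\<in>UNIV. conn y u i l * cmat (t y) l j + conn y u j l * cmat (t y) i l))) (at y)"
  using has_derivative_cmat[where X = t and x = y and
      X' = "\<lambda>u i j k. P y u (e y i) (e y j) (e y k) + act3 (conn y u) (t y) i j k", OF
          has_derivative_t[OF assms]]
  by (simp add: cmat_add g2_algebra.cmat_act3[OF conn_g2_algebra[OF assms]])

text \<open>The derivative of the constant trace has a part from \<open>P\<close> and a part from
  the connection form, and the latter drops out by invariance under
  \<open>g\<^sub>2\<close>.\<close>

lemma trace_cmat_p_eq_0:
  assumes y: "y \<in> V" and const: "\<And>y. y \<in> V \<Longrightarrow> (\<Sum>i\<in>UNIV. cmat (t y) i i) = c"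
  shows "(\<Sum>i\<in>UNIV. cmat (p y x) i i) = 0"
proof -
  interpret g2_algebra "conn y (e y x)"
    by (rule conn_g2_algebra[OF y])
  have "((\<lambda>y. \<Sum>i\<in>UNIV. cmat (t y) i i) has_derivative (\<lambda>u. \<Sum>i\<in>UNIV.
      cmat (\<lambda>i j k. P y u (e y i) (e y j) (e y k) + act3 (conn y u) (t y) i j k) i i)) (at y)"
    by (intro has_derivative_sum has_derivative_cmat has_derivative_t y)
  from has_derivative_eq_0_on_open[OF open_V y const this]
  have "(\<Sum>i\<in>UNIV. cmat (\<lambda>i j k. p y x i j k + act3 (conn y (e y x)) (t y) i j k) i i) = 0"
    by (simp add: p_def)
  then show ?thesis
    using trace_cmat_act3[of "t y"] by (simp add: cmat_add sum.distrib)
qed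

theorem P_eq_0_if_bianchi:
  assumes b: "\<And>y u v w z. y \<in> V \<Longrightarrow> bianchi_sum y u v w z = 0"
    and const: "\<And>y. y \<in> V \<Longrightarrow> (\<Sum>i\<in>UNIV. cmat (t y) i i) = c"
    and x: "x \<in> V"
  shows "P x u v w z = 0"
proof -
  define \<theta> where "\<theta> y = cvec (t y)" for y
  \<comment> \<open>Contraction with \<psi> commutes with the covariant derivative, so
    \<open>M\<close> is the matrix of \<open>\<nabla>\<theta>\<close>.\<close>
  define M where "M y i = cvec (p y i)" for y i
  have p: "p y a b c d = - (1 / 3) * sigma_form (t y) a b c d" if "y \<in> V" for y a b c d
    using p_eq_sigma[OF that b[OF that]] .
  have p_sigma: "p y i = (\<lambda>b c d. - (1 / 3) * sigma_form (t y) i b c d)"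
    and sigma_p: "sigma_form (t y) i = (\<lambda>b c d. - 3 * p y i b c d)" if "y \<in> V" for y i
    using p[OF that] by (simp_all add: fun_eq_iff)
  have p4: "skew4 (p y)" if y: "y \<in> V" for y
  proof -
    interpret skew4 "sigma_form (t y)"
      by (rule skew3.skew4_sigma[OF skew3_t[OF y]])
    show ?thesis
    proof
      show "p y i j k l = - p y j i k l" "p y i j k l = - p y i k j l" "p y i j k l = - p y i j l k"
          for i j k l
        unfolding p[OF y] using skew(1)[of i j k l] skew(2)[of i j k l] skew(3)[of i j k l] by
            linarith+
    qed
  qed
  have tr: "(\<Sum>i\<in>UNIV. cmat (p y a) i i) = 0" if "y \<in> V" for y a
    using trace_cmat_p_eq_0[OF that const] .
  have tr_sigma: "(\<Sum>i\<in>UNIV. cmat (sigma_form (t y) a) i i) = 0" if "y \<in> V" for y a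
    unfolding sigma_p[OF that] cmat_cmult sum_distrib_left[symmetric] tr[OF that] by simp
  have M_sym: "M y i j = M y j i" if "y \<in> V" for y i j
    using skew4.cvec_antisym[OF p4[OF that], of i j] tr[OF that] by (simp add: M_def)
  note s = skew3.sigma_cvec_eq_0[OF skew3_t tr_sigma]
  have M\<theta>: "(\<Sum>i\<in>UNIV. M y i j * \<theta> y i) = 0" if "y \<in> V" for y j
  proof -
    have "(\<Sum>i\<in>UNIV. \<theta> y i * (- 3 * M y i j)) = 0"
      using s(3)[OF that that, of j] unfolding sigma_p[OF that] cvec_cmult by (simp add: M_def
          \<theta>_def)
    then show ?thesis
      by (simp add: sum_negf sum_distrib_left[symmetric] mult.left_commute mult.commute)
  qed
  define S where "S y i j = cmat (t y) i j + cmat (t y) j i" for y i j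
  have S\<theta>: "(\<Sum>j\<in>UNIV. S y i j * \<theta> y j) = 0" if "y \<in> V" for y i
    using s(1)[OF that that, of i] s(2)[OF that that, of i]
    by (simp add: S_def \<theta>_def distrib_left sum.distrib mult.commute)
  have D\<theta>: "((\<lambda>y. \<theta> y j) has_derivative (\<lambda>u. cvec (\<lambda>a b c. P x u (e x a) (e x b) (e x c)) j
      + (\<Sum>m\<in>UNIV. conn x u j m * \<theta> x m))) (at x)" for j
    using cvec_t_derivative[OF x] by (simp add: \<theta>_def)
  have "M x i j = 0" for i j
  proof (cases "\<theta> x = (\<lambda>_. 0)")
    case True
    \<comment> \<open>At a zero of \<theta> the connection term vanishes and the plain derivative is
      the covariant one.\<close>
    have D0: "((\<lambda>y. \<theta> y j) has_derivative (\<lambda>u. cvec (\<lambda>a b c. P x u (e x a) (e x b) (e x c)) j)) (at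
        x)" for j
      using D\<theta>[of j] by (simp add: True)
    \<comment> \<open>\<open>p\<close> contains derivatives of the torsion, but its multiple
      \<sigma> is a polynomial in \<open>t\<close> and can be differentiated.\<close>
    have "(\<lambda>y. cvec (sigma_form (t y) i) j) differentiable (at x)" for i j
    proof -
      have "(\<lambda>y. t y i j k) differentiable (at x)" for i j k
        by (rule differentiableI[OF has_derivative_t[OF x]])
      then show ?thesis
        unfolding cvec_def cmat_def phic_def sigma_form_def
        by (intro differentiable_sum differentiable_mult differentiable_add differentiable_const
            ballI) auto
    qed
    moreover define N where "N i = frechet_derivative (\<lambda>y. cvec (sigma_form (t y) i) j) (at x)" for
        i
    ultimately have N: "((\<lambda>y. cvec (sigma_form (t y) i) j) has_derivative N i) (at x)" for i
      by (simp flip: frechet_derivative_works)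
    have z: "(\<Sum>i\<in>UNIV. cvec (sigma_form (t y) i) j * \<theta> y i) = 0" if "y \<in> V" for y
      using s(3)[OF that that, of j] by (simp add: \<theta>_def mult.commute)
    have "((\<lambda>y. \<Sum>i\<in>UNIV. cvec (sigma_form (t y) i) j * \<theta> y i) has_derivative (\<lambda>u. \<Sum>i\<in>UNIV.
        cvec (sigma_form (t x) i) j * cvec (\<lambda>a b c. P x u (e x a) (e x b) (e x c)) i + N i u * \<theta> x
            i)) (at x)"
      by (intro has_derivative_sum has_derivative_mult N D0)
    from has_derivative_eq_0_on_open[OF open_V x z this, of "e x j"]
    \<comment> \<open>The unknown derivative \<open>N\<close> is multiplied by \<theta>, which
      vanishes here. The direction \<open>e x j\<close> leaves the diagonal entry
      \<open>(j, j)\<close> of the square of the symmetric matrix \<open>M x\<close>, a sum of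
      squares.\<close>
    have "(\<Sum>i\<in>UNIV. - 3 * M x i j * M x j i) = 0"
      unfolding sigma_p[OF x] cvec_cmult by (simp add: True M_def p_def[abs_def])
    then have "(\<Sum>i\<in>UNIV. M x i j * M x i j) = 0"
      by (simp add: M_sym[OF x, of j] sum_negf sum_distrib_left[symmetric] mult.assoc)
    then show ?thesis
      by (simp add: sum_nonneg_eq_0_iff)
  next
    case False
    then obtain k where k: "\<theta> x k \<noteq> 0"
      by blast
    \<comment> \<open>The relation required by the lemma is
      \<open>(C + C\<^sup>T)\<theta> = 0\<close> differentiated along a frame vector.\<close>
    show ?thesis
    proof (rule eq_0_if_commute_cross[where S = "S x" and M = "M x" and v = "\<theta> x", OF M_sym[OF x] _
        _ _ k])
      show "S x i j = S x j i" for i j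
        by (simp add: S_def)
      show "(\<Sum>j\<in>UNIV. M x i j * \<theta> x j) = 0" for i
        using M\<theta>[OF x, of i] by (simp only: M_sym[OF x, of i])
      fix i l
      define u where "u = e x l"
      define K where "K = conn x u"
      interpret K: g2_algebra K
        unfolding K_def by (rule conn_g2_algebra[OF x])
      have D: "((\<lambda>y. \<Sum>j\<in>UNIV. S y i j * \<theta> y j) has_derivative (\<lambda>u. \<Sum>j\<in>UNIV.
          S x i j * (cvec (\<lambda>a b c. P x u (e x a) (e x b) (e x c)) j + (\<Sum>m\<in>UNIV. conn x u j m * \<theta> x
              m))
          + ((cmat (\<lambda>a b c. P x u (e x a) (e x b) (e x c)) i j
               + (\<Sum>l\<in>UNIV. conn x u i l * cmat (t x) l j + conn x u j l * cmat (t x) i l))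
             + (cmat (\<lambda>a b c. P x u (e x a) (e x b) (e x c)) j i
               + (\<Sum>l\<in>UNIV. conn x u j l * cmat (t x) l i + conn x u i l * cmat (t x) j l))) * \<theta> x
                   j)) (at x)"
        unfolding S_def
        by (intro has_derivative_sum has_derivative_mult has_derivative_add D\<theta> cmat_t_derivative[OF
            x])
      have "(\<Sum>j\<in>UNIV. S x i j * (M x l j + (\<Sum>m\<in>UNIV. K j m * \<theta> x m))
          + (cmat (p x l) i j + cmat (p x l) j i + (\<Sum>l\<in>UNIV. K i l * S x l j + K j l * S x i l)) * \<theta>
              x j) = 0"
        using has_derivative_eq_0_on_open[OF open_V x S\<theta> D, of u]
        by (simp add: u_def M_def p_def[abs_def] S_def K_def sum.distrib algebra_simps)
      then have 1: "(\<Sum>j\<in>UNIV. S x i j * M x l j) + (\<Sum>j\<in>UNIV. (cmat (p x l) i j + cmat (p x l) j i) *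
          \<theta> x j)
          + ((\<Sum>j\<in>UNIV. \<Sum>m\<in>UNIV. K j m * (S x i j * \<theta> x m)) + (\<Sum>j\<in>UNIV. \<Sum>m\<in>UNIV. K j m * (S x i m * \<theta>
              x j)))
          + (\<Sum>j\<in>UNIV. \<Sum>l\<in>UNIV. K i l * (S x l j * \<theta> x j)) = 0"
        by (simp add: sum.distrib sum_distrib_left sum_distrib_right algebra_simps)
      \<comment> \<open>The connection terms disappear: those on the free index \<open>i\<close>
        since \<open>S x\<close> kills \<theta>, those on the summed index since \<open>K\<close> is
        skew.\<close>
      have 2: "(\<Sum>j\<in>UNIV. \<Sum>l\<in>UNIV. K i l * (S x l j * \<theta> x j)) = 0"
        by (subst sum.swap) (simp add: sum_distrib_left[symmetric] S\<theta>[OF x])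
      have "(\<Sum>j\<in>UNIV. \<Sum>m\<in>UNIV. K j m * (S x i j * \<theta> x m + S x i m * \<theta> x j)) = 0"
        by (rule skew_sum_eq_0[OF K.skew]) simp
      then have 3: "(\<Sum>j\<in>UNIV. \<Sum>m\<in>UNIV. K j m * (S x i j * \<theta> x m)) + (\<Sum>j\<in>UNIV. \<Sum>m\<in>UNIV. K j m * (S x
          i m * \<theta> x j)) = 0"
        by (simp add: distrib_left sum.distrib)
      \<comment> \<open>Here \<open>cmat_sym\<close> brings in the cross product by \<theta>; of its
        two terms the second contains \<open>M x\<close> applied to \<theta> and vanishes.\<close>
      have "(\<Sum>j\<in>UNIV. (cmat (p x l) i j + cmat (p x l) j i) * \<theta> x j) =
          (\<Sum>j\<in>UNIV. (1 / 3) * (\<Sum>a\<in>UNIV. M x i a * (phi a j l * \<theta> x j))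
            + (1 / 3) * (\<Sum>a\<in>UNIV. phi a i l * (M x j a * \<theta> x j)))"
        unfolding skew4.cmat_sym[OF p4[OF x]] M_def[symmetric]
        by (simp only: sum.distrib distrib_left distrib_right sum_distrib_left sum_distrib_right)
          (simp add: mult_ac)
      also have "\<dots> = (1 / 3) * (\<Sum>a\<in>UNIV. M x i a * (\<Sum>j\<in>UNIV. phi a j l * \<theta> x j))"
        unfolding sum.distrib sum_distrib_left[symmetric]
        by (subst (1 2) sum.swap) (simp add: sum_distrib_left[symmetric] M\<theta>[OF x])
      finally show "(1 / 3) * (\<Sum>a\<in>UNIV. M x i a * (\<Sum>j\<in>UNIV. phi a j l * \<theta> x j))
          + (\<Sum>j\<in>UNIV. S x i j * M x l j) = 0"
        using 1 2 3 by linarith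
    qed
  qed
  then have "p x l i j k = 0" for l i j k
    using skew4.eq_0_if_cvec_eq_0[OF p4[OF x]] unfolding M_def by blast
  then show ?thesis
    by (rule P_eq_0I[OF x])
qed

text \<open>The difference \<open>b\<close> of the two sides, paired with a third vector, is skew in
  its last two arguments by metricity and symmetric in the first two, as both connections lose their
  torsion. Such a tensor is zero.\<close>

lemma levi_civita_eq:
  assumes y: "y \<in> V" and sym: "\<And>u v. G y u v = G y v u"
    and met: "\<And>u v w. dd (\<lambda>y. g y v w) y u = g y (G y u v) w + g y v (G y u w)"
  shows "G y u v = \<Gamma> y u v - (1 / 2) *\<^sub>R \<tau> y u v"
proof -
  define b where "b u v w = g y (\<Gamma> y u v) w - g y (G y u v) w - (1 / 2) * T y u v w" for u v w
  have s: "b u v w = - b u w v" for u v w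
    using met[of v w u] met_parallel[OF y, of v w u] T_skew(2)[OF y, of u v w]
      g_commute[of y v "G y u w"] g_commute[of y v "\<Gamma> y u w"] unfolding b_def by simp
  have c: "b u v w = b v u w" for u v w
    unfolding b_def T_def tau_def sym[of u v] by (simp add: g_simps field_simps)
  have b: "b u v w = 0" for u v w
    using s[of u v w] c[of u v w] s[of v u w] c[of v w u] s[of w v u] c[of w u v] s[of u w v] by
        linarith
  have "g y (\<Gamma> y u v - (1 / 2) *\<^sub>R \<tau> y u v - G y u v) w = 0" for w
    using b[of u v w] by (simp add: b_def T_def g_simps)
  from g_nondegenerate[OF y this] show ?thesis
    by simp
qed

lemma P_levi_civita:
  assumes y: "y \<in> V" and G: "\<And>u v. G y u v = \<Gamma> y u v - (1 / 2) *\<^sub>R \<tau> y u v"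
  shows "dd (\<lambda>y. T y v w z) y u - T y (G y u v) w z - T y v (G y u w) z - T y v w (G y u z) =
    P y u v w z + (1 / 2) * (T y (\<tau> y u v) w z + T y (\<tau> y v w) u z + T y (\<tau> y w u) v z)"
proof -
  have "\<tau> y w u = - \<tau> y u w"
    by (simp add: tau_def)
  then have "T y v (\<tau> y u w) z = T y (\<tau> y w u) v z"
    using T_skew(1)[of y v "\<tau> y u w" z] linear_neg[OF linear_T(1)[OF y]] by simp
  moreover have "T y v w (\<tau> y u z) = T y (\<tau> y v w) u z"
    using g_commute[of y "\<tau> y v w" "\<tau> y u z"] T_skew(1)[of y u "\<tau> y v w" z]
      T_skew(2)[OF y, of u z "\<tau> y v w"] unfolding T_def[of y v w] T_def[of y u z] by simp
  ultimately show ?thesis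
    by (simp add: P_def G linear_T[OF y, THEN linear_diff] linear_T[OF y, THEN linear_cmul]
        algebra_simps)
qed

text \<open>The exterior derivative of \<open>\<phi>\<close>; it involves only the torsion because \<open>\<nabla>\<phi> = 0\<close>.\<close>

definition dF :: "real^7 \<Rightarrow> real^7 \<Rightarrow> real^7 \<Rightarrow> real^7 \<Rightarrow> real^7 \<Rightarrow> real" where
  "dF y a b c d = F y (\<tau> y a b) c d - F y (\<tau> y a c) b d + F y (\<tau> y a d) b c
     + F y (\<tau> y b c) a d - F y (\<tau> y b d) a c + F y (\<tau> y c d) a b"

lemma ext_deriv_F:
  assumes "y \<in> V"
  shows "dd (\<lambda>y. F y b c d) y a - dd (\<lambda>y. F y a c d) y b + dd (\<lambda>y. F y a b d) y c
    - dd (\<lambda>y. F y a b c) y d = dF y a b c d"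
proof -
  have "F y v (\<Gamma> y u z) w = - F y (\<Gamma> y u z) v w" "F y v w (\<Gamma> y u z) = F y (\<Gamma> y u z) v w" for u v w z
    using F_skew(1)[of y v "\<Gamma> y u z" w] F_skew(2)[of y v w "\<Gamma> y u z"] by simp_all
  then show ?thesis
    by (simp add: phi_parallel[OF assms] dF_def tau_def F_simps)
qed

text \<open>\<open>P = 0\<close> says that the vector-valued torsion is parallel, and
  \<open>dF\<close> is built from it and the parallel form \<phi>.\<close>

lemma dF_parallel:
  assumes y: "y \<in> V" and P: "\<And>u v w z. P y u v w z = 0"
  shows "dd (\<lambda>y. dF y a b c d) y u =
    dF y (\<Gamma> y u a) b c d + dF y a (\<Gamma> y u b) c d + dF y a b (\<Gamma> y u c) d + dF y a b c (\<Gamma> y u d)"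
proof -
  have "dd (\<lambda>y. \<tau> y v w) y u + \<Gamma> y u (\<tau> y v w) - \<tau> y (\<Gamma> y u v) w - \<tau> y v (\<Gamma> y u w) = 0" for u v w
    by (rule g_nondegenerate[OF y]) (simp add: P flip: P_eq[OF y])
  then have \<tau>: "dd (\<lambda>y. \<tau> y v w) y u + \<Gamma> y u (\<tau> y v w) = \<tau> y (\<Gamma> y u v) w + \<tau> y v (\<Gamma> y u w)" for u v
      w
    by (simp add: algebra_simps)
  have D: "((\<lambda>y. F y (\<tau> y a b) c d) has_derivative
      (\<lambda>u. F y (\<tau> y (\<Gamma> y u a) b + \<tau> y a (\<Gamma> y u b)) c d + F y (\<tau> y a b) (\<Gamma> y u c) d
        + F y (\<tau> y a b) c (\<Gamma> y u d))) (at y)" for a b c d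
    using has_derivative_F[OF y \<tau>_diff[OF y, of a b], of "\<lambda>_. c" "\<lambda>_. d"] by (simp add: \<tau>)
  have "((\<lambda>y. dF y a b c d) has_derivative (\<lambda>u.
      dF y (\<Gamma> y u a) b c d + dF y a (\<Gamma> y u b) c d + dF y a b (\<Gamma> y u c) d + dF y a b c (\<Gamma> y u d)))
          (at y)"
    unfolding dF_def by (rule derivative_eq_intros D refl)+ (simp add: fun_eq_iff F_simps
        algebra_simps)
  then show ?thesis
    by (rule fun_cong[OF frechet_derivative_at[symmetric]])
qed

text \<open>Two orthonormal frames differ by an orthogonal matrix. This passes from the coframe
  selected by \<open>SOME\<close>, whose dependence on the point is uncontrolled, to the
  differentiable \<open>E\<close>.\<close>

lemma trace_frame:
  fixes b :: "real^7 \<Rightarrow> real^7 \<Rightarrow> real"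
  assumes y: "y \<in> V" and A: "invertible A" "\<And>u v. (A *v u) \<bullet> (A *v v) = g y u v"
    and b: "\<And>v. linear (\<lambda>u. b u v)" "\<And>u. linear (\<lambda>v. b u v)"
  shows "(\<Sum>i\<in>UNIV. b (frame A i) (frame A i)) = (\<Sum>i\<in>UNIV. b (e y i) (e y i))"
proof -
  define c where "c i l = g y (frame A i) (e y l)" for i l
  have ce: "f (frame A i) = (\<Sum>l\<in>UNIV. c i l * f (e y l))" if "linear f" for f i
    unfolding c_def E_component[OF y, symmetric] by (rule linear_expand[OF y that])
  have cc: "(\<Sum>i\<in>UNIV. c i l * c i m) = delta l m" for l m
    using linear_frame_expand_inner[OF A(1) linear_g(1)[of y "e y m"], of "e y l"] g_frame[OF y, of
        l m]
    by (simp add: A(2) c_def g_commute[of y "e y l"])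
  have "(\<Sum>i\<in>UNIV. b (frame A i) (frame A i)) =
      (\<Sum>i\<in>UNIV. \<Sum>l\<in>UNIV. \<Sum>m\<in>UNIV. (c i l * c i m) * b (e y l) (e y m))"
    by (subst ce[OF b(1)], subst ce[OF b(2)]) (simp add: sum_distrib_left mult.assoc)
  also have "\<dots> = (\<Sum>l\<in>UNIV. \<Sum>i\<in>UNIV. \<Sum>m\<in>UNIV. (c i l * c i m) * b (e y l) (e y m))"
    by (rule sum.swap)
  also have "\<dots> = (\<Sum>l\<in>UNIV. \<Sum>m\<in>UNIV. \<Sum>i\<in>UNIV. (c i l * c i m) * b (e y l) (e y m))"
    by (rule sum.cong[OF refl], rule sum.swap)
  also have "\<dots> = (\<Sum>l\<in>UNIV. b (e y l) (e y l))"
    by (simp add: sum_distrib_right[symmetric] cc)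
  finally show ?thesis .
qed

text \<open>The left-hand side is the pairing \<open>(d\<phi>, *\<phi>)\<close> in the selected
  coframe. It equals the full contraction of torsion and \<phi>, which does not depend on the
  orthonormal frame.\<close>

lemma trace_dF:
  assumes y: "y \<in> V" and A: "invertible A" "\<And>u v. (A *v u) \<bullet> (A *v v) = g y u v"
    "\<And>u v w. phi0 (A *v u) (A *v v) (A *v w) = F y u v w"
  defines "w \<equiv> \<lambda>i j k l. dF y (frame A i) (frame A j) (frame A k) (frame A l)"
  shows "w 3 4 5 6 - w 2 4 6 7 + w 2 3 5 7 + w 1 4 5 7 + w 1 3 6 7 + w 1 2 5 6 + w 1 2 3 4 =
    (\<Sum>i\<in>UNIV. cmat (t y) i i)"
proof -
  define f where "f = frame A"
  define s where "s i j k = T y (f i) (f j) (f k)" for i j k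
  interpret s: skew3 s
    unfolding s_def by unfold_locales (rule T_skew, rule T_skew(2)[OF y])
  have phi: "F y (f i) (f j) (f k) = phi i j k" for i j k
    unfolding A(3)[symmetric] f_def frame[OF A(1)] phi_def ..
  have "F y (\<tau> y (f i) (f j)) (f k) (f l) = (\<Sum>m\<in>UNIV. s i j m * phi m k l)" for i j k l
    using linear_frame_expand_inner[OF A(1) linear_F(1)[of y "f k" "f l"], of "\<tau> y (f i) (f j)"]
    by (simp add: A(2) f_def[symmetric] phi s_def T_def)
  then have "w 3 4 5 6 - w 2 4 6 7 + w 2 3 5 7 + w 1 4 5 7 + w 1 3 6 7 + w 1 2 5 6 + w 1 2 3 4 =
      (\<Sum>i\<in>UNIV. cmat s i i)"
    by (simp add: w_def dF_def f_def[symmetric] sum_7 phi_simps s.cvec_cmat_eval s.sort)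
  also have "\<dots> = (\<Sum>i\<in>UNIV. \<Sum>j\<in>UNIV. \<Sum>k\<in>UNIV. F y (f i) (f j) (f k) * T y (f i) (f j) (f k))"
    by (simp add: cmat_def phic_def s_def phi)
  \<comment> \<open>The frames are exchanged one summation index at a time, each exchange being a
    trace of a bilinear form.\<close>
  also have "\<dots> = (\<Sum>i\<in>UNIV. \<Sum>j\<in>UNIV. \<Sum>k\<in>UNIV. F y (e y i) (f j) (f k) * T y (e y i) (f j) (f k))"
    unfolding f_def
    by (rule trace_frame[OF y A(1,2), where b = "\<lambda>u v. \<Sum>j\<in>UNIV. \<Sum>k\<in>UNIV. F y u (frame A j) (frame A
        k) * T y v (frame A j) (frame A k)"])
      (intro linear_sumI linear_multI linear_F linear_T y)+
  also have "\<dots> = (\<Sum>i\<in>UNIV. \<Sum>j\<in>UNIV. \<Sum>k\<in>UNIV. F y (e y i) (e y j) (f k) * T y (e y i) (e y j) (f k))"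
    unfolding f_def
    by (intro sum.cong refl trace_frame[OF y A(1,2), where b = "\<lambda>u v. \<Sum>k\<in>UNIV. F y (e y _) u (frame
        A k) * T y (e y _) v (frame A k)"]
      linear_sumI linear_multI linear_F linear_T y)
  also have "\<dots> = (\<Sum>i\<in>UNIV. \<Sum>j\<in>UNIV. \<Sum>k\<in>UNIV. F y (e y i) (e y j) (e y k) * T y (e y i) (e y j) (e y
      k))"
    unfolding f_def
    by (intro sum.cong refl trace_frame[OF y A(1,2), where b = "\<lambda>u v. F y (e y _) (e y _) u * T y (e
        y _) (e y _) v"]
      linear_sumI linear_multI linear_F linear_T y)
  also have "\<dots> = (\<Sum>i\<in>UNIV. cmat (t y) i i)"
    by (simp add: cmat_def phic_def t_def F_frame[OF y])
  finally show ?thesis .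
qed

lemma ric_frame:
  assumes y: "y \<in> V" and A: "invertible A" "\<And>u v. (A *v u) \<bullet> (A *v v) = g y u v"
  shows "(\<Sum>i\<in>UNIV. riem y (frame A i) u v (frame A i)) = ric y u v"
  unfolding ric_def by (rule trace_frame[OF y A]) (rule linear_riem[OF y])+

end

section \<open>Passage to the manifold\<close>

lemma cov_const: "cov \<Gamma> (\<lambda>_. u) (\<lambda>_. v) = (\<lambda>y. \<Gamma> y u v)"
  by (simp add: cov_def fun_eq_iff)

lemma lie_bracket_const: "lie_bracket (\<lambda>_. u) (\<lambda>_. v) = (\<lambda>_. 0)"
  by (simp add: lie_bracket_def fun_eq_iff)

lemma torsion_vec_const: "torsion_vec \<Gamma> (\<lambda>_. u) (\<lambda>_. v) y = tau \<Gamma> y u v"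
  by (simp add: torsion_vec_def cov_const lie_bracket_const tau_def)

lemma curvature_vec_const:
  assumes "bilinear (\<Gamma> y)"
  shows "curvature_vec \<Gamma> (\<lambda>_. u) (\<lambda>_. v) (\<lambda>_. w) y = curv \<Gamma> y u v w"
  using assms by (simp add: curvature_vec_def lie_bracket_const cov_const)
    (simp add: cov_def curv_def bilinear_lzero)

text \<open>A parallel tensor is tested on lists of every length; this disposes of the lengths other
  than its degree.\<close>

lemma cov_tensor_eq_0:
  assumes "open V" "x \<in> V" "\<And>y vs. y \<in> V \<Longrightarrow> length vs \<noteq> k \<Longrightarrow> \<omega> y vs = 0" "length vs \<noteq> k"
  shows "cov_tensor \<Gamma> \<omega> x u vs = 0"
proof -
  have "frechet_derivative (\<lambda>y. \<omega> y vs) (at x) = frechet_derivative (\<lambda>_. 0) (at x)"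
    by (rule frechet_derivative_cong_open(1)[OF assms(1,2)]) (simp add: assms)
  then show ?thesis
    using assms by (simp add: cov_tensor_def)
qed

lemma cov_tensor_2: "cov_tensor \<Gamma> \<omega> x u [v, w] =
    dd (\<lambda>y. \<omega> y [v, w]) x u - \<omega> x [\<Gamma> x u v, w] - \<omega> x [v, \<Gamma> x u w]"
  by (simp add: cov_tensor_def cov_const numeral_2_eq_2)

lemma cov_tensor_3: "cov_tensor \<Gamma> \<omega> x u [v, w, z] =
    dd (\<lambda>y. \<omega> y [v, w, z]) x u - \<omega> x [\<Gamma> x u v, w, z] - \<omega> x [v, \<Gamma> x u w, z] - \<omega> x [v, w, \<Gamma> x u z]"
  by (simp add: cov_tensor_def cov_const sum.lessThan_Suc)

lemma cov_tensor_4: "cov_tensor \<Gamma> \<omega> x u [a, b, c, d] =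
    dd (\<lambda>y. \<omega> y [a, b, c, d]) x u - \<omega> x [\<Gamma> x u a, b, c, d] - \<omega> x [a, \<Gamma> x u b, c, d]
     - \<omega> x [a, b, \<Gamma> x u c, d] - \<omega> x [a, b, c, \<Gamma> x u d]"
  by (simp add: cov_tensor_def cov_const sum.lessThan_Suc)

lemma ext_deriv_4: "ext_deriv \<omega> x [a, b, c, d] =
    dd (\<lambda>y. \<omega> y [b, c, d]) x a - dd (\<lambda>y. \<omega> y [a, c, d]) x b + dd (\<lambda>y. \<omega> y [a, b, d]) x c
    - dd (\<lambda>y. \<omega> y [a, b, c]) x d"
  by (simp add: ext_deriv_def sum.lessThan_Suc)

lemma length_3_cases: "length vs = 3 \<longleftrightarrow> (\<exists>u v w. vs = [u, v, w])"
  by (auto simp: length_Suc_conv numeral_3_eq_3)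

lemma length_4_cases: "length vs = 4 \<longleftrightarrow> (\<exists>a b c d. vs = [a, b, c, d])"
  by (auto simp: length_Suc_conv eval_nat_numeral)

lemma is_form_3_skew:
  assumes "is_form 3 \<omega>"
  shows "\<omega> [u, v, w] = - \<omega> [u, w, v]"
proof -
  have "\<forall>vs i. length vs = 3 \<and> i < 3 \<longrightarrow> linear (\<lambda>v. \<omega> (vs[i := v]))"
    using assms unfolding is_form_def by blast
  note f = this[rule_format]
  have l: "linear (\<lambda>a. \<omega> [u, a, w])" "linear (\<lambda>a. \<omega> [u, v, a])" for u v w
    using f[of "[u, v, w]" 1] f[of "[u, v, w]" 2] by (simp_all add: numeral_2_eq_2)
  have z: "\<omega> [u, a, a] = 0" for a
    using assms unfolding is_form_def by auto
  show ?thesis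
    using z[of "v + w"] z[of v] z[of w] by (simp add: linear_add[OF l(1)] linear_add[OF l(2)])
qed

locale g2_chart = g2_local V E "\<Gamma> c"
  for V E and \<Gamma> :: "'a connection" and c :: "'a chart" +
  fixes \<phi> :: "'a tensor_field"
  assumes adapted: "y \<in> V \<Longrightarrow> g2_adapted (\<phi> c y) (E y)"
begin

lemma metric: "y \<in> V \<Longrightarrow> g2_metric (\<phi> c y) u v = g y u v"
  unfolding met_def by (rule g2_metric_eq[OF adapted])

lemma phi_eq: "y \<in> V \<Longrightarrow> \<phi> c y [u, v, w] = F y u v w"
  using adapted[of y] by (simp add: g2_adapted_def g2_model_3 phi_at_def)

lemma phi_eq_0: "y \<in> V \<Longrightarrow> length vs \<noteq> 3 \<Longrightarrow> \<phi> c y vs = 0"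
  using adapted[of y] by (simp add: g2_adapted_def g2_model_eq_0)

lemma g2_coframe:
  assumes "y \<in> V"
  shows "g2_adapted (\<phi> c y) (g2_coframe (\<phi> c y))"
  unfolding g2_coframe_def using adapted[OF assms] by (rule someI)

lemma g2_coframe_simps:
  assumes "y \<in> V"
  shows "invertible (g2_coframe (\<phi> c y))"
    and "(g2_coframe (\<phi> c y) *v u) \<bullet> (g2_coframe (\<phi> c y) *v v) = g y u v"
    and "phi0 (g2_coframe (\<phi> c y) *v u) (g2_coframe (\<phi> c y) *v v) (g2_coframe (\<phi> c y) *v w) = F y u
        v w"
proof -
  show "invertible (g2_coframe (\<phi> c y))"
    using g2_coframe[OF assms] by (simp add: g2_adapted_def)
  show "(g2_coframe (\<phi> c y) *v u) \<bullet> (g2_coframe (\<phi> c y) *v v) = g y u v"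
    using metric[OF assms] by (simp add: g2_metric_def)
  have "\<phi> c y [u, v, w] = g2_model (g2_coframe (\<phi> c y)) [u, v, w]"
    using g2_coframe[OF assms] unfolding g2_adapted_def by metis
  then show "phi0 (g2_coframe (\<phi> c y) *v u) (g2_coframe (\<phi> c y) *v v) (g2_coframe (\<phi> c y) *v w) = F
      y u v w"
    using phi_eq[OF assms] by (simp add: g2_model_3)
qed

lemma torsion_eq: "y \<in> V \<Longrightarrow> torsion \<phi> \<Gamma> c y [u, v, w] = T y u v w"
  by (simp add: torsion_def tensor3_def torsion_vec_const metric T_def)

lemma torsion_eq_0: "length vs \<noteq> 3 \<Longrightarrow> torsion \<phi> \<Gamma> c y vs = 0"
  by (simp add: torsion_def tensor3_def)

lemma curvature_eq: "y \<in> V \<Longrightarrow> curvature \<phi> \<Gamma> c y u v w z = riem y u v w z"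
  by (simp add: curvature_def curvature_vec_const bilinear_\<Gamma> metric riem_def)

lemma ricci_eq: "y \<in> V \<Longrightarrow> ricci \<phi> \<Gamma> c y u v = ric y u v"
  by (simp add: ricci_def Let_def curvature_eq ric_frame g2_coframe_simps)

lemma cov_torsion:
  assumes "y \<in> V"
  shows "cov_tensor G (torsion \<phi> \<Gamma> c) y u [v, w, z] =
    dd (\<lambda>y. T y v w z) y u - T y (G y u v) w z - T y v (G y u w) z - T y v w (G y u z)"
proof -
  have "dd (\<lambda>y. torsion \<phi> \<Gamma> c y [v, w, z]) y = dd (\<lambda>y. T y v w z) y"
    by (rule frechet_derivative_cong_open(1)[OF open_V assms]) (rule torsion_eq)
  then show ?thesis
    by (simp add: cov_tensor_3 torsion_eq[OF assms])
qed

lemma parallel_torsion_iff: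
  assumes "y \<in> V"
  shows "(\<forall>u vs. cov_tensor (\<Gamma> c) (torsion \<phi> \<Gamma> c) y u vs = 0) \<longleftrightarrow> (\<forall>u v w z. P y u v w z = 0)"
proof
  assume "\<forall>u vs. cov_tensor (\<Gamma> c) (torsion \<phi> \<Gamma> c) y u vs = 0"
  then show "\<forall>u v w z. P y u v w z = 0"
    using cov_torsion[OF assms, of "\<Gamma> c"] by (simp add: P_def)
next
  assume P: "\<forall>u v w z. P y u v w z = 0"
  show "\<forall>u vs. cov_tensor (\<Gamma> c) (torsion \<phi> \<Gamma> c) y u vs = 0"
  proof (intro allI)
    fix u vs
    show "cov_tensor (\<Gamma> c) (torsion \<phi> \<Gamma> c) y u vs = 0"
    proof (cases "length vs = 3")
      case True
      then show ?thesis
        using P cov_torsion[OF assms, of "\<Gamma> c"] by (auto simp: length_3_cases P_def)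
    next
      case False
      then show ?thesis
        by (intro cov_tensor_eq_0[OF open_V assms]) (rule torsion_eq_0)
    qed
  qed
qed

lemma cov_torsion_levi_civita:
  assumes y: "y \<in> V" and sym: "\<And>u v. tau G y u v = 0"
    and met: "\<And>u v w. cov_tensor G (metric_field \<phi> c) y u [v, w] = 0"
  shows "cov_tensor G (torsion \<phi> \<Gamma> c) y u [v, w, z] =
    P y u v w z + (1 / 2) * (T y (\<tau> y u v) w z + T y (\<tau> y v w) u z + T y (\<tau> y w u) v z)"
  unfolding cov_torsion[OF y]
proof (rule P_levi_civita[OF y], rule levi_civita_eq[OF y])
  show "G y u v = G y v u" for u v
    using sym[of u v] by (simp add: tau_def)
  fix u v w
  have "dd (\<lambda>y. metric_field \<phi> c y [v, w]) y = dd (\<lambda>y. g y v w) y"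
    by (rule frechet_derivative_cong_open(1)[OF open_V y]) (simp add: metric_field_def tensor2_def
        metric)
  then show "dd (\<lambda>y. g y v w) y u = g y (G y u v) w + g y v (G y u w)"
    using met[of u v w] by (simp add: cov_tensor_2) (simp add: metric_field_def tensor2_def
        metric[OF y])
qed

lemma dphi_eq:
  assumes "y \<in> V"
  shows "dphi \<phi> c y [a, b, d, f] = dF y a b d f"
proof -
  have "dd (\<lambda>y. \<phi> c y [u, v, w]) y = dd (\<lambda>y. F y u v w) y" for u v w
    by (rule frechet_derivative_cong_open(1)[OF open_V assms]) (rule phi_eq)
  then show ?thesis
    by (simp add: dphi_def ext_deriv_4 ext_deriv_F[OF assms])
qed

lemma dphi_eq_0:
  assumes "y \<in> V" "length vs \<noteq> 4"
  shows "dphi \<phi> c y vs = 0"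
proof -
  have "dd (\<lambda>y. \<phi> c y (take i vs @ drop (Suc i) vs)) y = dd (\<lambda>_. 0) y" if "i < length vs" for i
    by (rule frechet_derivative_cong_open(1)[OF open_V assms(1)], rule phi_eq_0) (use that assms in
        auto)
  then show ?thesis
    by (simp add: dphi_def ext_deriv_def)
qed

lemma parallel_dphi:
  assumes y: "y \<in> V" and P: "\<And>u v w z. P y u v w z = 0"
  shows "cov_tensor (\<Gamma> c) (dphi \<phi> c) y u vs = 0"
proof (cases "length vs = 4")
  case True
  then obtain a b d f where vs: "vs = [a, b, d, f]"
    by (auto simp: length_4_cases)
  have "dd (\<lambda>y. dphi \<phi> c y [a, b, d, f]) y = dd (\<lambda>y. dF y a b d f) y"
    by (rule frechet_derivative_cong_open(1)[OF open_V y]) (rule dphi_eq)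
  then show ?thesis
    by (simp add: vs cov_tensor_4 dphi_eq[OF y] dF_parallel[OF y P])
next
  case False
  then show ?thesis
    by (intro cov_tensor_eq_0[OF open_V y]) (rule dphi_eq_0)
qed

lemma g2_inner_dphi:
  assumes "y \<in> V"
  shows "g2_inner (\<phi> c y) (dphi \<phi> c y) (star_phi \<phi> c y) = (\<Sum>i\<in>UNIV. cmat (t y) i i)"
proof -
  have "\<phi> c y = g2_model (g2_coframe (\<phi> c y))"
    using g2_coframe[OF assms] by (simp add: g2_adapted_def)
  then have "star_phi \<phi> c y = coframe_star (g2_coframe (\<phi> c y)) (g2_model (g2_coframe (\<phi> c y)))"
    unfolding star_phi_def g2_star_def by metis
  then show ?thesis
    using coframe_inner_star[OF g2_coframe_simps(1)[OF assms] dphi_eq_0[OF assms]]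
    unfolding g2_inner_def trace_dF[OF assms g2_coframe_simps[OF assms], symmetric]
    by (simp add: dphi_eq[OF assms])
qed

end


lemma g2_chart_exists:
  fixes \<Gamma> :: "'a::{t2_space, second_countable_topology} connection"
  assumes A: "g2_structure A \<phi>" "characteristic_connection A \<phi> \<Gamma>" "c \<in> A" "x \<in> chart_image c"
  obtains V E where "x \<in> V" "V \<subseteq> chart_image c" "g2_chart V E \<Gamma> c \<phi>"
proof -
  obtain V E where V: "open V" "x \<in> V" "V \<subseteq> chart_image c"
    and E: "smooth_fun_on V E" "\<forall>y\<in>V. g2_adapted (\<phi> c y) (E y)"
    using A(1,3,4) unfolding g2_structure_def by blast
  have \<Gamma>: "affine_connection A \<Gamma>" "parallel_tensor A \<Gamma> (metric_field \<phi>)" "parallel_tensor A \<Gamma> \<phi>"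
    "differential_form A 3 (torsion \<phi> \<Gamma>)"
    using A(2) by (simp_all add: characteristic_connection_def)
  have met: "g2_metric (\<phi> c y) u v = met E y u v" if "y \<in> V" for y u v
    unfolding met_def by (rule g2_metric_eq) (use E that in blast)
  have phi: "\<phi> c y [u, v, w] = phi_at E y u v w" if "y \<in> V" for y u v w
    using E(2) that by (simp add: g2_adapted_def g2_model_3 phi_at_def)
  have par: "cov_tensor (\<Gamma> c) (metric_field \<phi> c) y u vs = 0" "cov_tensor (\<Gamma> c) (\<phi> c) y u vs = 0"
    if "y \<in> V" for y u vs
    using \<Gamma>(2,3) V(3) A(3) that unfolding parallel_tensor_def by blast+
  have "g2_chart V E \<Gamma> c \<phi>"
  proof unfold_locales
    show "open V" by fact
    fix y assume y: "y \<in> V"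
    show "E differentiable (at y)"
      using E(1)[unfolded smooth_fun_on_def, rule_format, of 1] y by simp
    show "invertible (E y)" "g2_adapted (\<phi> c y) (E y)"
      using E(2) y by (simp_all add: g2_adapted_def)
    show "bilinear (\<Gamma> c y)"
      using \<Gamma>(1) V(3) A(3) y unfolding affine_connection_def by blast
    show "(\<lambda>y. \<Gamma> c y u v) differentiable (at y)" for u v
    proof -
      have "smooth_fun_on (chart_image c) (\<lambda>x. \<Gamma> c x u v)"
        using \<Gamma>(1) A(3) unfolding affine_connection_def by blast
      from this[unfolded smooth_fun_on_def, rule_format, of 1] show ?thesis
        using V(3) y by auto
    qed
    show "dd (\<lambda>y. met E y v w) y u = met E y (\<Gamma> c y u v) w + met E y v (\<Gamma> c y u w)" for u v w
    proof -
      have "dd (\<lambda>y. metric_field \<phi> c y [v, w]) y = dd (\<lambda>y. met E y v w) y"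
        by (rule frechet_derivative_cong_open(1)[OF V(1) y]) (simp add: metric_field_def tensor2_def
            met)
      then show ?thesis
        using par(1)[OF y, of u "[v, w]"]
        by (simp add: cov_tensor_2) (simp add: metric_field_def tensor2_def met[OF y])
    qed
    show "dd (\<lambda>y. phi_at E y v w z) y u = phi_at E y (\<Gamma> c y u v) w z
        + phi_at E y v (\<Gamma> c y u w) z + phi_at E y v w (\<Gamma> c y u z)" for u v w z
    proof -
      have "dd (\<lambda>y. \<phi> c y [v, w, z]) y = dd (\<lambda>y. phi_at E y v w z) y"
        by (rule frechet_derivative_cong_open(1)[OF V(1) y]) (rule phi)
      then show ?thesis
        using par(2)[OF y, of u "[v, w, z]"] by (simp add: cov_tensor_3 phi[OF y])
    qed
    show "met E y (tau (\<Gamma> c) y u v) w = - met E y (tau (\<Gamma> c) y u w) v" for u v w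
    proof -
      have "is_form 3 (torsion \<phi> \<Gamma> c y)"
        using \<Gamma>(4) V(3) A(3) y unfolding differential_form_def by blast
      from is_form_3_skew[OF this, of u v w] show ?thesis
        by (simp add: torsion_def tensor3_def torsion_vec_const met[OF y])
    qed
  qed
  then show ?thesis
    using that V by blast
qed

section \<open>The equivalence, assembled chart by chart\<close>

theorem theorem1p2:
  fixes A :: "('a::{t2_space, second_countable_topology}) chart set"
    and \<phi> :: "'a tensor_field"
    and nabla nabla_g :: "'a connection"
  assumes "smooth_atlas A"
    and "g2_structure A \<phi>"
    and "integrable_g2 A \<phi>"
    and "constant_type A \<phi>"
    and "levi_civita A \<phi> nabla_g"
    and "characteristic_connection A \<phi> nabla"
  shows
    "let R = curvature \<phi> nabla; Ric = ricci \<phi> nabla; T = torsion \<phi> nabla;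
       cond_a = ((\<forall>c\<in>A. \<forall>x\<in>chart_image c. \<forall>X Y Z V. R c x X Y Z V = R c x Z V X Y) \<and>
                 (\<forall>c\<in>A. \<forall>x\<in>chart_image c. \<forall>X Y. Ric c x X Y = 0));
       cond_b = (\<forall>c\<in>A. \<forall>x\<in>chart_image c. \<forall>X Y Z V.
                   R c x X Y Z V + R c x Y Z X V + R c x Z X Y V = 0);
       cond_c = (parallel_tensor A nabla_g T \<and> parallel_tensor A nabla T)
     in (cond_a \<longleftrightarrow> cond_b) \<and> (cond_b \<longleftrightarrow> cond_c) \<and>
        (cond_a \<or> cond_b \<or> cond_c \<longrightarrow> parallel_tensor A nabla (dphi \<phi>))"
proof -
  let ?R = "curvature \<phi> nabla" and ?T = "torsion \<phi> nabla"
  let ?a = "(\<forall>c\<in>A. \<forall>x\<in>chart_image c. \<forall>X Y Z V. ?R c x X Y Z V = ?R c x Z V X Y) \<and>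
    (\<forall>c\<in>A. \<forall>x\<in>chart_image c. \<forall>X Y. ricci \<phi> nabla c x X Y = 0)"
  let ?b = "\<forall>c\<in>A. \<forall>x\<in>chart_image c. \<forall>X Y Z V. ?R c x X Y Z V + ?R c x Y Z X V + ?R c x Z X Y V = 0"
  let ?c = "parallel_tensor A nabla_g ?T \<and> parallel_tensor A nabla ?T"
  let ?nabla_T = "parallel_tensor A nabla ?T"
  note chart = g2_chart_exists[OF assms(2,6)]
  obtain \<kappa> where \<kappa>: "\<And>c x. c \<in> A \<Longrightarrow> x \<in> chart_image c \<Longrightarrow>
      g2_inner (\<phi> c x) (dphi \<phi> c x) (star_phi \<phi> c x) = \<kappa>"
    using assms(4) unfolding constant_type_def by blast
  have lc: "cov_tensor (nabla_g c) (?T c) x u [v, w, z] = g2_local.P E (nabla c) x u v w z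
      + (1 / 2) * (g2_local.T E (nabla c) x (tau (nabla c) x u v) w z
        + g2_local.T E (nabla c) x (tau (nabla c) x v w) u z + g2_local.T E (nabla c) x (tau (nabla
            c) x w u) v z)"
    if c: "c \<in> A" and x: "x \<in> V" and V: "V \<subseteq> chart_image c" and loc: "g2_chart V E nabla c \<phi>"
    for c x V E u v w z
  proof (rule g2_chart.cov_torsion_levi_civita[OF loc x])
    show "tau (nabla_g c) x u v = 0" for u v
      using assms(5) c x V by (auto simp: levi_civita_def torsion_vec_const)
    show "cov_tensor (nabla_g c) (metric_field \<phi> c) x u [v, w] = 0" for u v w
      using assms(5) c x V unfolding levi_civita_def parallel_tensor_def by blast
  qed
  have ab: ?b if a: ?a
  proof (intro ballI allI)
    fix c x X Y Z U assume c: "c \<in> A" "x \<in> chart_image c"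
    obtain V E where V: "x \<in> V" "V \<subseteq> chart_image c" and loc: "g2_chart V E nabla c \<phi>"
      using chart[OF c] .
    interpret g2_chart V E nabla c \<phi> by (rule loc)
    have "?R c x u v w z = ?R c x w z u v" "ricci \<phi> nabla c x u v = 0" for u v w z
      using a c by blast+
    then have "bianchi_sum x X Y Z U = 0"
      unfolding curvature_eq[OF V(1)] ricci_eq[OF V(1)]
      by (rule bianchi_if_pair_symmetric_ricci_flat[OF V(1)])
    then show "?R c x X Y Z U + ?R c x Y Z X U + ?R c x Z X Y U = 0"
      by (simp add: bianchi_sum_def curvature_eq[OF V(1)])
  qed
  have bianchi_sum: "g2_local.bianchi_sum E (nabla c) y X Y Z U = 0"
    if b: ?b and c: "c \<in> A" and V: "V \<subseteq> chart_image c" and loc: "g2_chart V E nabla c \<phi>" and y: "y \<in>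
        V"
    for c V E y X Y Z U
  proof -
    interpret g2_chart V E nabla c \<phi> by (rule loc)
    have "?R c y X Y Z U + ?R c y Y Z X U + ?R c y Z X Y U = 0"
      using b c V y by blast
    then show ?thesis
      by (simp add: bianchi_sum_def curvature_eq[OF y])
  qed
  have ba: ?a if b: ?b
  proof (intro conjI ballI allI)
    fix c x X Y assume c: "c \<in> A" "x \<in> chart_image c"
    obtain V E where V: "x \<in> V" "V \<subseteq> chart_image c" and loc: "g2_chart V E nabla c \<phi>"
      using chart[OF c] .
    interpret g2_chart V E nabla c \<phi> by (rule loc)
    note b' = bianchi_sum[OF b c(1) V(2) loc V(1)]
    show "?R c x X Y Z U = ?R c x Z U X Y" for Z U
      using riem_pair_symmetric[OF V(1) b'] by (simp add: curvature_eq[OF V(1)])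
    show "ricci \<phi> nabla c x X Y = 0"
      using ric_eq_0_if_bianchi[OF V(1) b'] by (simp add: ricci_eq[OF V(1)])
  qed
  have bc: ?c if b: ?b
    unfolding parallel_tensor_def
  proof (intro conjI ballI allI)
    fix c x u vs assume c: "c \<in> A" "x \<in> chart_image c"
    obtain V E where V: "x \<in> V" "V \<subseteq> chart_image c" and loc: "g2_chart V E nabla c \<phi>"
      using chart[OF c] .
    interpret g2_chart V E nabla c \<phi> by (rule loc)
    \<comment> \<open>The identity is kept for all points of \<open>V\<close>, since the vanishing
      of \<open>P\<close> at \<open>x\<close> is obtained by differentiating its
      consequences.\<close>
    note b' = bianchi_sum[OF b c(1) V(2) loc]
    have "(\<Sum>i\<in>UNIV. cmat (t y) i i) = \<kappa>" if "y \<in> V" for y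
      using g2_inner_dphi[OF that] \<kappa>[OF c(1)] V(2) that by auto
    then have P: "P x u v w z = 0" for u v w z
      using P_eq_0_if_bianchi[OF b' _ V(1)] by blast
    then show "cov_tensor (nabla c) (?T c) x u vs = 0"
      using parallel_torsion_iff[OF V(1)] by blast
    show "cov_tensor (nabla_g c) (?T c) x u vs = 0"
    proof (cases "length vs = 3")
      case True
      then obtain v w z where vs: "vs = [v, w, z]"
        by (auto simp: length_3_cases)
      \<comment> \<open>With \<open>P = 0\<close> the Bianchi sum is \<sigma>, so \<sigma> vanishes
        and with it the Levi-Civita derivative \<open>P + \<sigma> / 2\<close>.\<close>
      show ?thesis
        using bianchi_sum_torsion[OF V(1), of u v w z] b'[OF V(1)]
        unfolding vs lc[OF c(1) V loc] by (simp add: P)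
    next
      case False
      then show ?thesis
        by (intro cov_tensor_eq_0[OF open_V V(1)]) (rule torsion_eq_0)
    qed
  qed
  have P: "g2_local.P E (nabla c) x u v w z = 0"
    if c: ?nabla_T "c \<in> A" and x: "x \<in> V" and V: "V \<subseteq> chart_image c" and loc: "g2_chart V E nabla c
        \<phi>"
    for c x V E u v w z
    using g2_chart.parallel_torsion_iff[OF loc x] c x V unfolding parallel_tensor_def by blast
  have cb: ?b if c': ?c
  proof (intro ballI allI)
    fix c x X Y Z U assume c: "c \<in> A" "x \<in> chart_image c"
    obtain V E where V: "x \<in> V" "V \<subseteq> chart_image c" and loc: "g2_chart V E nabla c \<phi>"
      using chart[OF c] .
    interpret g2_chart V E nabla c \<phi> by (rule loc)
    have P0: "P x u v w z = 0" for u v w z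
      using P[OF _ c(1) V loc] c' by blast
    \<comment> \<open>The two derivatives of the torsion differ by half of \<sigma>; as both vanish,
      so do \<sigma> and the Bianchi sum.\<close>
    have "cov_tensor (nabla_g c) (?T c) x X [Y, Z, U] = 0"
      using c' c unfolding parallel_tensor_def by blast
    then have "bianchi_sum x X Y Z U = 0"
      unfolding bianchi_sum_torsion[OF V(1)] lc[OF c(1) V loc] by (simp add: P0)
    then show "?R c x X Y Z U + ?R c x Y Z X U + ?R c x Z X Y U = 0"
      by (simp add: bianchi_sum_def curvature_eq[OF V(1)])
  qed
  \<comment> \<open>Each of the three conditions implies \<open>\<nabla>T = 0\<close>, from which
    the last claim follows.\<close>
  have d: "parallel_tensor A nabla (dphi \<phi>)" if T: ?nabla_T
    unfolding parallel_tensor_def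
  proof (intro ballI allI)
    fix c x u vs assume c: "c \<in> A" "x \<in> chart_image c"
    obtain V E where V: "x \<in> V" "V \<subseteq> chart_image c" and loc: "g2_chart V E nabla c \<phi>"
      using chart[OF c] .
    show "cov_tensor (nabla c) (dphi \<phi> c) x u vs = 0"
      by (rule g2_chart.parallel_dphi[OF loc V(1) P[OF T c(1) V loc]])
  qed
  show ?thesis
    unfolding Let_def using ab ba bc cb d by blast
qed

end
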